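(* Let $G$ be a countable, simple, undirected, connected graph, not isomorphic to $\mathbb Z$, all of whose vertices have finite degree, with finitely many infinite branches $Q_i$, $i\in I=\{1,\dots,N\}$, such that $G\setminus\bigcup_{i\in I}Q_i$ is finite. For each $i\in I$ let $\varphi_i:\mathbb N\to Q_i$ be the graph isomorphism. Let $\mathcal L$ be a generator on $G$ such that for all $x\ne y$ in $G$, $\mathcal L_{x,y}\neq 0$ if and only if $x$ and $y$ are adjacent. Assume that $\mathcal L$ is positive recurrent and nonexplosive, with (unique) stationary probability $\mu$, that it is reversible, i.e. $\mu(p)\mathcal L_{p,q}=\mu(q)\mathcal L_{q,p}$ for all $p,q\in G$, and that $\sum_{p\in G}\mu(p)|\mathcal L_{p,p}|<\infty$. Put $$\mu^i(n):=\prod_{k=0}^{n-1}\frac{\mathcal L_{\varphi_i(k),\varphi_i(k+1)}}{\mathcal L_{\varphi_i(k+1),\varphi_i(k)}},\qquad i\in I,\ n\in\mathbb N .$$ Then the following are equivalent: (a) for every initial distribution $\mu_0$ on $G$, the Markov process $X$ with generator $\mathcal L$ and initial distribution $\mu_0$ has a finite strong stationary time; (b) for every $i\in I$, $$\sum_{j=1}^{\infty}\mu^i(j+1)\sum_{k=1}^{j}\frac{1}{\mu^i(k)\,\mathcal L_{\varphi_i(k),\varphi_i(k+1)}}<\infty .$$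
   Context: $\mathbb N=\{0,1,2,\dots\}$, with $n,m$ adjacent iff $|n-m|=1$. An infinite branch of $G$ is a maximal (for inclusion) infinite connected set of vertices all of which have degree $2$ in $G$. Since $G$ is connected and not isomorphic to $\mathbb Z$, each infinite branch is isomorphic as a graph to $\mathbb N$, by a unique isomorphism. A generator on a countable set $S$ is a matrix $(\mathcal L_{x,y})_{x,y\in S}$ with $0\le \mathcal L_{x,y}<\infty$ for $x\neq y$ and $\sum_{y\ne x}\mathcal L_{x,y}=-\mathcal L_{x,x}<\infty$. The associated (minimal) process is the right-continuous jump process which stays at $x$ for an exponential time of parameter $-\mathcal L_{x,x}$ and then jumps to $y\neq x$ with probability $\mathcal L_{x,y}/(-\mathcal L_{x,x})$; $\mathcal L$ is nonexplosive if almost surely, for every initial law, the jump times tend to infinity. Let $\mathcal F^X_t$ be the filtration generated by $X$ and $\mathcal F^X_\infty=\bigvee_t\mathcal F^X_t$. A random time $T\in[0,\infty]$ is a randomized stopping time relative to $X$ if there is a $\sigma$-algebra $\mathcal G$ independent of $\mathcal F^X_\infty$ such that $T$ is a stopping time with respect to $(\sigma(\mathcal F^X_t,\mathcal G))_{t\ge 0}$. A strong stationary time of $X$ is a randomized stopping time $T$ relative to $X$ such that, on $\{T<\infty\}$, the conditional law of $X_T$ given $T$ is $\mu$. It is finite if $T<\infty$ almost surely. The underlying probability space is assumed to be large enough (it may be enlarged by random variables independent of $X$). *)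

theory Defs
  imports "HOL-Probability.Probability"
begin

section \<open>Graphs\<close>

text \<open>A simple undirected graph is a symmetric irreflexive adjacency relation \<open>E\<close>; the vertex set
  of \<open>G\<close> is a whole (countable) type.\<close>

definition graph_iso ::
  "'a set \<Rightarrow> ('a \<Rightarrow> 'a \<Rightarrow> bool) \<Rightarrow> 'b set \<Rightarrow> ('b \<Rightarrow> 'b \<Rightarrow> bool) \<Rightarrow> ('a \<Rightarrow> 'b) \<Rightarrow> bool" where
  "graph_iso V E W F f \<longleftrightarrow> bij_betw f V W \<and> (\<forall>x\<in>V. \<forall>y\<in>V. E x y \<longleftrightarrow> F (f x) (f y))"

definition int_adj :: "int \<Rightarrow> int \<Rightarrow> bool" where
  "int_adj n m \<longleftrightarrow> \<bar>n - m\<bar> = 1"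

definition nat_adj :: "nat \<Rightarrow> nat \<Rightarrow> bool" where
  "nat_adj n m \<longleftrightarrow> \<bar>int n - int m\<bar> = 1"

definition connected_vertices :: "('a \<Rightarrow> 'a \<Rightarrow> bool) \<Rightarrow> 'a set \<Rightarrow> bool" where
  "connected_vertices E Q \<longleftrightarrow> (\<forall>x\<in>Q. \<forall>y\<in>Q. (\<lambda>u v. u \<in> Q \<and> v \<in> Q \<and> E u v)\<^sup>*\<^sup>* x y)"

definition branch_candidate :: "('a \<Rightarrow> 'a \<Rightarrow> bool) \<Rightarrow> 'a set \<Rightarrow> bool" where
  "branch_candidate E Q \<longleftrightarrow>
     infinite Q \<and> connected_vertices E Q \<and> (\<forall>x\<in>Q. card {y. E x y} = 2)"

definition infinite_branch :: "('a \<Rightarrow> 'a \<Rightarrow> bool) \<Rightarrow> 'a set \<Rightarrow> bool" where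
  "infinite_branch E Q \<longleftrightarrow>
     branch_candidate E Q \<and> (\<forall>Q'. branch_candidate E Q' \<longrightarrow> Q \<subseteq> Q' \<longrightarrow> Q' = Q)"

definition branch_measure :: "('a \<Rightarrow> 'a \<Rightarrow> real) \<Rightarrow> (nat \<Rightarrow> 'a) \<Rightarrow> nat \<Rightarrow> real" where
  "branch_measure L \<phi> n = (\<Prod>k<n. L (\<phi> k) (\<phi> (k + 1)) / L (\<phi> (k + 1)) (\<phi> k))"


section \<open>Generators and their jump processes\<close>

definition generator :: "('a \<Rightarrow> 'a \<Rightarrow> real) \<Rightarrow> bool" where
  "generator L \<longleftrightarrow>
     (\<forall>x y. x \<noteq> y \<longrightarrow> 0 \<le> L x y) \<and> (\<forall>x. ((\<lambda>y. L x y) has_sum (- L x x)) (- {x}))"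

text \<open>A state \<open>x\<close> with \<open>L x x = 0\<close> is absorbing: its holding time is infinite, and by convention
  the jump chain stays there.\<close>

definition jump_prob :: "('a \<Rightarrow> 'a \<Rightarrow> real) \<Rightarrow> 'a \<Rightarrow> 'a \<Rightarrow> real" where
  "jump_prob L x y =
     (if L x x = 0 then (if x = y then 1 else 0)
      else if x = y then 0 else L x y / (- L x x))"

text \<open>\<open>Y\<close> is the sequence of visited states and \<open>H\<close> the sequence of holding times: \<open>Y\<close> is a Markov
  chain with transition probabilities \<open>jump_prob L\<close> and initial law \<open>\<mu>0\<close>, and given \<open>Y\<close> the \<open>H k\<close>
  are independent, exponential of parameter \<open>- L (Y k) (Y k)\<close>, i.e.\ with tails
  \<open>exp (L (Y k) (Y k) * t)\<close>. For parameter \<open>0\<close> the formula forces \<open>H k = \<infinity>\<close> almost surely.\<close>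

definition jump_chain_holding ::
  "'w measure \<Rightarrow> ('a \<Rightarrow> 'a \<Rightarrow> real) \<Rightarrow> 'a pmf \<Rightarrow> (nat \<Rightarrow> 'w \<Rightarrow> 'a) \<Rightarrow> (nat \<Rightarrow> 'w \<Rightarrow> ennreal) \<Rightarrow> bool" where
  "jump_chain_holding M L \<mu>0 Y H \<longleftrightarrow>
     prob_space M \<and>
     (\<forall>n. Y n \<in> measurable M (count_space UNIV)) \<and>
     (\<forall>n. H n \<in> borel_measurable M) \<and>
     (\<forall>n. \<forall>y :: nat \<Rightarrow> 'a. \<forall>t :: nat \<Rightarrow> real. (\<forall>k. 0 \<le> t k) \<longrightarrow>
        measure M {\<omega> \<in> space M. \<forall>k\<le>n. Y k \<omega> = y k \<and> ennreal (t k) < H k \<omega>} =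
          pmf \<mu>0 (y 0) * (\<Prod>k<n. jump_prob L (y k) (y (Suc k)))
                       * (\<Prod>k\<le>n. exp (L (y k) (y k) * t k)))"

definition jump_time :: "(nat \<Rightarrow> 'w \<Rightarrow> ennreal) \<Rightarrow> nat \<Rightarrow> 'w \<Rightarrow> ennreal" where
  "jump_time H n \<omega> = (\<Sum>k<n. H k \<omega>)"

text \<open>The process is only used for nonexplosive generators; on the then negligible event of
  explosion, the path after explosion is constrained only by right-continuity for the discrete
  topology.\<close>

definition markov_jump_process ::
  "'w measure \<Rightarrow> ('a \<Rightarrow> 'a \<Rightarrow> real) \<Rightarrow> 'a pmf \<Rightarrow> (real \<Rightarrow> 'w \<Rightarrow> 'a) \<Rightarrow> bool" where
  "markov_jump_process M L \<mu>0 X \<longleftrightarrow>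
     (\<forall>t\<ge>0. X t \<in> measurable M (count_space UNIV)) \<and>
     (\<forall>\<omega>\<in>space M. \<forall>t\<ge>0. \<forall>\<^sub>F s in at_right t. X s \<omega> = X t \<omega>) \<and>
     (\<exists>Y H. jump_chain_holding M L \<mu>0 Y H \<and>
        (\<forall>\<omega>\<in>space M. \<forall>t\<ge>0. \<forall>n.
           jump_time H n \<omega> \<le> ennreal t \<and> ennreal t < jump_time H (Suc n) \<omega> \<longrightarrow> X t \<omega> = Y n \<omega>))"

text \<open>Properties of the law of the process are stated for all realizations on probability spaces
  with sample points in a type \<open>'w\<close>; they have their intended meaning as soon as \<open>'w\<close> has at least
  the cardinality of the continuum, so that realizations exist.\<close>

definition nonexplosive :: "'w itself \<Rightarrow> ('a \<Rightarrow> 'a \<Rightarrow> real) \<Rightarrow> bool" where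
  "nonexplosive W L \<longleftrightarrow>
     (\<forall>\<mu>0 (M :: 'w measure) Y H. jump_chain_holding M L \<mu>0 Y H \<longrightarrow>
        (AE \<omega> in M. (\<lambda>n. jump_time H n \<omega>) \<longlonglongrightarrow> \<infinity>))"

text \<open>The first time at or after the first jump at which the process is in \<open>x\<close>; it is \<open>\<infinity>\<close> if there
  is none.\<close>

definition return_time ::
  "(nat \<Rightarrow> 'w \<Rightarrow> 'a) \<Rightarrow> (nat \<Rightarrow> 'w \<Rightarrow> ennreal) \<Rightarrow> 'a \<Rightarrow> 'w \<Rightarrow> ennreal" where
  "return_time Y H x \<omega> = (INF n\<in>{n. 1 \<le> n \<and> Y n \<omega> = x}. jump_time H n \<omega>)"

definition positive_recurrent :: "'w itself \<Rightarrow> ('a \<Rightarrow> 'a \<Rightarrow> real) \<Rightarrow> bool" where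
  "positive_recurrent W L \<longleftrightarrow>
     (\<forall>x. L x x = 0 \<or>
        (\<forall>(M :: 'w measure) Y H. jump_chain_holding M L (return_pmf x) Y H \<longrightarrow>
           (\<integral>\<^sup>+ \<omega>. return_time Y H x \<omega> \<partial>M) < \<infinity>))"

definition stationary :: "('a \<Rightarrow> 'a \<Rightarrow> real) \<Rightarrow> 'a pmf \<Rightarrow> bool" where
  "stationary L \<mu> \<longleftrightarrow> (\<forall>q. ((\<lambda>p. pmf \<mu> p * L p q) has_sum 0) UNIV)"

definition reversible :: "('a \<Rightarrow> 'a \<Rightarrow> real) \<Rightarrow> 'a pmf \<Rightarrow> bool" where
  "reversible L \<mu> \<longleftrightarrow> (\<forall>p q. pmf \<mu> p * L p q = pmf \<mu> q * L q p)"


section \<open>Strong stationary times\<close>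

text \<open>Times are extended nonnegative reals, so that the filtration also has an index \<open>\<infinity>\<close>, where it
  is generated by the whole process.\<close>

definition natural_filtration ::
  "'w measure \<Rightarrow> (real \<Rightarrow> 'w \<Rightarrow> 'a) \<Rightarrow> ennreal \<Rightarrow> 'w measure" where
  "natural_filtration M X t =
     sigma (space M) {X s -` A \<inter> space M | s A. 0 \<le> s \<and> ennreal s \<le> t}"

definition randomized_stopping_time ::
  "'w measure \<Rightarrow> (real \<Rightarrow> 'w \<Rightarrow> 'a) \<Rightarrow> ('w \<Rightarrow> ennreal) \<Rightarrow> bool" where
  "randomized_stopping_time M X T \<longleftrightarrow>
     (\<exists>\<G>. sigma_algebra (space M) \<G> \<and>
          prob_space.indep_set M \<G> (sets (natural_filtration M X \<infinity>)) \<and>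
          stopping_time (\<lambda>t. sigma (space M) (sets (natural_filtration M X t) \<union> \<G>)) T)"

text \<open>On \<open>T < \<infinity>\<close> the conditional probability of \<open>X_T = x\<close> given \<open>T\<close> is \<open>\<mu> x\<close>, for every \<open>x\<close>.\<close>

definition strong_stationary_time ::
  "'w measure \<Rightarrow> (real \<Rightarrow> 'w \<Rightarrow> 'a) \<Rightarrow> 'a pmf \<Rightarrow> ('w \<Rightarrow> ennreal) \<Rightarrow> bool" where
  "strong_stationary_time M X \<mu> T \<longleftrightarrow>
     randomized_stopping_time M X T \<and>
     (\<forall>x. AE \<omega> in M. T \<omega> < \<infinity> \<longrightarrow>
        real_cond_exp M (vimage_algebra (space M) T borel)
          (indicator {\<omega> \<in> space M. X (enn2real (T \<omega>)) \<omega> = x}) \<omega> = pmf \<mu> x)"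

text \<open>The probability space may be enlarged by a random variable independent of \<open>X\<close>, of arbitrary
  law \<open>K\<close>.\<close>

definition has_finite_strong_stationary_time ::
  "'w measure \<Rightarrow> (real \<Rightarrow> 'w \<Rightarrow> 'a) \<Rightarrow> 'a pmf \<Rightarrow> bool" where
  "has_finite_strong_stationary_time M X \<mu> \<longleftrightarrow>
     (\<exists>(K :: real measure) T. prob_space K \<and>
        strong_stationary_time (M \<Otimes>\<^sub>M K) (\<lambda>t \<omega>. X t (fst \<omega>)) \<mu> T \<and>
        (AE \<omega> in M \<Otimes>\<^sub>M K. T \<omega> < \<infinity>))"

end

theory Submission
  imports Defs
begin

text \<open>Write \<open>R z y\<close> for the resolvent \<open>\<integral>\<^sub>0\<^sup>\<infinity> exp (- t) P\<^sub>t(z, y) dt\<close>. After a finite strong stationary time the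
  process restarts from the stationary law \<open>\<mu>\<close>, so its existence from the start \<open>z\<close> forces
  \<open>R z y \<ge> c * \<mu> y\<close> for some \<open>c > 0\<close>. Conversely, by reversibility and by waiting at \<open>z\<close>, such a bound
  yields a minorization \<open>P\<^sub>h(x, y) \<ge> \<epsilon> * \<mu> y\<close>; stopping the chain observed at the multiples of \<open>h\<close>
  with conditional probability \<open>\<epsilon> * \<mu> y / P\<^sub>h(x, y)\<close> at each step gives a geometric strong stationary
  time, from every initial law.

  By reversibility \<open>g = R z / \<mu>\<close> satisfies \<open>g = L g\<close> away from \<open>z\<close>. Along a branch with
  weights \<open>m\<close> and conductances \<open>c\<close> this says that the flux \<open>c n * (g n - g (n + 1))\<close> decreases by
  \<open>m n * g n\<close> at \<open>n\<close>. The flux tends to 0 because the jump rates are \<open>\<mu>\<close>-integrable, hence it equals the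
  sum of \<open>m j * g j\<close> over \<open>j > n\<close>, and \<open>g\<close> is bounded below if and only if the sum of
  \<open>(\<Sum>j>n. m j) / c n\<close> over \<open>n\<close> converges, which is condition (b).\<close>

section \<open>Functions on a branch\<close>

text \<open>The resolvent reduces the problem to a linear recursion along each branch. To return to
  a fixed time \<open>\<tau>\<close>, note that for \<open>t \<le> \<tau>\<close> both
  \<open>P\<^sub>t(z, y)\<close> and \<open>P\<^sub>t(x, z)\<close> are at most a constant times
  their values at \<open>\<tau>\<close>, since the process can wait at \<open>z\<close>. Times
  beyond \<open>\<tau>\<close> contribute little to \<open>R z y\<close>, because
  \<open>P\<^sub>t(z, y) \<le> \<mu> y / \<mu> z\<close>; this bound is proportional to
  \<open>\<mu> y\<close>, so one \<open>\<tau>\<close> serves every \<open>y\<close>. Reversibility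
  gives \<open>R x z \<ge> c * \<mu> z\<close> uniformly in \<open>x\<close>.

  The probabilistic obstacle is that a realization is known only through cylinder probabilities of
  the jump chain and its holding times. The transition probabilities are therefore defined
  analytically, by recursion over the number of jumps, and then identified with conditional
  probabilities given the history. Facts that rest on nonexplosion, such as total mass 1, are read
  off from a realization, which has to be built on the given type of sample points.\<close>

lemma summable_on_atLeast_1_iff:
  fixes f :: "nat \<Rightarrow> real"
  assumes "\<And>j. f j \<ge> 0" "f 0 = 0"
  shows "f summable_on {1..} \<longleftrightarrow> summable f"
proof -
  have "f summable_on {1..} \<longleftrightarrow> f summable_on UNIV"
    by (rule summable_on_cong_neutral) (use assms in \<open>auto simp: not_le\<close>)
  also have "\<dots> \<longleftrightarrow> summable f"
    using assms by (intro summable_on_UNIV_nonneg_real_iff) auto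
  finally show ?thesis .
qed

text \<open>With \<open>m\<close> the stationary weights and \<open>b\<close> the inverse conductances along a branch, the
  right-hand side is condition (b) and the left-hand side the mean descent time from infinity.\<close>

lemma summable_tail_iff:
  fixes m b :: "nat \<Rightarrow> real"
  assumes m: "\<And>n. m n \<ge> 0" "summable m" and b: "\<And>n. b n \<ge> 0"
  shows "summable (\<lambda>k. b (Suc k) * (\<Sum>j. m (j + Suc (Suc k)))) \<longleftrightarrow>
         (\<lambda>j. m (j + 1) * (\<Sum>k=1..j. b k)) summable_on {1..}"
proof -
  have "(\<lambda>j. m (j + 1) * (\<Sum>k=1..j. b k)) summable_on {1..} \<longleftrightarrow>
        summable (\<lambda>j. m (j + 1) * (\<Sum>k=1..j. b k))"
    by (rule summable_on_atLeast_1_iff) (auto intro!: mult_nonneg_nonneg sum_nonneg m b)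
  also have "\<dots> \<longleftrightarrow> summable (\<lambda>k. b (Suc k) * (\<Sum>j. m (j + Suc (Suc k))))"
  proof -
    \<comment> \<open>The double array lives on \<open>k \<le> j\<close>: its row sums form the left
      series, its column sums the right one, and Tonelli in \<open>ennreal\<close> compares
      them.\<close>
    define f where "f k j = (if k \<le> j then b (Suc k) * m (Suc (Suc j)) else 0)" for k j
    have f0: "f k j \<ge> 0" for k j
      using m b by (auto simp: f_def)
    have rows: "f k sums (b (Suc k) * (\<Sum>j. m (j + Suc (Suc k))))" for k
    proof -
      have "summable (\<lambda>j. m (j + Suc (Suc k)))"
        using m(2) by (subst summable_iff_shift)
      hence "(\<lambda>j. b (Suc k) * m (j + Suc (Suc k))) sums (b (Suc k) * (\<Sum>j. m (j + Suc (Suc k))))"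
        by (intro sums_mult summable_sums)
      hence "(\<lambda>j. f k (j + k)) sums (b (Suc k) * (\<Sum>j. m (j + Suc (Suc k))))"
        by (simp add: f_def add.commute add.left_commute)
      hence "f k sums (b (Suc k) * (\<Sum>j. m (j + Suc (Suc k))) + (\<Sum>i<k. f k i))"
        by (subst (asm) sums_iff_shift) auto
      moreover have "(\<Sum>i<k. f k i) = 0"
        by (auto simp: f_def intro!: sum.neutral)
      ultimately show ?thesis by simp
    qed
    have cols: "(\<lambda>k. f k j) sums (m (Suc j + 1) * (\<Sum>k=1..Suc j. b k))" for j
    proof -
      have "(\<lambda>k. f k j) sums (\<Sum>k\<in>{..j}. f k j)"
        by (rule sums_finite) (auto simp: f_def)
      also have "(\<Sum>k\<in>{..j}. f k j) = (\<Sum>k\<le>j. b (Suc k)) * m (Suc (Suc j))"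
        by (simp add: f_def sum_distrib_right)
      also have "(\<Sum>k\<le>j. b (Suc k)) = (\<Sum>k=1..Suc j. b k)"
        using sum.shift_bounds_cl_Suc_ivl[of b 0 j] by (simp add: atMost_atLeast0)
      finally show ?thesis by (simp add: mult.commute)
    qed
    have nn: "(\<Sum>n. ennreal (a n)) < \<infinity> \<longleftrightarrow> summable a" if "\<And>n. a n \<ge> 0" for a :: "nat \<Rightarrow> real"
      using that summable_suminf_not_top[of a] suminf_ennreal2[of a]
      by (metis ennreal_less_top infinity_ennreal_def less_top)
    have "(\<Sum>k. ennreal (b (Suc k) * (\<Sum>j. m (j + Suc (Suc k))))) = (\<Sum>k. \<Sum>j. ennreal (f k j))"
      using rows f0 by (intro suminf_cong) (simp add: suminf_ennreal2 sums_iff)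
    also have "\<dots> = (\<Sum>j. \<Sum>k. ennreal (f k j))"
      unfolding nn_integral_count_space_nat[symmetric]
      by (rule nn_integral_fst_count_space[of "\<lambda>(i,j). ennreal (f i j)", simplified, THEN trans])
         (rule nn_integral_snd_count_space[of "\<lambda>(i,j). ennreal (f i j)", simplified, symmetric])
    also have "\<dots> = (\<Sum>j. ennreal (m (Suc j + 1) * (\<Sum>k=1..Suc j. b k)))"
      using cols f0 by (intro suminf_cong) (simp add: suminf_ennreal2 sums_iff)
    finally have "summable (\<lambda>k. b (Suc k) * (\<Sum>j. m (j + Suc (Suc k)))) \<longleftrightarrow>
      summable (\<lambda>j. m (Suc j + 1) * (\<Sum>k=1..Suc j. b k))"
    proof (subst (1 2) nn[symmetric])
      show "0 \<le> b (Suc n) * (\<Sum>j. m (j + Suc (Suc n)))" for n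
        using m by (intro mult_nonneg_nonneg suminf_nonneg b summable_ignore_initial_segment) auto
      show "0 \<le> m (Suc n + 1) * sum b {1..Suc n}" for n
        using m b by (intro mult_nonneg_nonneg sum_nonneg) auto
    qed simp
    thus ?thesis by (subst (asm) summable_Suc_iff) simp
  qed
  finally show ?thesis by simp
qed

text \<open>The equation is required only from \<open>n0\<close> on: it fails at the starting point
  of the resolvent, and at the vertex where the branch is attached to the rest of the graph the
  neighbours are different. \<open>C\<close> is the bound that invariance of \<open>\<mu>\<close>
  gives for the density \<open>g\<close>.\<close>

locale branch_function =
  fixes m c g :: "nat \<Rightarrow> real" and n0 :: nat and C :: real
  assumes m_pos: "m n > 0" and m_summable: "summable m"
    and c_pos: "c n > 0" and c_tendsto: "c \<longlonglongrightarrow> 0"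
    and g_pos: "g n > 0" and g_le: "g n \<le> C"
    and g_eq: "n \<ge> n0 \<Longrightarrow>
      m n * g n = c n * (g (n + 1) - g n) + c (n - 1) * (g (n - 1) - g n)"
begin

definition flux :: "nat \<Rightarrow> real" where
  "flux n = c n * (g n - g (n + 1))"

text \<open>Since \<open>0 < g \<le> C\<close>, the increments of \<open>g\<close> are bounded by
  \<open>C\<close>, so the flux inherits the decay of the conductances.\<close>

lemma flux_tendsto: "flux \<longlonglongrightarrow> 0"
proof (rule tendsto_0_le[OF c_tendsto, of _ C])
  have "norm (flux n) \<le> norm (c n) * C" for n
  proof -
    have "\<bar>g n - g (n + 1)\<bar> \<le> C"
      using g_pos[of n] g_pos[of "n+1"] g_le[of n] g_le[of "n+1"] by linarith
    thus ?thesis unfolding flux_def by (simp add: abs_mult mult_left_mono)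
  qed
  thus "\<forall>\<^sub>F n in sequentially. norm (flux n) \<le> norm (c n) * C" by simp
qed

text \<open>Telescoping out to infinity. The equation enters at \<open>Suc (j + n)\<close>, the
  vertices beyond the edge that carries the flux.\<close>

lemma flux_sums:
  assumes "n \<ge> n0"
  shows "(\<lambda>j. m (j + Suc n) * g (j + Suc n)) sums flux n"
proof -
  have "(\<lambda>j. flux (j + n)) \<longlonglongrightarrow> 0"
    using flux_tendsto by (rule LIMSEQ_ignore_initial_segment)
  from telescope_sums'[OF this]
  have "(\<lambda>j. flux (j + n) - flux (Suc j + n)) sums flux n" by simp
  moreover have "flux (j + n) - flux (Suc j + n) = m (j + Suc n) * g (j + Suc n)" for j
    using g_eq[of "Suc (j + n)"] assms by (simp add: flux_def algebra_simps)
  ultimately show ?thesis by simp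
qed

definition tail :: "nat \<Rightarrow> real" where
  "tail n = (\<Sum>j. m (j + Suc n))"

lemma tail_sums: "(\<lambda>j. m (j + Suc n)) sums tail n"
  unfolding tail_def by (intro summable_sums summable_ignore_initial_segment m_summable)

lemma tail_nonneg: "tail n \<ge> 0"
  by (rule sums_le[OF _ sums_zero tail_sums]) (simp add: m_pos less_imp_le)

text \<open>If \<open>g \<ge> d\<close>, the flux through edge \<open>n\<close> is at least
  \<open>d * tail n\<close>; hence \<open>d * (tail n / c n)\<close> is at most the decrement of
  \<open>g\<close>, and the decrements telescope to at most \<open>C\<close>.\<close>

lemma summable_tail_if_bounded_below:
  assumes d: "d > 0" and g: "\<And>n. g n \<ge> d"
  shows "summable (\<lambda>n. tail n / c n)"
proof -
  have step: "d * (tail n / c n) \<le> g n - g (n + 1)" if "n \<ge> n0" for n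
  proof -
    have "d * tail n \<le> flux n"
      by (rule sums_le[OF _ sums_mult[OF tail_sums, of d] flux_sums[OF that]])
         (use g m_pos in \<open>auto intro!: mult_right_mono simp: less_imp_le mult.commute[of d]
            intro!: mult_left_mono\<close>)
    thus ?thesis
      using c_pos[of n] by (simp add: flux_def field_simps)
  qed
  have part: "d * (\<Sum>i<k. tail (i + n0) / c (i + n0)) \<le> C" for k
  proof -
    have "d * (\<Sum>i<k. tail (i + n0) / c (i + n0)) \<le> (\<Sum>i<k. g (i + n0) - g (Suc i + n0))"
      unfolding sum_distrib_left by (rule sum_mono) (use step in auto)
    also have "\<dots> = g n0 - g (k + n0)"
      by (subst sum_lessThan_telescope') simp
    finally show ?thesis using g_le[of n0] g_pos[of "k+n0"] by linarith
  qed
  have "summable (\<lambda>i. tail (i + n0) / c (i + n0))"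
  proof (rule summableI_nonneg_bounded[of _ "C / d"])
    show "0 \<le> tail (n + n0) / c (n + n0)" for n
      using tail_nonneg c_pos by (simp add: less_imp_le)
    show "(\<Sum>i<n. tail (i + n0) / c (i + n0)) \<le> C / d" for n
      using part[of n] d by (simp add: field_simps)
  qed
  thus ?thesis by (subst (asm) summable_iff_shift)
qed

text \<open>A discrete Gronwall argument. The flux is nonnegative beyond \<open>n0\<close>, so
  \<open>g\<close> decreases there and the flux is at most \<open>g (Suc n) * tail n\<close>. One
  step thus loses at most a factor \<open>1 + a n \<le> exp (a n)\<close>, and the product of these
  factors is bounded when \<open>a\<close> is summable.\<close>

lemma bounded_below_if_summable_tail:
  assumes "summable (\<lambda>n. tail n / c n)"
  shows "\<exists>d>0. \<forall>n. g n \<ge> d"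
proof -
  define a where "a n = tail n / c n" for n
  have a0: "a n \<ge> 0" for n using tail_nonneg c_pos by (simp add: a_def less_imp_le)
  have flux0: "flux n \<ge> 0" if "n \<ge> n0" for n
    by (rule sums_le[OF _ sums_zero flux_sums[OF that]]) (simp add: m_pos g_pos less_imp_le)
  have dec: "g (Suc n) \<le> g n" if "n \<ge> n0" for n
    using flux0[OF that] c_pos[of n] by (simp add: flux_def zero_le_mult_iff)
  have dec': "g (j + n) \<le> g n" if "n \<ge> n0" for j n
  proof (induction j)
    case (Suc j)
    show ?case using dec[of "j + n"] Suc that by simp
  qed simp
  have step: "g n \<le> g (Suc n) * exp (a n)" if "n \<ge> n0" for n
  proof -
    have "flux n \<le> g (Suc n) * tail n"
      by (rule sums_le[OF _ flux_sums[OF that] sums_mult[OF tail_sums, of "g (Suc n)"]])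
         (use dec'[of "Suc n"] that m_pos in \<open>auto simp: less_imp_le mult.commute intro!: mult_right_mono\<close>)
    hence "g n \<le> g (Suc n) * (1 + a n)"
      using c_pos[of n] by (simp add: flux_def a_def field_simps)
    also have "\<dots> \<le> g (Suc n) * exp (a n)"
      using g_pos[of "Suc n"] exp_ge_add_one_self[of "a n"] by (intro mult_left_mono) auto
    finally show ?thesis .
  qed
  have it: "g n0 \<le> g (j + n0) * exp (\<Sum>i<j. a (i + n0))" for j
  proof (induction j)
    case (Suc j)
    note Suc
    also have "g (j + n0) * exp (\<Sum>i<j. a (i + n0)) \<le>
       (g (Suc (j + n0)) * exp (a (j + n0))) * exp (\<Sum>i<j. a (i + n0))"
      by (intro mult_right_mono step) auto
    finally show ?case by (simp add: exp_add mult_ac)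
  qed auto
  define A where "A = (\<Sum>i. a (i + n0))"
  have sA: "summable (\<lambda>i. a (i + n0))"
    using assms unfolding a_def by (rule summable_ignore_initial_segment)
  have far: "g (j + n0) \<ge> g n0 * exp (- A)" for j
  proof -
    have "(\<Sum>i<j. a (i + n0)) \<le> A"
      unfolding A_def by (rule sum_le_suminf[OF sA]) (auto simp: a0)
    hence "g (j + n0) * exp (\<Sum>i<j. a (i + n0)) \<le> g (j + n0) * exp A"
      using g_pos[of "j+n0"] by (intro mult_left_mono) auto
    with it[of j] have "g n0 \<le> g (j + n0) * exp A" by linarith
    hence "g n0 * exp (- A) \<le> g (j + n0) * exp A * exp (- A)"
      by (intro mult_right_mono) auto
    thus ?thesis by (simp add: mult.assoc exp_minus)
  qed
  \<comment> \<open>The exponential bound covers the indices from \<open>n0\<close> on; before that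
    there are finitely many positive values.\<close>
  define d where "d = min (g n0 * exp (- A)) (Min (g ` {..n0}))"
  show ?thesis
  proof (intro exI conjI allI)
    show "d > 0" using g_pos by (auto simp: d_def)
    show "g n \<ge> d" for n
    proof (cases "n \<le> n0")
      case True
      hence "Min (g ` {..n0}) \<le> g n" by (intro Min_le) auto
      thus ?thesis by (simp add: d_def)
    next
      case False
      thus ?thesis using far[of "n - n0"] by (simp add: d_def)
    qed
  qed
qed

end

section \<open>The resolvent of a reversible generator\<close>

locale reversible_generator =
  fixes L :: "'a::countable \<Rightarrow> 'a \<Rightarrow> real" and \<mu> :: "'a pmf"
  assumes generator: "generator L"
    and finite_in_nbrs: "finite {z. z \<noteq> y \<and> L z y \<noteq> 0}"
    and reversible: "reversible L \<mu>"
    and irreducible: "(\<lambda>u v. u \<noteq> v \<and> L u v \<noteq> 0)\<^sup>*\<^sup>* x y"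
begin

definition nbrs :: "'a \<Rightarrow> 'a set" where
  "nbrs y = {z. z \<noteq> y \<and> L z y \<noteq> 0}"

definition rate :: "'a \<Rightarrow> real" where
  "rate x = - L x x"

lemma finite_nbrs [simp]: "finite (nbrs y)"
  unfolding nbrs_def by (rule finite_in_nbrs)

lemma L_nonneg: "x \<noteq> y \<Longrightarrow> 0 \<le> L x y"
  using generator by (auto simp: generator_def)

lemma L_nbrs_nonneg: "z \<in> nbrs y \<Longrightarrow> 0 \<le> L z y"
  by (auto simp: nbrs_def intro: L_nonneg)

lemma balance: "pmf \<mu> p * L p q = pmf \<mu> q * L q p"
  using reversible by (simp add: reversible_def)

lemma mu_pos: "pmf \<mu> y > 0"
proof -
  obtain x where x: "x \<in> set_pmf \<mu>" using set_pmf_not_empty[of \<mu>] by blast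
  from irreducible[of x y] show ?thesis
  proof induction
    case base
    show ?case using x by (simp add: pmf_positive)
  next
    case (step u v)
    hence "pmf \<mu> u * L u v > 0" using L_nonneg[of u v] by (simp add: less_le)
    thus ?case using balance[of u v] pmf_nonneg[of \<mu> v] by (simp add: less_le)
  qed
qed

lemma mu_nonzero [simp]: "pmf \<mu> y \<noteq> 0"
  using mu_pos[of y] by simp

lemma L_eq_0_iff: "L p q = 0 \<longleftrightarrow> L q p = 0"
  using balance[of p q] by (metis mu_nonzero mult_eq_0_iff)

lemma nbrs_sym: "z \<in> nbrs y \<longleftrightarrow> y \<in> nbrs z"
  using L_eq_0_iff by (auto simp: nbrs_def)

lemma rate_eq_sum: "rate x = (\<Sum>y\<in>nbrs x. L x y)"
proof -
  have "((\<lambda>y. L x y) has_sum rate x) (- {x})"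
    using generator by (simp add: generator_def rate_def)
  moreover have "((\<lambda>y. L x y) has_sum (\<Sum>y\<in>nbrs x. L x y)) (nbrs x)"
    by (simp add: has_sum_finite)
  hence "((\<lambda>y. L x y) has_sum (\<Sum>y\<in>nbrs x. L x y)) (- {x})"
    by (rule has_sum_cong_neutral[THEN iffD1, rotated -1]) (auto simp: nbrs_def L_eq_0_iff)
  ultimately show ?thesis by (rule has_sum_unique)
qed

lemma rate_nonneg: "rate x \<ge> 0"
  unfolding rate_eq_sum by (intro sum_nonneg L_nonneg) (auto simp: nbrs_def)

lemma rate_plus_1_pos: "1 + rate x > 0" and rate_plus_1_nz [simp]: "1 + rate x \<noteq> 0"
  using rate_nonneg[of x] by auto

lemma sum_in_flow: "(\<Sum>z\<in>nbrs y. pmf \<mu> z * L z y) = pmf \<mu> y * rate y"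
  unfolding rate_eq_sum sum_distrib_left by (intro sum.cong balance) simp

text \<open>The resolvent \<open>\<integral>\<^sub>0\<^sup>\<infinity> exp (- t) P\<^sub>t(x, y) dt\<close>, split according to the number of jumps.\<close>

fun nres :: "nat \<Rightarrow> 'a \<Rightarrow> 'a \<Rightarrow> real" where
  "nres 0 x y = (if x = y then 1 / (1 + rate y) else 0)"
| "nres (Suc n) x y = (\<Sum>z\<in>nbrs y. nres n x z * L z y) / (1 + rate y)"

lemma nres_nonneg: "nres n x y \<ge> 0"
proof (induction n arbitrary: y)
  case 0
  show ?case using rate_plus_1_pos[of y] by auto
next
  case (Suc n)
  thus ?case using rate_plus_1_pos[of y] L_nbrs_nonneg
    by (auto intro!: divide_nonneg_pos sum_nonneg mult_nonneg_nonneg)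
qed

text \<open>The definition peels off the last jump, this version the first; symmetry under
  \<open>\<mu>\<close> needs both.\<close>

lemma nres_Suc_left: "nres (Suc n) x y = (\<Sum>z\<in>nbrs x. L x z * nres n z y) / (1 + rate x)"
proof (induction n arbitrary: y)
  case 0
  show ?case
    by (auto simp: if_distrib if_distribR sum.delta' sum.delta nbrs_sym[of x y] cong: if_cong)
next
  case (Suc n)
  have "nres (Suc (Suc n)) x y = (\<Sum>z\<in>nbrs y. nres (Suc n) x z * L z y) / (1 + rate y)"
    by simp
  also have "(\<Sum>z\<in>nbrs y. nres (Suc n) x z * L z y) =
             (\<Sum>z\<in>nbrs y. \<Sum>w\<in>nbrs x. L x w * nres n w z * L z y / (1 + rate x))"
    by (subst Suc) (simp add: sum_distrib_right sum_divide_distrib)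
  also have "\<dots> = (\<Sum>w\<in>nbrs x. \<Sum>z\<in>nbrs y. L x w * nres n w z * L z y / (1 + rate x))"
    by (rule sum.swap)
  also have "\<dots> / (1 + rate y) = (\<Sum>w\<in>nbrs x. L x w * nres (Suc n) w y) / (1 + rate x)"
    by (simp add: sum_distrib_left sum_divide_distrib mult_ac)
  finally show ?case .
qed

text \<open>Detailed balance moves \<open>\<mu>\<close> across one edge at a time and so reverses a
  path, turning the last-jump recursion into the first-jump recursion.\<close>

lemma nres_sym: "pmf \<mu> x * nres n x y = pmf \<mu> y * nres n y x"
proof (induction n arbitrary: y)
  case (Suc n)
  have "pmf \<mu> x * nres (Suc n) x y = (\<Sum>z\<in>nbrs y. (pmf \<mu> x * nres n x z) * L z y) / (1 + rate y)"
    by (simp add: sum_distrib_left mult_ac)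
  also have "\<dots> = (\<Sum>z\<in>nbrs y. (pmf \<mu> z * L z y) * nres n z x) / (1 + rate y)"
    by (subst Suc) (simp add: mult_ac)
  also have "\<dots> = pmf \<mu> y * ((\<Sum>z\<in>nbrs y. L y z * nres n z x) / (1 + rate y))"
    by (subst balance) (simp add: sum_distrib_left mult_ac)
  also have "\<dots> = pmf \<mu> y * nres (Suc n) y x"
    by (simp only: nres_Suc_left)
  finally show ?case .
qed auto

lemma delta_le_mu_ratio: "(if x = y then 1 else 0) \<le> pmf \<mu> y / pmf \<mu> x"
  by simp

text \<open>\<open>pmf \<mu> y / pmf \<mu> x\<close> is a supersolution of the forward equation: its
  inflow at \<open>y\<close> is \<open>pmf \<mu> y * rate y / pmf \<mu> x\<close>, and at
  \<open>y = x\<close> its value 1 covers the unit source. Partial sums starting from 0 stay below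
  it.\<close>

lemma sum_nres_le: "(\<Sum>k<n. nres k x y) \<le> pmf \<mu> y / pmf \<mu> x"
proof (induction n arbitrary: y)
  case (Suc n)
  have "(1 + rate y) * (\<Sum>k<Suc n. nres k x y) =
    (if x = y then 1 else 0) + (\<Sum>k<n. \<Sum>z\<in>nbrs y. nres k x z * L z y)"
    unfolding sum.lessThan_Suc_shift distrib_left sum_distrib_left[of "1 + rate y" "\<lambda>i. nres (Suc i) x y"]
    by simp
  also have "(\<Sum>k<n. \<Sum>z\<in>nbrs y. nres k x z * L z y) = (\<Sum>z\<in>nbrs y. (\<Sum>k<n. nres k x z) * L z y)"
    by (subst sum.swap) (simp add: sum_distrib_right)
  also have "\<dots> \<le> (\<Sum>z\<in>nbrs y. pmf \<mu> z / pmf \<mu> x * L z y)"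
    by (intro sum_mono mult_right_mono Suc L_nbrs_nonneg)
  also have "\<dots> = pmf \<mu> y * rate y / pmf \<mu> x"
    unfolding sum_in_flow[symmetric] by (simp add: sum_divide_distrib)
  also have "(if x = y then 1 else 0) + \<dots> \<le> pmf \<mu> y / pmf \<mu> x + pmf \<mu> y * rate y / pmf \<mu> x"
    by (intro add_right_mono delta_le_mu_ratio)
  also have "\<dots> = (1 + rate y) * (pmf \<mu> y / pmf \<mu> x)"
    by (simp add: field_simps)
  finally show ?case
    using rate_plus_1_pos[of y] by (simp only: mult_le_cancel_left_pos)
qed simp

lemma summable_nres: "summable (\<lambda>n. nres n x y)"
  by (rule summableI_nonneg_bounded[OF nres_nonneg sum_nres_le])

definition res :: "'a \<Rightarrow> 'a \<Rightarrow> real" where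
  "res x y = (\<Sum>n. nres n x y)"

lemma res_nonneg: "res x y \<ge> 0"
  unfolding res_def by (intro suminf_nonneg summable_nres nres_nonneg)

lemma res_le: "res x y \<le> pmf \<mu> y / pmf \<mu> x"
  unfolding res_def by (intro suminf_le_const summable_nres sum_nres_le)

lemma res_sym: "pmf \<mu> x * res x y = pmf \<mu> y * res y x"
  unfolding res_def by (subst (1 2) suminf_mult[symmetric, OF summable_nres]) (simp only: nres_sym)

lemma res_equation:
  "(1 + rate y) * res x y = (if x = y then 1 else 0) + (\<Sum>z\<in>nbrs y. res x z * L z y)"
proof -
  have "(\<lambda>n. nres (Suc n) x y) sums ((\<Sum>z\<in>nbrs y. res x z * L z y) / (1 + rate y))"
    unfolding nres.simps res_def
    by (intro sums_divide sums_sum sums_mult2 summable_sums summable_nres)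
  moreover have "(\<lambda>n. nres (Suc n) x y) sums (res x y - nres 0 x y)"
    unfolding sums_Suc_iff[of "\<lambda>n. nres n x y"] res_def
    by (simp add: summable_sums[OF summable_nres] del: nres.simps)
  ultimately have "res x y = (\<Sum>z\<in>nbrs y. res x z * L z y) / (1 + rate y) + nres 0 x y"
    using sums_unique2 by fastforce
  thus ?thesis by (auto simp: field_simps)
qed

text \<open>The unit source makes \<open>res x x\<close> positive, and the inflow along an edge
  carries positivity to the next vertex.\<close>

lemma res_pos: "res x y > 0"
proof -
  have pos: "res x y > 0" if "(1 + rate y) * res x y > 0" for y
    using that rate_plus_1_pos[of y] by (simp add: zero_less_mult_iff)
  from irreducible[of x y] show ?thesis
  proof induction
    case base
    have "(\<Sum>z\<in>nbrs x. res x z * L z x) \<ge> 0"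
      by (intro sum_nonneg mult_nonneg_nonneg res_nonneg L_nbrs_nonneg)
    thus ?case by (intro pos, subst res_equation) simp
  next
    case (step u v)
    hence u: "u \<in> nbrs v" by (auto simp: nbrs_def)
    have "0 < res x u * L u v"
      using step L_nonneg[of u v] by (simp add: less_le)
    also have "\<dots> \<le> (\<Sum>z\<in>nbrs v. res x z * L z v)"
      by (rule member_le_sum[OF u]) (auto intro!: mult_nonneg_nonneg res_nonneg L_nbrs_nonneg)
    also have "\<dots> \<le> (if x = v then 1 else 0) + \<dots>" by simp
    finally show ?case by (intro pos, subst res_equation)
  qed
qed

text \<open>Division by \<open>pmf \<mu> y\<close> and detailed balance turn the inflow rates
  \<open>L z y\<close> of the forward equation into the outflow rates \<open>L y z\<close>.\<close>

lemma res_density_harmonic: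
  assumes "x \<noteq> y"
  shows "res x y / pmf \<mu> y = (\<Sum>z\<in>nbrs y. L y z * (res x z / pmf \<mu> z - res x y / pmf \<mu> y))"
proof -
  have "(1 + rate y) * res x y = (\<Sum>z\<in>nbrs y. res x z * L z y)"
    using res_equation[of y x] assms by simp
  also have "\<dots> = (\<Sum>z\<in>nbrs y. res x z / pmf \<mu> z * (pmf \<mu> y * L y z))"
    by (subst balance[symmetric]) (simp add: field_simps)
  also have "\<dots> = pmf \<mu> y * (\<Sum>z\<in>nbrs y. L y z * (res x z / pmf \<mu> z))"
    by (simp add: sum_distrib_left mult_ac)
  finally have "(1 + rate y) * (res x y / pmf \<mu> y) = (\<Sum>z\<in>nbrs y. L y z * (res x z / pmf \<mu> z))"
    by (simp add: divide_eq_eq mult.commute)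
  moreover have "(\<Sum>z\<in>nbrs y. L y z * (res x z / pmf \<mu> z - d)) =
      (\<Sum>z\<in>nbrs y. L y z * (res x z / pmf \<mu> z)) - rate y * d" for d
    by (simp add: right_diff_distrib sum_subtractf sum_distrib_right rate_eq_sum)
  ultimately show ?thesis
    by (simp only: distrib_right mult_1 add_diff_cancel_right')
qed

end

section \<open>Transition probabilities\<close>

lemma nn_integral_exp_tail:
  assumes "q > 0"
  shows "(\<integral>\<^sup>+ t. (if a \<le> t then ennreal (exp (- q * t)) else 0) \<partial>lborel) = ennreal (exp (- q * a) / q)"
proof -
  have "(\<integral>\<^sup>+ t. ennreal (exp (- q * t)) * indicator {a..} t \<partial>lborel) = ennreal (0 - (- exp (- q * a) / q))"
  proof (rule nn_integral_FTC_atLeast)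
    show "((\<lambda>t. - exp (- q * t) / q) has_real_derivative exp (- q * t)) (at t)" for t
      using assms by (auto intro!: derivative_eq_intros)
    show "((\<lambda>t. - exp (- q * t) / q) \<longlongrightarrow> 0) at_top"
      using assms by real_asymp
  qed auto
  thus ?thesis
    by (simp add: if_distrib indicator_def of_bool_def cong: if_cong)
qed

lemma nn_integral_exp_interval:
  assumes "t \<ge> 0" "q \<ge> 0"
  shows "(\<integral>\<^sup>+ r. (if 0 < r \<and> r \<le> t then ennreal (exp (- q * (t - r)) * q) else 0) \<partial>lborel)
           \<le> ennreal (1 - exp (- q * t))"
proof -
  have "(\<integral>\<^sup>+ r. ennreal (exp (- q * (t - r)) * q) * indicator {0..t} r \<partial>lborel) =
      ennreal (exp (- q * (t - t)) - exp (- q * (t - 0)))"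
    by (rule nn_integral_FTC_Icc) (use assms in \<open>auto intro!: derivative_eq_intros\<close>)
  moreover have "(\<integral>\<^sup>+ r. (if 0 < r \<and> r \<le> t then ennreal (exp (- q * (t - r)) * q) else 0) \<partial>lborel)
    \<le> (\<integral>\<^sup>+ r. ennreal (exp (- q * (t - r)) * q) * indicator {0..t} r \<partial>lborel)"
    by (intro nn_integral_mono) auto
  ultimately show ?thesis by simp
qed

context reversible_generator
begin

text \<open>The transition probabilities of the minimal process, split according to the number of jumps
  and computed by the forward recursion over the time of the last jump.\<close>

fun ntrans :: "nat \<Rightarrow> 'a \<Rightarrow> real \<Rightarrow> 'a \<Rightarrow> ennreal" where
  "ntrans 0 x t y = (if x = y then ennreal (exp (- rate y * t)) else 0)"
| "ntrans (Suc n) x t y =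
     (\<integral>\<^sup>+ r. (if 0 < r \<and> r \<le> t then
        ennreal (exp (- rate y * (t - r))) * (\<Sum>z\<in>nbrs y. ntrans n x r z * ennreal (L z y)) else 0) \<partial>lborel)"

lemma borel_measurable_ntrans [measurable]: "(\<lambda>t. ntrans n x t y) \<in> borel_measurable borel"
proof (induction n arbitrary: y)
  case (Suc n)
  note [measurable] = Suc
  show ?case unfolding ntrans.simps by measurable
qed simp

definition trans_prob :: "'a \<Rightarrow> real \<Rightarrow> 'a \<Rightarrow> ennreal" where
  "trans_prob x t y = (\<Sum>n. ntrans n x t y)"

lemma borel_measurable_trans [measurable]: "(\<lambda>t. trans_prob x t y) \<in> borel_measurable borel"
  unfolding trans_prob_def by measurable

lemma borel_measurable_trans_shift [measurable]: "(\<lambda>t. trans_prob x (t - g) y) \<in> borel_measurable borel"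
  using measurable_compose[OF _ borel_measurable_trans[of x y], of "\<lambda>t. t - g" borel] by simp

text \<open>The Laplace transform at 1. For transition probabilities it is the probability of a
  state at an independent exponential time of rate 1.\<close>

definition laplace :: "(real \<Rightarrow> ennreal) \<Rightarrow> ennreal" where
  "laplace f = (\<integral>\<^sup>+ t. (if 0 \<le> t then ennreal (exp (- t)) * f t else 0) \<partial>lborel)"

text \<open>The forward recursion is a convolution with \<open>exp (- rate y * t)\<close>, whose
  transform at 1 is \<open>1 / (1 + rate y)\<close>. After Fubini it becomes the recursion of
  \<open>nres\<close>.\<close>

lemma laplace_ntrans: "laplace (\<lambda>t. ntrans n x t y) = ennreal (nres n x y)"
proof (induction n arbitrary: y)
  case 0
  have "(if 0 \<le> t then ennreal (exp (- t)) * ennreal (exp (- rate y * t)) else 0) =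
        (if 0 \<le> t then ennreal (exp (- (1 + rate y) * t)) else 0)" for t
    by (simp add: ennreal_mult[symmetric] exp_add[symmetric] algebra_simps)
  hence "laplace (\<lambda>t. ennreal (exp (- rate y * t))) = ennreal (1 / (1 + rate y))"
    using nn_integral_exp_tail[OF rate_plus_1_pos[of y], of 0] by (simp only: laplace_def) simp
  moreover have "laplace (\<lambda>t. 0) = 0"
    by (simp add: laplace_def cong: if_cong)
  ultimately show ?case by simp
next
  case (Suc n)
  define w where "w r = (\<Sum>z\<in>nbrs y. ntrans n x r z * ennreal (L z y))" for r
  have [measurable]: "w \<in> borel_measurable borel" unfolding w_def by measurable
  have "laplace (\<lambda>t. ntrans (Suc n) x t y) =
    (\<integral>\<^sup>+ t. \<integral>\<^sup>+ r. (if 0 < r \<and> r \<le> t then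
        ennreal (exp (- t)) * (ennreal (exp (- rate y * (t - r))) * w r) else 0) \<partial>lborel \<partial>lborel)"
    unfolding laplace_def ntrans.simps w_def[symmetric]
  proof (intro nn_integral_cong)
    fix t :: real
    have "(\<lambda>r. if 0 < r \<and> r \<le> t then F r else (0::ennreal)) = (\<lambda>r. 0)" if "\<not> 0 \<le> t" for F
      using that by fastforce
    thus "(if 0 \<le> t then ennreal (exp (- t)) * (\<integral>\<^sup>+ r. (if 0 < r \<and> r \<le> t then
        ennreal (exp (- rate y * (t - r))) * w r else 0) \<partial>lborel) else 0) =
      (\<integral>\<^sup>+ r. (if 0 < r \<and> r \<le> t then
        ennreal (exp (- t)) * (ennreal (exp (- rate y * (t - r))) * w r) else 0) \<partial>lborel)"
      by (cases "0 \<le> t") (auto simp flip: nn_integral_cmult intro!: nn_integral_cong)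
  qed
  also have "\<dots> = (\<integral>\<^sup>+ r. \<integral>\<^sup>+ t. (if 0 < r \<and> r \<le> t then
        ennreal (exp (- t)) * (ennreal (exp (- rate y * (t - r))) * w r) else 0) \<partial>lborel \<partial>lborel)"
    by (rule lborel_pair.Fubini') measurable
  also have "\<dots> = (\<integral>\<^sup>+ r. (if 0 < r then ennreal (exp (rate y * r)) * w r *
      (\<integral>\<^sup>+ t. (if r \<le> t then ennreal (exp (- (1 + rate y) * t)) else 0) \<partial>lborel) else 0) \<partial>lborel)"
  proof (intro nn_integral_cong)
    fix r :: real
    have "ennreal (exp (- t)) * (ennreal (exp (- rate y * (t - r))) * w r) =
      ennreal (exp (rate y * r)) * w r * ennreal (exp (- (1 + rate y) * t))" for t
    proof -
      have "exp (- t) * exp (- rate y * (t - r)) = exp (rate y * r) * exp (- (1 + rate y) * t)"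
        by (simp add: exp_add[symmetric] algebra_simps)
      hence "ennreal (exp (- t)) * ennreal (exp (- rate y * (t - r))) =
         ennreal (exp (rate y * r)) * ennreal (exp (- (1 + rate y) * t))"
        by (simp add: ennreal_mult[symmetric])
      thus ?thesis by (metis mult.assoc mult.commute)
    qed
    thus "(\<integral>\<^sup>+ t. (if 0 < r \<and> r \<le> t then
        ennreal (exp (- t)) * (ennreal (exp (- rate y * (t - r))) * w r) else 0) \<partial>lborel) =
      (if 0 < r then ennreal (exp (rate y * r)) * w r *
      (\<integral>\<^sup>+ t. (if r \<le> t then ennreal (exp (- (1 + rate y) * t)) else 0) \<partial>lborel) else 0)"
      by (auto simp flip: nn_integral_cmult intro!: nn_integral_cong)
  qed
  also have "\<dots> = (\<integral>\<^sup>+ r. (if 0 < r then ennreal (exp (- r)) * w r * ennreal (1 / (1 + rate y)) else 0) \<partial>lborel)"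
  proof (intro nn_integral_cong if_cong refl)
    fix r :: real
    have "exp (rate y * r) * (exp (- (1 + rate y) * r) / (1 + rate y)) = exp (- r) * (1 / (1 + rate y))"
      by (simp add: exp_add[symmetric] algebra_simps)
    hence "ennreal (exp (rate y * r)) * ennreal (exp (- (1 + rate y) * r) / (1 + rate y)) =
       ennreal (exp (- r)) * ennreal (1 / (1 + rate y))"
      using rate_plus_1_pos[of y] by (simp add: ennreal_mult[symmetric])
    thus "ennreal (exp (rate y * r)) * w r *
        (\<integral>\<^sup>+ t. (if r \<le> t then ennreal (exp (- (1 + rate y) * t)) else 0) \<partial>lborel) =
        ennreal (exp (- r)) * w r * ennreal (1 / (1 + rate y))"
      unfolding nn_integral_exp_tail[OF rate_plus_1_pos[of y]] by (metis mult.assoc mult.commute)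
  qed
  also have "\<dots> = (\<integral>\<^sup>+ r. (if 0 \<le> r then ennreal (exp (- r)) * w r * ennreal (1 / (1 + rate y)) else 0) \<partial>lborel)"
    by (rule nn_integral_cong_AE) (use AE_lborel_singleton[of "0::real"] in \<open>eventually_elim, auto\<close>)
  also have "\<dots> = (\<integral>\<^sup>+ r. (\<Sum>z\<in>nbrs y. (if 0 \<le> r then ennreal (exp (- r)) * ntrans n x r z else 0) *
                    ennreal (L z y)) * ennreal (1 / (1 + rate y)) \<partial>lborel)"
    by (intro nn_integral_cong) (auto simp: w_def sum_distrib_left mult.assoc)
  also have "\<dots> = (\<Sum>z\<in>nbrs y. laplace (\<lambda>r. ntrans n x r z) * ennreal (L z y)) * ennreal (1 / (1 + rate y))"
    by (simp add: nn_integral_multc nn_integral_sum laplace_def)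
  also have "(\<Sum>z\<in>nbrs y. laplace (\<lambda>r. ntrans n x r z) * ennreal (L z y)) =
      ennreal (\<Sum>z\<in>nbrs y. nres n x z * L z y)"
    by (simp add: Suc ennreal_mult[symmetric] nres_nonneg L_nbrs_nonneg mult_nonneg_nonneg)
  also have "\<dots> * ennreal (1 / (1 + rate y)) = ennreal (nres (Suc n) x y)"
    using rate_plus_1_pos[of y]
    by (subst ennreal_mult[symmetric])
      (auto intro!: sum_nonneg mult_nonneg_nonneg nres_nonneg L_nbrs_nonneg)
  finally show ?case .
qed

lemma laplace_trans: "laplace (\<lambda>t. trans_prob x t y) = ennreal (res x y)"
proof -
  have "laplace (\<lambda>t. trans_prob x t y) =
      (\<integral>\<^sup>+ t. (\<Sum>n. (if 0 \<le> t then ennreal (exp (- t)) * ntrans n x t y else 0)) \<partial>lborel)"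
    unfolding laplace_def trans_prob_def by (intro nn_integral_cong) (auto simp: ennreal_suminf_cmult)
  also have "\<dots> = (\<Sum>n. laplace (\<lambda>t. ntrans n x t y))"
    unfolding laplace_def by (rule nn_integral_suminf) measurable
  also have "\<dots> = ennreal (res x y)"
    unfolding laplace_ntrans res_def by (intro suminf_ennreal2 nres_nonneg summable_nres)
  finally show ?thesis .
qed

text \<open>The supersolution argument for \<open>sum_nres_le\<close>, now in time. The bound
  \<open>c\<close> splits into \<open>c * exp (- rate y * t)\<close>, which dominates the paths
  without a jump, and \<open>c * (1 - exp (- rate y * t))\<close>, the inflow under
  \<open>\<mu>\<close> integrated over the time of the last jump.\<close>

lemma sum_ntrans_le:
  assumes "t \<ge> 0"
  shows "(\<Sum>k<n. ntrans k x t y) \<le> ennreal (pmf \<mu> y / pmf \<mu> x)"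
  using assms
proof (induction n arbitrary: y t)
  case (Suc n)
  define c where "c = pmf \<mu> y / pmf \<mu> x"
  have c0: "c \<ge> 0" by (simp add: c_def)
  have "(\<Sum>k<n. ntrans (Suc k) x t y) =
     (\<integral>\<^sup>+ r. (\<Sum>k<n. if 0 < r \<and> r \<le> t then
        ennreal (exp (- rate y * (t - r))) * (\<Sum>z\<in>nbrs y. ntrans k x r z * ennreal (L z y)) else 0) \<partial>lborel)"
    by (simp add: nn_integral_sum)
  also have "\<dots> \<le> (\<integral>\<^sup>+ r. ennreal c * (if 0 < r \<and> r \<le> t then ennreal (exp (- rate y * (t - r)) * rate y) else 0) \<partial>lborel)"
  proof (intro nn_integral_mono)
    fix r :: real
    show "(\<Sum>k<n. if 0 < r \<and> r \<le> t then
        ennreal (exp (- rate y * (t - r))) * (\<Sum>z\<in>nbrs y. ntrans k x r z * ennreal (L z y)) else 0)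
      \<le> ennreal c * (if 0 < r \<and> r \<le> t then ennreal (exp (- rate y * (t - r)) * rate y) else 0)"
    proof (cases "0 < r \<and> r \<le> t")
      case True
      have "(\<Sum>k<n. \<Sum>z\<in>nbrs y. ntrans k x r z * ennreal (L z y)) =
            (\<Sum>z\<in>nbrs y. (\<Sum>k<n. ntrans k x r z) * ennreal (L z y))"
        by (subst sum.swap) (simp add: sum_distrib_right)
      also have "\<dots> \<le> (\<Sum>z\<in>nbrs y. ennreal (pmf \<mu> z / pmf \<mu> x) * ennreal (L z y))"
        using True by (intro sum_mono mult_right_mono Suc.IH) auto
      also have "\<dots> = ennreal (\<Sum>z\<in>nbrs y. pmf \<mu> z * L z y / pmf \<mu> x)"
        by (simp add: ennreal_mult[symmetric] L_nbrs_nonneg)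
      also have "(\<Sum>z\<in>nbrs y. pmf \<mu> z * L z y / pmf \<mu> x) = c * rate y"
        unfolding sum_divide_distrib[symmetric] sum_in_flow c_def by simp
      finally have "(\<Sum>k<n. \<Sum>z\<in>nbrs y. ntrans k x r z * ennreal (L z y)) \<le> ennreal c * ennreal (rate y)"
        using c0 by (simp add: ennreal_mult' )
      hence "ennreal (exp (- rate y * (t - r))) * (\<Sum>k<n. \<Sum>z\<in>nbrs y. ntrans k x r z * ennreal (L z y))
         \<le> ennreal (exp (- rate y * (t - r))) * (ennreal c * ennreal (rate y))"
        by (rule mult_left_mono) simp
      thus ?thesis using True
        by (simp add: sum_distrib_left ennreal_mult' rate_nonneg mult_ac)
    next
      case False
      thus ?thesis by (simp only: if_False) simp
    qed
  qed
  also have "\<dots> = ennreal c * (\<integral>\<^sup>+ r. (if 0 < r \<and> r \<le> t then ennreal (exp (- rate y * (t - r)) * rate y) else 0) \<partial>lborel)"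
    by (rule nn_integral_cmult) measurable
  also have "\<dots> \<le> ennreal c * ennreal (1 - exp (- rate y * t))"
    by (intro mult_left_mono nn_integral_exp_interval Suc.prems rate_nonneg) simp
  also have "\<dots> = ennreal (c * (1 - exp (- rate y * t)))"
    using c0 by (simp add: ennreal_mult')
  finally have 1: "(\<Sum>k<n. ntrans (Suc k) x t y) \<le> ennreal (c * (1 - exp (- rate y * t)))" .
  have 2: "ntrans 0 x t y \<le> ennreal (c * exp (- rate y * t))"
    by (auto simp: c_def)
  have "(\<Sum>k<Suc n. ntrans k x t y) \<le> ennreal (c * exp (- rate y * t)) + ennreal (c * (1 - exp (- rate y * t)))"
    unfolding sum.lessThan_Suc_shift by (rule add_mono[OF 2 1])
  also have "\<dots> = ennreal c"
    using c0 Suc.prems rate_nonneg[of y] by (subst ennreal_plus[symmetric]) (auto simp: algebra_simps intro!: mult_left_le)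
  finally show ?case by (simp add: c_def)
qed simp

lemma trans_le:
  assumes "t \<ge> 0"
  shows "trans_prob x t y \<le> ennreal (pmf \<mu> y / pmf \<mu> x)"
  unfolding trans_prob_def
  by (intro suminf_le_const sum_ntrans_le assms) auto

lemma trans_self_ge: "trans_prob x t x \<ge> ennreal (exp (- rate x * t))"
proof -
  have "ntrans 0 x t x \<le> trans_prob x t x"
    unfolding trans_prob_def using sum_le_suminf[of "\<lambda>n. ntrans n x t x" "{0}"] by simp
  thus ?thesis by simp
qed

end

section \<open>Jump chains and holding times\<close>

text \<open>\<open>M\<close> restricted to \<open>D\<close>, scaled by \<open>c\<close> and pushed
  forward by \<open>g\<close>. Two such measures represent the sides of an identity between
  restricted integrals, so that uniqueness theorems for measures apply to it.\<close>

definition weighted_image ::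
  "ennreal \<Rightarrow> 'b set \<Rightarrow> 'b measure \<Rightarrow> 'c measure \<Rightarrow> ('b \<Rightarrow> 'c) \<Rightarrow> 'c measure" where
  "weighted_image c D M N g = distr (density M (\<lambda>x. c * indicator D x)) N g"

lemma sets_weighted_image [simp, measurable_cong]: "sets (weighted_image c D M N g) = sets N"
  by (simp add: weighted_image_def)

lemma nn_integral_weighted_image:
  assumes [measurable]: "g \<in> measurable M N" "D \<in> sets M" "f \<in> borel_measurable N"
  shows "(\<integral>\<^sup>+ y. f y \<partial>weighted_image c D M N g) = c * (\<integral>\<^sup>+ x. indicator D x * f (g x) \<partial>M)"
  by (simp add: weighted_image_def nn_integral_distr nn_integral_density nn_integral_cmult mult.assoc)

lemma emeasure_weighted_image:
  assumes [measurable]: "g \<in> measurable M N" "D \<in> sets M" "A \<in> sets N"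
  shows "emeasure (weighted_image c D M N g) A = c * emeasure M (D \<inter> (g -` A \<inter> space M))"
proof -
  have "emeasure (weighted_image c D M N g) A = c * (\<integral>\<^sup>+ x. indicator D x * indicator A (g x) \<partial>M)"
    using nn_integral_weighted_image[of g M N D "indicator A" c] by simp
  also have "(\<integral>\<^sup>+ x. indicator D x * indicator A (g x) \<partial>M) = (\<integral>\<^sup>+ x. indicator (D \<inter> (g -` A \<inter> space M)) x \<partial>M)"
    by (intro nn_integral_cong) (auto split: split_indicator)
  finally show ?thesis by simp
qed

text \<open>Both sides are measures in \<open>A\<close>, finite on a countable cover by generators,
  so agreement on the intersection-stable \<open>E\<close> determines them. This is the form in
  which conditional probabilities pass from generators to a whole history.\<close>

lemma (in finite_measure) emeasure_Int_eqI:
  assumes "Int_stable E" and EM: "E \<subseteq> sets M"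
    and [measurable]: "C \<in> sets M" "D \<in> sets M"
    and eq: "\<And>a. a \<in> E \<Longrightarrow> emeasure M (a \<inter> C) = emeasure M (a \<inter> D) * c"
    and A: "A \<in> sigma_sets (space M) E"
    and cover: "K \<subseteq> E" "\<Union>K = space M" "countable K"
  shows "emeasure M (A \<inter> C) = emeasure M (A \<inter> D) * c"
proof -
  have EP: "E \<subseteq> Pow (space M)" using EM sets.sets_into_space by auto
  define S where "S = sigma (space M) E"
  have S: "sets S = sigma_sets (space M) E" "space S = space M"
    using EP by (simp_all add: S_def)
  have SM: "sets S \<subseteq> sets M"
    unfolding S by (rule sets.sigma_sets_subset[OF EM])
  have id: "(\<lambda>\<omega>. \<omega>) \<in> measurable M S"
    using SM S by (auto simp: measurable_def)
  have im: "emeasure (weighted_image k B M S (\<lambda>\<omega>. \<omega>)) X = k * emeasure M (X \<inter> B)"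
    if "B \<in> sets M" "X \<in> sets S" for k B X
    using emeasure_weighted_image[OF id that] sets.sets_into_space[of X M] SM that(2)
    by (auto simp: Int_absorb2 Int_commute)
  have ES: "X \<in> sets S" if "X \<in> E" for X using that by (auto simp: S)
  have "weighted_image 1 C M S (\<lambda>\<omega>. \<omega>) = weighted_image c D M S (\<lambda>\<omega>. \<omega>)"
  proof (rule measure_eqI_generator_eq_countable[OF \<open>Int_stable E\<close> EP _ _ _ cover])
    show "emeasure (weighted_image 1 C M S (\<lambda>\<omega>. \<omega>)) X = emeasure (weighted_image c D M S (\<lambda>\<omega>. \<omega>)) X" if "X \<in> E" for X
      using ES[OF that] that eq by (simp add: im mult.commute)
    show "emeasure (weighted_image 1 C M S (\<lambda>\<omega>. \<omega>)) a \<noteq> \<infinity>" if "a \<in> K" for a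
      using ES[of a] that cover(1) by (auto simp: im emeasure_eq_measure)
  qed (simp_all add: S)
  thus ?thesis using im[of C A 1] im[of D A c] A by (simp add: S mult.commute)
qed

text \<open>Negative parameters stand for the absence of a condition.\<close>

definition ray :: "real \<Rightarrow> ennreal set" where
  "ray t = (if t < 0 then UNIV else {ennreal t <..})"

lemma ray_Int: "ray s \<inter> ray t = ray (max s t)"
proof (cases "s \<le> t")
  case True
  thus ?thesis by (auto simp: ray_def max_def intro: le_less_trans ennreal_leI)
next
  case False
  hence "ennreal t \<le> ennreal s" by (intro ennreal_leI) simp
  hence "ennreal t < x" if "ennreal s < x" for x using that by (rule le_less_trans)
  thus ?thesis using False by (auto simp: ray_def max_def)
qed

lemma sets_borel_eq_ray: "sets (borel :: ennreal measure) = sigma_sets UNIV (range ray)"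
proof
  have "range ray \<subseteq> sets borel"
    by (auto simp: ray_def)
  thus "sigma_sets UNIV (range ray) \<subseteq> sets (borel :: ennreal measure)"
    using sets.sigma_sets_subset[of "range ray" borel] by simp
next
  have "{a<..} \<in> sigma_sets UNIV (range ray)" for a :: ennreal
  proof (cases a rule: ennreal_cases)
    case (real r)
    hence "{a<..} = ray r" by (simp add: ray_def)
    thus ?thesis by auto
  next
    case top
    hence "{a<..} = {}" by auto
    thus ?thesis by (simp add: sigma_sets.Empty)
  qed
  hence "sigma_sets UNIV (range (\<lambda>a. {a<..})) \<subseteq> sigma_sets UNIV (range ray)"
    by (intro sigma_sets_mono) auto
  moreover have "sets (borel :: ennreal measure) = sigma_sets UNIV (range (\<lambda>a. {a<..}))"
    by (subst borel_Ioi) simp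
  ultimately show "sets (borel :: ennreal measure) \<subseteq> sigma_sets UNIV (range ray)"
    by simp
qed

text \<open>Parameter 0 belongs to an absorbing state, whose holding time is infinite.\<close>

definition exp_law :: "real \<Rightarrow> ennreal measure" where
  "exp_law q = (if q = 0 then return borel \<infinity>
     else distr (density lborel (exponential_density q)) borel ennreal)"

lemma sets_exp_law [simp, measurable_cong]: "sets (exp_law q) = sets borel"
  by (simp add: exp_law_def)

lemma space_exp_law [simp]: "space (exp_law q) = UNIV"
  by (simp add: exp_law_def)

lemma prob_space_exp_law: "q \<ge> 0 \<Longrightarrow> prob_space (exp_law q)"
  unfolding exp_law_def
  by (auto intro!: prob_space_return prob_space.prob_space_distr prob_space_exponential_density)

text \<open>The condition \<open>f \<infinity> = 0\<close> lets the density formula include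
  \<open>q = 0\<close>, where both sides vanish.\<close>

lemma nn_integral_exp_law:
  assumes "q \<ge> 0" and [measurable]: "f \<in> borel_measurable borel" and "f \<infinity> = 0"
  shows "(\<integral>\<^sup>+ u. f u \<partial>exp_law q) =
         (\<integral>\<^sup>+ u. (if 0 \<le> u then ennreal (q * exp (- q * u)) * f (ennreal u) else 0) \<partial>lborel)"
proof (cases "q = 0")
  case True
  thus ?thesis using assms by (simp add: exp_law_def nn_integral_return cong: if_cong)
next
  case False
  hence "(\<integral>\<^sup>+ u. f u \<partial>exp_law q) = (\<integral>\<^sup>+ u. ennreal (exponential_density q u) * f (ennreal u) \<partial>lborel)"
    using assms by (simp add: exp_law_def nn_integral_distr nn_integral_density)
  also have "\<dots> = (\<integral>\<^sup>+ u. (if 0 \<le> u then ennreal (q * exp (- q * u)) * f (ennreal u) else 0) \<partial>lborel)"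
    by (intro nn_integral_cong) (auto simp: exponential_density_def mult.commute)
  finally show ?thesis .
qed

lemma emeasure_exp_law_ray:
  assumes "q \<ge> 0"
  shows "emeasure (exp_law q) (ray t) = ennreal (exp (- q * max 0 t))"
proof (cases "t < 0 \<or> q = 0")
  case True
  interpret prob_space "exp_law q" using assms by (rule prob_space_exp_law)
  show ?thesis
  proof (cases "t < 0")
    case True
    thus ?thesis using emeasure_space_1 by (simp add: ray_def)
  next
    case False
    thus ?thesis using True by (simp add: ray_def exp_law_def)
  qed
next
  case False
  hence q: "q > 0" and t: "t \<ge> 0" using assms by auto
  have "ennreal -` {ennreal t<..} = {t<..}"
    using t by (auto simp: ennreal_less_iff)
  hence "emeasure (exp_law q) (ray t) =
      (\<integral>\<^sup>+ u. ennreal (exponential_density q u) * indicator {t<..} u \<partial>lborel)"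
    using q t by (simp add: exp_law_def emeasure_distr ray_def emeasure_density)
  also have "\<dots> = (\<integral>\<^sup>+ u. ennreal q * (if t \<le> u then ennreal (exp (- q * u)) else 0) \<partial>lborel)"
  proof (rule nn_integral_cong_AE)
    show "AE u in lborel. ennreal (exponential_density q u) * indicator {t<..} u =
      ennreal q * (if t \<le> u then ennreal (exp (- q * u)) else 0)"
      using AE_lborel_singleton[of t]
      by eventually_elim
        (use q t in \<open>auto simp: exponential_density_def ennreal_mult[symmetric] mult.commute split: split_indicator\<close>)
  qed
  also have "\<dots> = ennreal q * ennreal (exp (- q * t) / q)"
    by (subst nn_integral_cmult) (simp_all add: nn_integral_exp_tail[OF q])
  also have "\<dots> = ennreal (exp (- q * max 0 t))"
    using q t by (simp add: ennreal_mult[symmetric])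
  finally show ?thesis .
qed

section \<open>Jump intervals and jump probabilities\<close>

lemma jump_interval_exists:
  assumes "ennreal t < jump_time H m \<omega>"
  shows "\<exists>n<m. jump_time H n \<omega> \<le> ennreal t \<and> ennreal t < jump_time H (Suc n) \<omega>"
proof -
  define l where "l = (LEAST n. ennreal t < jump_time H n \<omega>)"
  have l: "ennreal t < jump_time H l \<omega>" "l \<le> m"
    unfolding l_def using assms by (auto intro: LeastI Least_le)
  have "jump_time H 0 \<omega> = 0" by (simp add: jump_time_def)
  then obtain n where n: "l = Suc n" using l by (cases l) auto
  hence "\<not> ennreal t < jump_time H n \<omega>" unfolding l_def by (metis lessI not_less_Least)
  thus ?thesis using l n by (auto simp: not_less Suc_le_eq)
qed

lemma jump_time_mono: "m \<le> n \<Longrightarrow> jump_time H m \<omega> \<le> jump_time H n \<omega>"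
  unfolding jump_time_def by (rule sum_mono2) auto

text \<open>Stated for two times: the number of jumps made is nondecreasing in time. With
  \<open>s = t\<close>, applied in both directions, it gives uniqueness of the interval.\<close>

lemma jump_interval_unique:
  assumes "jump_time H n \<omega> \<le> ennreal s" "ennreal s < jump_time H (Suc n) \<omega>"
    "jump_time H m \<omega> \<le> ennreal t" "ennreal t < jump_time H (Suc m) \<omega>" "s \<le> t"
  shows "n \<le> m"
proof (rule ccontr)
  assume "\<not> n \<le> m"
  hence "jump_time H (Suc m) \<omega> \<le> jump_time H n \<omega>" by (intro jump_time_mono) simp
  also have "\<dots> \<le> ennreal t" using assms ennreal_leI[of s t] by auto
  finally show False using assms by simp
qed

context reversible_generator
begin

lemma L_eq_0: "y \<notin> nbrs x \<Longrightarrow> x \<noteq> y \<Longrightarrow> L x y = 0"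
  using L_eq_0_iff[of x y] by (auto simp: nbrs_def)

lemma rate_eq_0_iff: "rate x = 0 \<longleftrightarrow> nbrs x = {}"
proof
  assume "rate x = 0"
  hence "\<forall>y\<in>nbrs x. L x y = 0"
    unfolding rate_eq_sum
    by (subst (asm) sum_nonneg_eq_0_iff[OF finite_nbrs]) (auto simp: nbrs_def intro: L_nonneg)
  moreover have "L x y \<noteq> 0" if "y \<in> nbrs x" for y
    using that by (auto simp: nbrs_def L_eq_0_iff)
  ultimately show "nbrs x = {}" by blast
qed (simp add: rate_eq_sum)

lemma jump_prob_nonneg: "jump_prob L x y \<ge> 0"
  using divide_nonneg_nonneg[OF L_nonneg[of x y] rate_nonneg[of x]] by (simp add: jump_prob_def rate_def)

text \<open>This product appears as holding-time density times jump probability, and it restores the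
  entries of the generator. At an absorbing state both sides are 0.\<close>

lemma rate_mult_jump_prob: "rate x * jump_prob L x y = (if y \<in> nbrs x then L x y else 0)"
  using rate_eq_0_iff[of x] by (auto simp: jump_prob_def rate_def nbrs_def L_eq_0_iff)

lemma nn_integral_jump_prob: "(\<integral>\<^sup>+ y. ennreal (jump_prob L x y) \<partial>count_space UNIV) = 1"
proof (cases "rate x = 0")
  case True
  hence "(\<integral>\<^sup>+ y. ennreal (jump_prob L x y) \<partial>count_space UNIV) =
         (\<integral>\<^sup>+ y. indicator {x} y \<partial>count_space UNIV)"
    by (intro nn_integral_cong) (auto simp: jump_prob_def rate_def split: split_indicator)
  thus ?thesis by simp
next
  case False
  have "(\<integral>\<^sup>+ y. ennreal (jump_prob L x y) \<partial>count_space UNIV) =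
        (\<Sum>y\<in>nbrs x. ennreal (jump_prob L x y))"
    using False by (intro nn_integral_count_space'[OF finite_nbrs])
      (auto simp: jump_prob_def rate_def L_eq_0)
  also have "\<dots> = (\<Sum>y\<in>nbrs x. ennreal (L x y / rate x))"
    using False by (intro sum.cong) (auto simp: jump_prob_def rate_def nbrs_def)
  also have "\<dots> = ennreal (\<Sum>y\<in>nbrs x. L x y / rate x)"
    by (intro sum_ennreal divide_nonneg_nonneg L_nonneg rate_nonneg) (auto simp: nbrs_def)
  also have "(\<Sum>y\<in>nbrs x. L x y / rate x) = 1"
    using False by (simp add: sum_divide_distrib[symmetric] rate_eq_sum[symmetric])
  finally show ?thesis by simp
qed

end

section \<open>Cylinder probabilities and the history of a realization\<close>

locale jump_realization = reversible_generator L \<mu>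
  for L :: "'a::countable \<Rightarrow> 'a \<Rightarrow> real" and \<mu> :: "'a pmf" +
  fixes M :: "'w measure" and \<mu>0 :: "'a pmf"
    and Y :: "nat \<Rightarrow> 'w \<Rightarrow> 'a" and H :: "nat \<Rightarrow> 'w \<Rightarrow> ennreal"
  assumes realization: "jump_chain_holding M L \<mu>0 Y H"

sublocale jump_realization \<subseteq> prob_space M
  using realization by (simp add: jump_chain_holding_def)

context jump_realization
begin

lemma measurable_Y [measurable]: "Y n \<in> measurable M (count_space UNIV)"
  and measurable_H [measurable]: "H n \<in> borel_measurable M"
  using realization by (simp_all add: jump_chain_holding_def)

definition path_weight :: "nat \<Rightarrow> (nat \<Rightarrow> 'a) \<Rightarrow> real" where
  "path_weight n y = pmf \<mu>0 (y 0) * (\<Prod>k<n. jump_prob L (y k) (y (Suc k)))"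

lemma path_weight_nonneg: "path_weight n y \<ge> 0"
  unfolding path_weight_def by (intro mult_nonneg_nonneg prod_nonneg jump_prob_nonneg) auto

lemma path_weight_Suc: "path_weight (Suc n) y = path_weight n y * jump_prob L (y n) (y (Suc n))"
  by (simp add: path_weight_def)

lemma path_weight_cong: "(\<And>k. k \<le> n \<Longrightarrow> y k = y' k) \<Longrightarrow> path_weight n y = path_weight n y'"
  unfolding path_weight_def by (intro arg_cong2[of _ _ _ _ "(*)"] prod.cong) auto

lemma emeasure_cylinder_nonneg:
  assumes "\<And>k. t k \<ge> 0"
  shows "emeasure M {\<omega> \<in> space M. \<forall>k\<le>n. Y k \<omega> = y k \<and> ennreal (t k) < H k \<omega>} =
     ennreal (path_weight n y * (\<Prod>k\<le>n. exp (- rate (y k) * t k)))"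
  using realization assms
  unfolding emeasure_eq_measure jump_chain_holding_def path_weight_def rate_def by simp

definition path_event :: "nat \<Rightarrow> (nat \<Rightarrow> 'a) \<Rightarrow> 'w set" where
  "path_event n y = {\<omega> \<in> space M. \<forall>k\<le>n. Y k \<omega> = y k}"

text \<open>The description of a realization controls only events with strict lower bounds
  \<open>t k \<ge> 0\<close> on the holding times. With all bounds 0 it yields the mass of this
  event, not that of \<open>path_event\<close>; that the difference is null has to be
  proved.\<close>

definition pos_event :: "nat \<Rightarrow> (nat \<Rightarrow> 'a) \<Rightarrow> 'w set" where
  "pos_event n y = {\<omega> \<in> space M. \<forall>k\<le>n. Y k \<omega> = y k \<and> 0 < H k \<omega>}"

lemma sets_path_event [measurable]: "path_event n y \<in> sets M" "pos_event n y \<in> sets M"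
  unfolding path_event_def pos_event_def by measurable

lemma emeasure_pos_event: "emeasure M (pos_event n y) = ennreal (path_weight n y)"
  using emeasure_cylinder_nonneg[of "\<lambda>_. 0" n y] by (simp add: pos_event_def)

lemma null_diff_if_emeasure_eq:
  assumes "A \<in> sets M" "B \<in> sets M" "B \<subseteq> A" "emeasure M A \<le> emeasure M B"
  shows "A - B \<in> null_sets M"
proof (rule null_setsI)
  have "emeasure M (A - B) = emeasure M A - emeasure M B"
    using assms by (intro emeasure_Diff) auto
  thus "emeasure M (A - B) = 0"
    using assms(4) by (simp add: diff_eq_0_iff_ennreal emeasure_finite less_top[symmetric])
qed (use assms in auto)

text \<open>The events for different last states are disjoint parts of \<open>P\<close> whose masses
  add up to that of \<open>P\<close>, so only a null set is left over.\<close>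

lemma minus_pos_event_null:
  assumes P: "P \<in> sets M" "\<And>z. pos_event n (y(n := z)) \<subseteq> P"
    and e: "(\<integral>\<^sup>+ z. ennreal (path_weight n (y(n := z))) \<partial>count_space UNIV) = emeasure M P"
  shows "P - (\<Union>z. pos_event n (y(n := z))) \<in> null_sets M"
proof (rule null_diff_if_emeasure_eq)
  have "emeasure M (\<Union>z. pos_event n (y(n := z))) =
    (\<integral>\<^sup>+ z. emeasure M (pos_event n (y(n := z))) \<partial>count_space UNIV)"
    by (rule emeasure_UN_countable)
       (auto simp: disjoint_family_on_def pos_event_def dest!: spec[of _ n])
  thus "emeasure M P \<le> emeasure M (\<Union>z. pos_event n (y(n := z)))"
    by (simp add: emeasure_pos_event e)
qed (use P in \<open>auto intro!: sets.countable_UN'\<close>)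

text \<open>The continuations with positive holding times already carry the whole mass of a path.\<close>

lemma path_minus_pos_null: "path_event n y - pos_event n y \<in> null_sets M"
proof (induction n arbitrary: y)
  case 0
  have "space M - (\<Union>z. pos_event 0 (y(0 := z))) \<in> null_sets M"
    by (rule minus_pos_event_null)
       (auto simp: pos_event_def path_weight_def nn_integral_pmf' emeasure_space_1
         nn_integral_pmf_eq_1)
  thus ?case
    by (rule null_sets_subset) (auto simp: path_event_def pos_event_def)
next
  case (Suc n)
  have "emeasure M (path_event n y) = emeasure M (pos_event n y)"
  proof -
    have "path_event n y - (path_event n y - pos_event n y) = pos_event n y"
      by (auto simp: path_event_def pos_event_def)
    thus ?thesis using emeasure_Diff_null_set[OF Suc[of y], of "path_event n y"] by simp
  qed
  also have "\<dots> = (\<integral>\<^sup>+ z. ennreal (path_weight n y) * ennreal (jump_prob L (y n) z) \<partial>count_space UNIV)"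
    by (simp add: nn_integral_cmult nn_integral_jump_prob emeasure_pos_event)
  also have "\<dots> = (\<integral>\<^sup>+ z. ennreal (path_weight (Suc n) (y(Suc n := z))) \<partial>count_space UNIV)"
  proof (rule nn_integral_cong)
    fix z
    have "path_weight n (y(Suc n := z)) = path_weight n y"
      by (rule path_weight_cong) auto
    thus "ennreal (path_weight n y) * ennreal (jump_prob L (y n) z) =
        ennreal (path_weight (Suc n) (y(Suc n := z)))"
      by (simp add: path_weight_Suc ennreal_mult' path_weight_nonneg)
  qed
  finally have "path_event n y - (\<Union>z. pos_event (Suc n) (y(Suc n := z))) \<in> null_sets M"
    by (intro minus_pos_event_null) (auto simp: path_event_def pos_event_def)
  thus ?case
    by (rule null_sets_subset) (auto simp: path_event_def pos_event_def)
qed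

lemma AE_H_pos: "AE \<omega> in M. \<forall>n. 0 < H n \<omega>"
proof (subst AE_all_countable, intro allI)
  fix n
  \<comment> \<open>Lists enumerate the countably many finite paths; only the entries up to index
    \<open>n\<close> matter.\<close>
  have "(\<Union>xs::'a list. path_event n ((!) xs) - pos_event n ((!) xs)) \<in> null_sets M"
    by (intro null_sets_UN' path_minus_pos_null) auto
  thus "AE \<omega> in M. 0 < H n \<omega>"
  proof (rule AE_I')
    show "{\<omega> \<in> space M. \<not> 0 < H n \<omega>} \<subseteq> (\<Union>xs::'a list. path_event n ((!) xs) - pos_event n ((!) xs))"
    proof
      fix \<omega> assume "\<omega> \<in> {\<omega> \<in> space M. \<not> 0 < H n \<omega>}"
      hence "\<omega> \<in> path_event n ((!) (map (\<lambda>k. Y k \<omega>) [0..<Suc n])) - pos_event n ((!) (map (\<lambda>k. Y k \<omega>) [0..<Suc n]))"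
        by (auto simp: path_event_def pos_event_def nth_append simp del: upt_Suc)
      thus "\<omega> \<in> (\<Union>xs::'a list. path_event n ((!) xs) - pos_event n ((!) xs))" by blast
    qed
  qed
qed

lemma AE_H_in_ray: "AE \<omega> in M. \<forall>n t. H n \<omega> \<in> ray t \<longleftrightarrow> ennreal (max 0 t) < H n \<omega>"
  using AE_H_pos by eventually_elim (auto simp: ray_def max_def)

text \<open>What is known at the \<open>n\<close>-th jump: the states up to \<open>Y n\<close>, and the holding times before.\<close>

definition hist_gen :: "nat \<Rightarrow> (nat \<Rightarrow> 'a) \<Rightarrow> (nat \<Rightarrow> real) \<Rightarrow> 'w set" where
  "hist_gen n y t = {\<omega> \<in> space M. \<forall>k\<le>n. Y k \<omega> = y k \<and> (k < n \<longrightarrow> H k \<omega> \<in> ray (t k))}"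

text \<open>The empty set is included for stability under intersection: generators with different
  states are disjoint.\<close>

definition hist_gens :: "nat \<Rightarrow> 'w set set" where
  "hist_gens n = insert {} (\<Union>y t. {hist_gen n y t})"

definition hist :: "nat \<Rightarrow> 'w measure" where
  "hist n = sigma (space M) (hist_gens n)"

lemma ray_borel [measurable]: "ray t \<in> sets borel"
  by (simp add: sets_borel_eq_ray)

lemma sets_hist_gen [measurable]: "hist_gen n y t \<in> sets M"
  unfolding hist_gen_def by measurable

lemma hist_gens_Pow: "hist_gens n \<subseteq> Pow (space M)"
  by (auto simp: hist_gens_def hist_gen_def)

lemma space_hist [simp]: "space (hist n) = space M"
  and sets_hist: "sets (hist n) = sigma_sets (space M) (hist_gens n)"
  using hist_gens_Pow by (auto simp: hist_def space_measure_of sets_measure_of)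

lemma hist_gens_M: "hist_gens n \<subseteq> sets M"
  by (auto simp: hist_gens_def)

lemma sets_hist_subset: "sets (hist n) \<subseteq> sets M"
  unfolding sets_hist by (rule sets.sigma_sets_subset[OF hist_gens_M])

lemma Int_stable_hist_gens: "Int_stable (hist_gens n)"
proof (rule Int_stableI)
  fix A B assume "A \<in> hist_gens n" "B \<in> hist_gens n"
  then consider "A \<inter> B = {}" | y s z t where "A = hist_gen n y s" "B = hist_gen n z t"
    by (auto simp: hist_gens_def)
  thus "A \<inter> B \<in> hist_gens n"
  proof cases
    case 2
    show ?thesis
    proof (cases "\<forall>k\<le>n. y k = z k")
      case True
      hence "A \<inter> B = hist_gen n y (\<lambda>k. max (s k) (t k))"
        unfolding 2 hist_gen_def ray_Int[symmetric] by auto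
      thus ?thesis by (auto simp: hist_gens_def)
    next
      case False
      hence "A \<inter> B = {}" unfolding 2 hist_gen_def by auto
      thus ?thesis by (simp add: hist_gens_def)
    qed
  qed (simp add: hist_gens_def)
qed

text \<open>The parameter \<open>-1\<close> imposes no condition on the holding times, so finite
  paths alone give the countable cover that uniqueness of measures requires.\<close>

definition hist_cover :: "nat \<Rightarrow> 'w set set" where
  "hist_cover n = (\<Union>xs::'a list. {hist_gen n ((!) xs) (\<lambda>_. -1)})"

lemma hist_cover: "hist_cover n \<subseteq> hist_gens n" "\<Union> (hist_cover n) = space M" "countable (hist_cover n)"
proof -
  show "\<Union> (hist_cover n) = space M"
  proof (intro equalityI subsetI)
    fix \<omega> assume "\<omega> \<in> space M"
    hence "\<omega> \<in> hist_gen n ((!) (map (\<lambda>k. Y k \<omega>) [0..<Suc n])) (\<lambda>_. -1)"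
      by (auto simp: hist_gen_def ray_def simp del: upt_Suc)
    thus "\<omega> \<in> \<Union> (hist_cover n)" unfolding hist_cover_def by blast
  qed (auto simp: hist_cover_def hist_gen_def)
qed (auto simp: hist_cover_def hist_gens_def)

definition at_state :: "nat \<Rightarrow> 'a \<Rightarrow> 'w set" where
  "at_state n z = {\<omega> \<in> space M. Y n \<omega> = z}"

definition holding :: "nat \<Rightarrow> real \<Rightarrow> 'w set" where
  "holding n s = {\<omega> \<in> space M. H n \<omega> \<in> ray s}"

lemma sets_at_state [measurable]: "at_state n z \<in> sets M" "holding n s \<in> sets M"
  unfolding at_state_def holding_def by measurable

lemma hist_gen_cong:
  "(\<And>k. k \<le> n \<Longrightarrow> y k = y' k) \<Longrightarrow> (\<And>k. k < n \<Longrightarrow> t k = t' k) \<Longrightarrow> hist_gen n y t = hist_gen n y' t'"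
  by (auto simp: hist_gen_def)

lemma hist_gen_Suc:
  "hist_gen (Suc n) y t = hist_gen n y t \<inter> holding n (t n) \<inter> at_state (Suc n) (y (Suc n))"
proof -
  have 1: "(\<forall>k\<le>Suc n. P k) \<longleftrightarrow> (\<forall>k\<le>n. P k) \<and> P (Suc n)" for P
    by (metis le_Suc_eq)
  have 2: "(\<forall>k\<le>n. A k \<and> (k < Suc n \<longrightarrow> B k)) \<longleftrightarrow> (\<forall>k\<le>n. A k \<and> (k < n \<longrightarrow> B k)) \<and> B n" for A B
    by (metis less_Suc_eq_le order.order_iff_strict order.refl)
  show ?thesis
    unfolding hist_gen_def holding_def at_state_def 1 2 by auto
qed

lemma hist_gen_neg: "hist_gen n y t \<inter> holding n (-1) = hist_gen n y t"
proof -
  have "holding n (-1) = space M" by (simp add: holding_def ray_def)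
  moreover have "hist_gen n y t \<subseteq> space M" by (simp add: hist_gen_def)
  ultimately show ?thesis by (simp add: Int_absorb2)
qed

lemma hist_gen_at_state:
  "y n = z \<Longrightarrow> hist_gen n y t \<inter> (at_state n z \<inter> C) = hist_gen n y t \<inter> C"
  "y n \<noteq> z \<Longrightarrow> hist_gen n y t \<inter> (at_state n z \<inter> C) = {}"
  "y n = z \<Longrightarrow> hist_gen n y t \<inter> at_state n z = hist_gen n y t"
  "y n \<noteq> z \<Longrightarrow> hist_gen n y t \<inter> at_state n z = {}"
  by (auto simp: hist_gen_def at_state_def)

lemma emeasure_hist_gen:
  "emeasure M (hist_gen n y t \<inter> holding n s) =
   ennreal (path_weight n y * (\<Prod>k<n. exp (- rate (y k) * max 0 (t k))) * exp (- rate (y n) * max 0 s))"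
proof -
  \<comment> \<open>A negative bound is no condition; as holding times are almost surely positive,
    it may be replaced by 0, which brings the event into the form of the known cylinders.\<close>
  define t' where "t' k = max 0 (if k < n then t k else s)" for k
  have "emeasure M (hist_gen n y t \<inter> holding n s) =
     emeasure M {\<omega> \<in> space M. \<forall>k\<le>n. Y k \<omega> = y k \<and> ennreal (t' k) < H k \<omega>}"
  proof (rule emeasure_eq_AE)
    show "AE \<omega> in M. \<omega> \<in> hist_gen n y t \<inter> holding n s \<longleftrightarrow>
        \<omega> \<in> {\<omega> \<in> space M. \<forall>k\<le>n. Y k \<omega> = y k \<and> ennreal (t' k) < H k \<omega>}"
      using AE_H_in_ray
      by eventually_elim (auto simp: hist_gen_def t'_def le_less holding_def)
  qed measurable
  also have "\<dots> = ennreal (path_weight n y * (\<Prod>k\<le>n. exp (- rate (y k) * t' k)))"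
    by (rule emeasure_cylinder_nonneg) (simp add: t'_def)
  also have "(\<Prod>k\<le>n. exp (- rate (y k) * t' k)) =
      (\<Prod>k<n. exp (- rate (y k) * max 0 (t k))) * exp (- rate (y n) * max 0 s)"
    by (simp add: lessThan_Suc_atMost[symmetric] t'_def)
  finally show ?thesis by (simp add: mult.assoc)
qed

lemma emeasure_hist_gen':
  "emeasure M (hist_gen n y t) =
   ennreal (path_weight n y * (\<Prod>k<n. exp (- rate (y k) * max 0 (t k))))"
  using emeasure_hist_gen[of n y t "-1"] by (simp add: hist_gen_neg)

text \<open>Conditionally on the path the holding times are independent, so a bound on the current
  one contributes just its exponential tail.\<close>

lemma hist_gen_holding:
  "emeasure M (hist_gen n y t \<inter> (at_state n z \<inter> holding n s)) =
   emeasure M (hist_gen n y t \<inter> at_state n z) * ennreal (exp (- rate z * max 0 s))"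
proof (cases "y n = z")
  case True
  have "emeasure M (hist_gen n y t \<inter> holding n s) =
      emeasure M (hist_gen n y t) * ennreal (exp (- rate z * max 0 s))"
    unfolding emeasure_hist_gen emeasure_hist_gen' True by (rule ennreal_mult'') simp
  thus ?thesis using True by (simp add: hist_gen_at_state)
qed (simp add: hist_gen_at_state)

lemma hist_gen_holding_next:
  "emeasure M (hist_gen n y t \<inter> (at_state n z \<inter> holding n s \<inter> at_state (Suc n) x)) =
   emeasure M (hist_gen n y t \<inter> at_state n z) * ennreal (exp (- rate z * max 0 s) * jump_prob L z x)"
proof (cases "y n = z")
  case True
  define y' where "y' = y(Suc n := x)"
  define t' where "t' = t(n := s)"
  have y': "y' k = y k" if "k \<le> n" for k using that by (simp add: y'_def)
  have e: "hist_gen n y t = hist_gen n y' t'"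
    by (rule hist_gen_cong) (auto simp: y'_def t'_def)
  hence "hist_gen n y t \<inter> (holding n s \<inter> at_state (Suc n) x) = hist_gen (Suc n) y' t'"
    by (simp add: hist_gen_Suc y'_def t'_def Int_assoc)
  moreover have "emeasure M (hist_gen (Suc n) y' t') =
      emeasure M (hist_gen n y' t') * ennreal (exp (- rate z * max 0 s) * jump_prob L z x)"
    unfolding emeasure_hist_gen' path_weight_Suc
    by (subst ennreal_mult''[symmetric])
      (simp_all add: jump_prob_nonneg True t'_def y'_def mult_ac)
  ultimately show ?thesis
    unfolding Int_assoc hist_gen_at_state(1,3)[where y = y, OF True] by (simp only: e)
qed (simp add: hist_gen_at_state Int_assoc)

lemma hist_eqI:
  assumes [measurable]: "C \<in> sets M" "D \<in> sets M"
    and eq: "\<And>y t. emeasure M (hist_gen n y t \<inter> C) = emeasure M (hist_gen n y t \<inter> D) * ennreal c"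
    and B: "B \<in> sets (hist n)"
  shows "emeasure M (B \<inter> C) = emeasure M (B \<inter> D) * ennreal c"
proof (rule emeasure_Int_eqI[OF Int_stable_hist_gens hist_gens_M _ _ _ _ hist_cover])
  show "B \<in> sigma_sets (space M) (hist_gens n)" using B by (simp add: sets_hist)
qed (use eq in \<open>auto simp: hist_gens_def\<close>)

text \<open>Given the history and \<open>Y n = z\<close>, the holding time has law
  \<open>exp_law (rate z)\<close> and is independent of \<open>C\<close>, which has conditional
  probability \<open>c\<close>. \<open>C\<close> is going to be the whole space or the event of a
  given next state.\<close>

lemma nn_integral_hist_holding:
  assumes [measurable]: "C \<in> sets M" and c: "c \<ge> 0"
    and eq: "\<And>y t s. emeasure M (hist_gen n y t \<inter> (at_state n z \<inter> holding n s \<inter> C)) =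
      emeasure M (hist_gen n y t \<inter> at_state n z) * ennreal (exp (- rate z * max 0 s) * c)"
    and F [measurable]: "F \<in> borel_measurable (hist n \<Otimes>\<^sub>M borel)"
  shows "(\<integral>\<^sup>+ \<omega>. indicator (at_state n z \<inter> C) \<omega> * F (\<omega>, H n \<omega>) \<partial>M) =
     ennreal c * (\<integral>\<^sup>+ \<omega>. indicator (at_state n z) \<omega> * (\<integral>\<^sup>+ u. F (\<omega>, u) \<partial>exp_law (rate z)) \<partial>M)"
proof -
  interpret E: prob_space "exp_law (rate z)"
    by (rule prob_space_exp_law[OF rate_nonneg])
  define D where "D = at_state n z"
  have [measurable]: "D \<in> sets M" by (simp add: D_def)
  have sub: "A \<in> sets M" if "A \<in> sets (hist n)" for A
    using that sets_hist_subset by auto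
  have id [measurable]: "(\<lambda>\<omega>. \<omega>) \<in> measurable M (hist n)"
    using sets_hist_subset by (auto simp: measurable_def)
  have pair: "(\<lambda>\<omega>. (\<omega>, H n \<omega>)) \<in> measurable M (hist n \<Otimes>\<^sub>M borel)"
    by measurable
  \<comment> \<open>\<open>N\<close> is the joint law of history and holding time on the event,
    \<open>N1\<close> the law of the history scaled by \<open>c\<close>; the claim is that
    \<open>N\<close> is a product.\<close>
  define N1 where "N1 = weighted_image (ennreal c) D M (hist n) (\<lambda>\<omega>. \<omega>)"
  define N where "N = weighted_image 1 (D \<inter> C) M (hist n \<Otimes>\<^sub>M borel) (\<lambda>\<omega>. (\<omega>, H n \<omega>))"
  have N1: "emeasure N1 A = ennreal c * emeasure M (A \<inter> D)" if "A \<in> sets (hist n)" for A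
    using that sub[OF that] sets.sets_into_space[of A M]
    by (simp add: N1_def emeasure_weighted_image[OF id] Int_absorb2 Int_commute)
  have N: "emeasure N (A \<times> B) = emeasure M (A \<inter> D \<inter> C \<inter> (H n -` B \<inter> space M))"
    if A: "A \<in> sets (hist n)" and B: "B \<in> sets borel" for A B
  proof -
    have "D \<inter> C \<inter> ((\<lambda>\<omega>. (\<omega>, H n \<omega>)) -` (A \<times> B) \<inter> space M) = A \<inter> D \<inter> C \<inter> (H n -` B \<inter> space M)" by auto
    thus ?thesis using A B by (simp add: N_def emeasure_weighted_image[OF pair])
  qed
  have "N1 \<Otimes>\<^sub>M exp_law (rate z) = N"
  proof (rule pair_measure_eqI)
    have "emeasure N1 (space N1) \<noteq> \<infinity>"
      using N1[of "space M"] sets.top[of "hist n"]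
      by (simp add: N1_def weighted_image_def ennreal_mult_eq_top_iff)
    then interpret N1: finite_measure N1 by (rule finite_measureI)
    show "sigma_finite_measure N1" ..
    show "sigma_finite_measure (exp_law (rate z))" ..
    show "sets (N1 \<Otimes>\<^sub>M exp_law (rate z)) = sets N"
      unfolding N1_def N_def by (simp cong: sets_pair_measure_cong)
  next
    fix A B assume A': "A \<in> sets N1" and B': "B \<in> sets (exp_law (rate z))"
    have A: "A \<in> sets (hist n)" using A' by (simp add: N1_def)
    note [measurable] = sub[OF A]
    have B: "B \<in> sets borel" using B' by simp
    \<comment> \<open>For a fixed history event both sides are measures in the holding time, and it
      suffices to compare them on the rays.\<close>
    define P1 where "P1 = weighted_image 1 (A \<inter> D \<inter> C) M borel (H n)"
    define P2 where "P2 = scale_measure (emeasure N1 A) (exp_law (rate z))"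
    have P1: "emeasure P1 X = emeasure M (A \<inter> D \<inter> C \<inter> (H n -` X \<inter> space M))" if "X \<in> sets borel" for X
      using that by (simp add: P1_def emeasure_weighted_image[OF measurable_H])
    have "P1 = P2"
    proof (rule measure_eqI_generator_eq[of "range ray" UNIV _ _ "\<lambda>_. ray (-1)"])
      show "Int_stable (range ray)"
        by (rule Int_stableI) (auto simp: ray_Int)
      show "sets P1 = sigma_sets UNIV (range ray)" "sets P2 = sigma_sets UNIV (range ray)"
        by (simp_all add: P1_def P2_def sets_borel_eq_ray)
      show "range (\<lambda>_::nat. ray (-1)) \<subseteq> range ray" by auto
      show "emeasure P1 (ray (-1)) \<noteq> \<infinity>"
        by (simp add: P1 emeasure_eq_measure)
    next
      fix X assume "X \<in> range ray"
      then obtain s where X: "X = ray s" by auto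
      have "emeasure P1 X = emeasure M (A \<inter> (at_state n z \<inter> holding n s \<inter> C))"
        unfolding X by (subst P1) (auto simp: holding_def D_def intro!: arg_cong[where f = "emeasure M"])
      also have "\<dots> = emeasure M (A \<inter> D) * ennreal (exp (- rate z * max 0 s) * c)"
        unfolding D_def by (rule hist_eqI[OF _ _ eq A]) measurable
      also have "\<dots> = emeasure P2 X"
        using c A unfolding X P2_def
        by (simp add: N1 emeasure_exp_law_ray[OF rate_nonneg] ennreal_mult mult_ac)
      finally show "emeasure P1 X = emeasure P2 X" .
    qed (simp_all add: ray_def[of "-1"])
    thus "emeasure N1 A * emeasure (exp_law (rate z)) B = emeasure N (A \<times> B)"
      using P1[OF B] N[OF A B] by (simp add: P2_def)
  qed
  hence "(\<integral>\<^sup>+ x. F x \<partial>N) = (\<integral>\<^sup>+ \<omega>. (\<integral>\<^sup>+ u. F (\<omega>, u) \<partial>exp_law (rate z)) \<partial>N1)"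
    using F by (subst E.nn_integral_fst) (simp_all add: N1_def cong: measurable_cong_sets sets_pair_measure_cong)
  moreover have "(\<integral>\<^sup>+ x. F x \<partial>N) = (\<integral>\<^sup>+ \<omega>. indicator (D \<inter> C) \<omega> * F (\<omega>, H n \<omega>) \<partial>M)"
    unfolding N_def by (simp add: nn_integral_weighted_image[OF pair])
  moreover have "(\<integral>\<^sup>+ \<omega>. (\<integral>\<^sup>+ u. F (\<omega>, u) \<partial>exp_law (rate z)) \<partial>N1) =
      ennreal c * (\<integral>\<^sup>+ \<omega>. indicator D \<omega> * (\<integral>\<^sup>+ u. F (\<omega>, u) \<partial>exp_law (rate z)) \<partial>M)"
    unfolding N1_def by (rule nn_integral_weighted_image[OF id]) measurable
  ultimately show ?thesis by (simp add: D_def)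
qed

lemma nn_integral_holding:
  assumes "F \<in> borel_measurable (hist n \<Otimes>\<^sub>M borel)"
  shows "(\<integral>\<^sup>+ \<omega>. indicator (at_state n z) \<omega> * F (\<omega>, H n \<omega>) \<partial>M) =
     (\<integral>\<^sup>+ \<omega>. indicator (at_state n z) \<omega> * (\<integral>\<^sup>+ u. F (\<omega>, u) \<partial>exp_law (rate z)) \<partial>M)"
proof -
  have "at_state n z \<inter> space M = at_state n z" "at_state n z \<inter> holding n s \<inter> space M = at_state n z \<inter> holding n s" for s
    by (auto simp: at_state_def)
  thus ?thesis
    using nn_integral_hist_holding[of "space M" 1 n z F] assms hist_gen_holding by simp
qed

lemma nn_integral_holding_next:
  assumes "F \<in> borel_measurable (hist n \<Otimes>\<^sub>M borel)"
  shows "(\<integral>\<^sup>+ \<omega>. indicator (at_state n z \<inter> at_state (Suc n) x) \<omega> * F (\<omega>, H n \<omega>) \<partial>M) =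
     ennreal (jump_prob L z x) *
       (\<integral>\<^sup>+ \<omega>. indicator (at_state n z) \<omega> * (\<integral>\<^sup>+ u. F (\<omega>, u) \<partial>exp_law (rate z)) \<partial>M)"
  by (rule nn_integral_hist_holding[OF _ jump_prob_nonneg hist_gen_holding_next assms]) simp

lemma measurable_Y_hist [measurable (raw)]:
  assumes "k \<le> n"
  shows "Y k \<in> measurable (hist n) (count_space UNIV)"
proof (rule measurable_count_space_eq2_countable[THEN iffD2], intro conjI ballI)
  fix a :: 'a
  have "Y k -` {a} \<inter> space (hist n) =
    (\<Union>xs\<in>{xs::'a list. xs ! k = a}. hist_gen n ((!) xs) (\<lambda>_. -1))" (is "_ = ?R")
  proof (intro equalityI subsetI)
    fix \<omega> assume \<omega>: "\<omega> \<in> Y k -` {a} \<inter> space (hist n)"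
    define xs where "xs = map (\<lambda>k. Y k \<omega>) [0..<Suc n]"
    have "xs ! j = Y j \<omega>" if "j \<le> n" for j
      using that by (simp add: xs_def del: upt_Suc)
    hence "xs ! k = a" "\<omega> \<in> hist_gen n ((!) xs) (\<lambda>_. -1)"
      using \<omega> assms by (auto simp: hist_gen_def ray_def)
    thus "\<omega> \<in> ?R" by blast
  qed (use assms in \<open>auto simp: hist_gen_def\<close>)
  also have "\<dots> \<in> sets (hist n)"
    by (intro sets.countable_UN') (auto simp: sets_hist hist_gens_def)
  finally show "Y k -` {a} \<inter> space (hist n) \<in> sets (hist n)" .
qed auto

lemma measurable_H_hist [measurable (raw)]:
  assumes "k < n"
  shows "H k \<in> borel_measurable (hist n)"
proof (rule measurable_sigma_sets[OF sets_borel_eq_ray])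
  fix A assume "A \<in> range ray"
  then obtain t where A: "A = ray t" by auto
  have "H k -` ray t \<inter> space (hist n) =
    (\<Union>xs::'a list. hist_gen n ((!) xs) (\<lambda>j. if j = k then t else -1))" (is "_ = ?R")
  proof (intro equalityI subsetI)
    fix \<omega> assume \<omega>: "\<omega> \<in> H k -` ray t \<inter> space (hist n)"
    define xs where "xs = map (\<lambda>k. Y k \<omega>) [0..<Suc n]"
    have "xs ! j = Y j \<omega>" if "j \<le> n" for j
      using that by (simp add: xs_def del: upt_Suc)
    moreover have "H j \<omega> \<in> ray (-1)" for j by (simp add: ray_def)
    ultimately have "\<omega> \<in> hist_gen n ((!) xs) (\<lambda>j. if j = k then t else -1)"
      using \<omega> assms by (auto simp: hist_gen_def)
    thus "\<omega> \<in> ?R" by blast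
  next
    fix \<omega> assume "\<omega> \<in> ?R"
    then obtain xs :: "'a list" where "\<omega> \<in> hist_gen n ((!) xs) (\<lambda>j. if j = k then t else -1)"
      by blast
    hence "\<omega> \<in> space M \<and> H k \<omega> \<in> ray (if k = k then t else -1)"
      unfolding hist_gen_def using less_imp_le[OF assms] assms by blast
    thus "\<omega> \<in> H k -` ray t \<inter> space (hist n)" by simp
  qed
  also have "\<dots> \<in> sets (hist n)"
    by (intro sets.countable_UN') (auto simp: sets_hist hist_gens_def)
  finally show "H k -` A \<inter> space (hist n) \<in> sets (hist n)" by (simp only: A)
qed auto

section \<open>Jump times and the number of jumps between two times\<close>

abbreviation J :: "nat \<Rightarrow> 'w \<Rightarrow> ennreal" where
  "J \<equiv> jump_time H"

lemma J_Suc: "J (Suc n) \<omega> = J n \<omega> + H n \<omega>"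
  by (simp add: jump_time_def)

lemma measurable_J_hist [measurable (raw)]:
  assumes "k \<le> n"
  shows "J k \<in> borel_measurable (hist n)"
proof -
  have "(\<lambda>\<omega>. \<Sum>i<k. H i \<omega>) \<in> borel_measurable (hist n)"
    by (intro borel_measurable_sum measurable_H_hist) (use assms in auto)
  thus ?thesis by (simp add: jump_time_def[abs_def])
qed

lemma measurable_J: "J k \<in> borel_measurable M"
  unfolding jump_time_def[abs_def] by measurable

declare measurable_H [measurable del]

lemma sets_hist_mono: "n \<le> m \<Longrightarrow> sets (hist n) \<subseteq> sets (hist m)"
proof -
  assume nm: "n \<le> m"
  have "hist_gen n y t \<in> sets (hist m)" for y t
  proof -
    have "hist_gen n y t = (\<Inter>k\<in>{..n}. {\<omega> \<in> space (hist m). Y k \<omega> = y k}) \<inter>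
        (\<Inter>k\<in>{..n}. {\<omega> \<in> space (hist m). k < n \<longrightarrow> H k \<omega> \<in> ray (t k)})"
      by (auto simp: hist_gen_def)
    also have "\<dots> \<in> sets (hist m)"
    proof (intro sets.Int sets.finite_INT)
      fix k assume "k \<in> {..n}"
      hence "k \<le> m" using nm by simp
      thus "{\<omega> \<in> space (hist m). Y k \<omega> = y k} \<in> sets (hist m)" by measurable
      show "{\<omega> \<in> space (hist m). k < n \<longrightarrow> H k \<omega> \<in> ray (t k)} \<in> sets (hist m)"
      proof (cases "k < n")
        case True
        hence "k < m" using nm by simp
        hence "{\<omega> \<in> space (hist m). H k \<omega> \<in> ray (t k)} \<in> sets (hist m)" by measurable
        thus ?thesis using True by simp
      next
        case False
        thus ?thesis by (simp only: False simp_thms Collect_mem_eq sets.top)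
      qed
    qed auto
    finally show ?thesis .
  qed
  hence "hist_gens n \<subseteq> sets (hist m)"
    by (auto simp: hist_gens_def)
  from sets.sigma_sets_subset[OF this] show ?thesis by (simp add: sets_hist[of n])
qed

definition in_state :: "nat \<Rightarrow> real \<Rightarrow> 'a \<Rightarrow> 'w set" where
  "in_state n t y = {\<omega> \<in> space M. Y n \<omega> = y \<and> J n \<omega> \<le> ennreal t \<and> ennreal t < J (Suc n) \<omega>}"

lemma sets_in_state [measurable]: "in_state n t y \<in> sets M"
  supply [measurable] = measurable_J
  unfolding in_state_def by measurable

lemma sets_hist_M: "A \<in> sets (hist n) \<Longrightarrow> A \<in> sets M"
  using sets_hist_subset by auto

lemma exp_law_beyond:
  assumes "j \<le> ennreal t" "t \<ge> 0"
  shows "(\<integral>\<^sup>+ u. indicator {u. ennreal t < j + u} u \<partial>exp_law (rate z)) =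
    ennreal (exp (- rate z * (t - enn2real j)))"
proof -
  obtain r where r: "j = ennreal r" "r \<ge> 0"
    using assms by (cases j) (auto simp: top_unique)
  have "r \<le> t" using assms r by simp
  have "{u. ennreal t < j + u} = ray (t - r)"
  proof -
    have "ennreal t < ennreal r + u \<longleftrightarrow> ennreal (t - r) < u" for u
      using r \<open>r \<le> t\<close> by (cases u) (auto simp: ennreal_less_iff ennreal_plus[symmetric] simp del: ennreal_plus)
    thus ?thesis using \<open>r \<le> t\<close> r by (auto simp: ray_def)
  qed
  thus ?thesis using \<open>r \<le> t\<close> r
    by (simp add: emeasure_exp_law_ray[OF rate_nonneg])
qed

text \<open>\<open>J n\<close> belongs to the history, so the conditional probability is that of an
  exponential time exceeding \<open>t - J n\<close>.\<close>

lemma emeasure_holding_at: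
  assumes B: "B \<in> sets (hist n)" and t: "t \<ge> 0"
  shows "emeasure M (B \<inter> in_state n t z) =
    (\<integral>\<^sup>+ \<omega>. indicator (B \<inter> at_state n z) \<omega> * (if J n \<omega> \<le> ennreal t then
       ennreal (exp (- rate z * (t - enn2real (J n \<omega>)))) else 0) \<partial>M)"
proof -
  note [measurable] = B
  define F where "F p = indicator B (fst p) * (if J n (fst p) \<le> ennreal t \<and> ennreal t < J n (fst p) + snd p then 1 else 0 :: ennreal)" for p
  have [measurable]: "J n \<in> borel_measurable (hist n)"
    by (rule measurable_J_hist) simp
  have F [measurable]: "F \<in> borel_measurable (hist n \<Otimes>\<^sub>M borel)"
    unfolding F_def by measurable
  note [measurable] = measurable_J measurable_H sets_hist_M[OF B]
  have "emeasure M (B \<inter> in_state n t z) = (\<integral>\<^sup>+ \<omega>. indicator (at_state n z) \<omega> * F (\<omega>, H n \<omega>) \<partial>M)"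
    by (subst nn_integral_indicator[symmetric], measurable, intro nn_integral_cong)
       (auto simp: F_def in_state_def at_state_def J_Suc split: split_indicator)
  also have "\<dots> = (\<integral>\<^sup>+ \<omega>. indicator (at_state n z) \<omega> * (\<integral>\<^sup>+ u. F (\<omega>, u) \<partial>exp_law (rate z)) \<partial>M)"
    by (rule nn_integral_holding[OF F])
  also have "\<dots> = (\<integral>\<^sup>+ \<omega>. indicator (B \<inter> at_state n z) \<omega> * (if J n \<omega> \<le> ennreal t then
       ennreal (exp (- rate z * (t - enn2real (J n \<omega>)))) else 0) \<partial>M)"
  proof (intro nn_integral_cong)
    fix \<omega> assume "\<omega> \<in> space M"
    have "(\<integral>\<^sup>+ u. F (\<omega>, u) \<partial>exp_law (rate z)) = indicator B \<omega> * (if J n \<omega> \<le> ennreal t then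
       ennreal (exp (- rate z * (t - enn2real (J n \<omega>)))) else 0)"
    proof (cases "\<omega> \<in> B \<and> J n \<omega> \<le> ennreal t")
      case True
      hence "(\<integral>\<^sup>+ u. F (\<omega>, u) \<partial>exp_law (rate z)) =
         (\<integral>\<^sup>+ u. indicator {u. ennreal t < J n \<omega> + u} u \<partial>exp_law (rate z))"
        by (intro nn_integral_cong) (auto simp: F_def)
      thus ?thesis using True exp_law_beyond[of "J n \<omega>" t z] t by simp
    next
      case False
      hence "F (\<omega>, u) = 0" for u by (auto simp: F_def)
      thus ?thesis using False by auto
    qed
    thus "indicator (at_state n z) \<omega> * (\<integral>\<^sup>+ u. F (\<omega>, u) \<partial>exp_law (rate z)) =
      indicator (B \<inter> at_state n z) \<omega> * (if J n \<omega> \<le> ennreal t then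
       ennreal (exp (- rate z * (t - enn2real (J n \<omega>)))) else 0)"
      by (simp split: split_indicator)
  qed
  finally show ?thesis .
qed

text \<open>Substitution \<open>r = j + u\<close>, from the holding time to the time of the next
  jump. The condition \<open>f \<infinity> = 0\<close> settles absorbing states and infinite
  \<open>j\<close>.\<close>

lemma nn_integral_exp_law_shift:
  assumes [measurable]: "f \<in> borel_measurable borel" and f: "f \<infinity> = 0"
  shows "(\<integral>\<^sup>+ u. f (j + u) \<partial>exp_law (rate z)) =
     (\<integral>\<^sup>+ r. f (ennreal r) * (ennreal (rate z) * (if j \<le> ennreal r \<and> 0 \<le> r then
       ennreal (exp (- rate z * (r - enn2real j))) else 0)) \<partial>lborel)"
proof (cases j)
  case (real a)
  have "(\<integral>\<^sup>+ u. f (j + u) \<partial>exp_law (rate z)) =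
      (\<integral>\<^sup>+ u. (if 0 \<le> u then ennreal (rate z * exp (- rate z * u)) * f (j + ennreal u) else 0) \<partial>lborel)"
    by (rule nn_integral_exp_law[OF rate_nonneg]) (use f in auto)
  also have "\<dots> = (\<integral>\<^sup>+ r. f (ennreal (a + r)) * (ennreal (rate z) * (if j \<le> ennreal (a + r) \<and> 0 \<le> a + r then
       ennreal (exp (- rate z * (a + r - enn2real j))) else 0)) \<partial>lborel)"
    using real rate_nonneg[of z]
    by (intro nn_integral_cong) (auto simp: ennreal_mult' mult_ac ennreal_plus[symmetric] simp del: ennreal_plus)
  also have "\<dots> = (\<integral>\<^sup>+ r. f (ennreal r) * (ennreal (rate z) * (if j \<le> ennreal r \<and> 0 \<le> r then
       ennreal (exp (- rate z * (r - enn2real j))) else 0)) \<partial>lborel)"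
    using nn_integral_real_affine[of "\<lambda>r. f (ennreal r) * (ennreal (rate z) * (if j \<le> ennreal r \<and> 0 \<le> r then
       ennreal (exp (- rate z * (r - enn2real j))) else 0))" 1 a] by (simp cong: if_cong)
  finally show ?thesis .
next
  case top
  thus ?thesis using f by (simp add: top_unique)
qed

text \<open>Decomposition according to the time \<open>r\<close> of the last jump.\<close>

lemma emeasure_last_jump:
  assumes B: "B \<in> sets (hist k)" and s: "0 \<le> s" "s \<le> t"
  shows "emeasure M (B \<inter> {\<omega> \<in> space M. ennreal s < J (Suc k) \<omega>} \<inter> in_state (Suc k) t y) =
    (\<integral>\<^sup>+ r. (if s < r \<and> r \<le> t then ennreal (exp (- rate y * (t - r))) *
       (\<Sum>z\<in>nbrs y. emeasure M (B \<inter> in_state k r z) * ennreal (L z y)) else 0) \<partial>lborel)"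
proof -
  note [measurable] = B
  have B_Suc [measurable]: "B \<in> sets (hist (Suc k))" using sets_hist_mono[of k "Suc k"] B by auto
  \<comment> \<open>\<open>f \<rho>\<close> is the probability of staying in \<open>y\<close> until
    \<open>t\<close> after a last jump at \<open>\<rho>\<close>, cut off to the jump times between
    \<open>s\<close> and \<open>t\<close>.\<close>
  define f :: "ennreal \<Rightarrow> ennreal" where
    "f \<rho> = (if ennreal s < \<rho> \<and> \<rho> \<le> ennreal t then ennreal (exp (- rate y * (t - enn2real \<rho>))) else 0)" for \<rho>
  have f [measurable]: "f \<in> borel_measurable borel" unfolding f_def by measurable
  have [measurable]: "J k \<in> borel_measurable (hist k)"
    by (rule measurable_J_hist) simp
  have F [measurable]: "(\<lambda>(\<omega>, u). indicator B \<omega> * f (J k \<omega> + u)) \<in> borel_measurable (hist k \<Otimes>\<^sub>M borel)"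
    by measurable
  have B': "B \<inter> {\<omega> \<in> space M. ennreal s < J (Suc k) \<omega>} \<in> sets (hist (Suc k))"
  proof -
    have "{\<omega> \<in> space (hist (Suc k)). ennreal s < J (Suc k) \<omega>} \<in> sets (hist (Suc k))" by measurable
    thus ?thesis by (auto intro: sets.Int)
  qed
  note [measurable] = measurable_J measurable_H sets_hist_M[OF B]
  have f_inf: "f \<infinity> = 0" by (simp add: f_def top_unique)
  have f_ennreal: "f (ennreal r) = (if s < r \<and> r \<le> t then ennreal (exp (- rate y * (t - r))) else 0)" for r
    using s by (cases "r \<ge> 0") (auto simp: f_def ennreal_less_iff ennreal_neg)
  define S where "S z r = emeasure M (B \<inter> in_state k r z)" for z r
  define g where "g z r \<omega> = indicator (B \<inter> at_state k z) \<omega> * (if J k \<omega> \<le> ennreal r \<and> 0 \<le> r then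
       ennreal (exp (- rate z * (r - enn2real (J k \<omega>)))) else 0)" for z r \<omega>
  have g [measurable]: "(\<lambda>(r, \<omega>). g z r \<omega>) \<in> borel_measurable (lborel \<Otimes>\<^sub>M M)" for z
    unfolding g_def by measurable
  have [measurable]: "(\<lambda>(\<omega>, r). g z r \<omega>) \<in> borel_measurable (M \<Otimes>\<^sub>M lborel)" for z
    unfolding g_def by measurable
  have S: "S z r = (\<integral>\<^sup>+ \<omega>. g z r \<omega> \<partial>M)" if "r \<ge> 0" for z r
    using emeasure_holding_at[OF B that, of z] that by (simp add: S_def g_def)
  \<comment> \<open>The integral formula for \<open>S z r\<close> is available only for
    \<open>r \<ge> 0\<close>; for negative \<open>r\<close> the factor \<open>f\<close>
    vanishes.\<close>
  have fS [measurable]: "(\<lambda>r. f (ennreal r) * S z r) \<in> borel_measurable lborel" for z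
  proof -
    have "(\<lambda>r. f (ennreal r) * S z r) = (\<lambda>r. f (ennreal r) * (\<integral>\<^sup>+ \<omega>. g z r \<omega> \<partial>M))"
      using s by (auto simp: fun_eq_iff f_ennreal S)
    thus ?thesis by simp
  qed
  from emeasure_holding_at[OF B', of t y]
  have "emeasure M (B \<inter> {\<omega> \<in> space M. ennreal s < J (Suc k) \<omega>} \<inter> in_state (Suc k) t y) =
    (\<integral>\<^sup>+ \<omega>. indicator (at_state (Suc k) y) \<omega> * (indicator B \<omega> * f (J k \<omega> + H k \<omega>)) \<partial>M)"
    using s by (auto intro!: nn_integral_cong simp: f_def J_Suc split: split_indicator)
  also have "\<dots> = (\<integral>\<^sup>+ \<omega>. \<integral>\<^sup>+ z. indicator (at_state k z \<inter> at_state (Suc k) y) \<omega> *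
       (indicator B \<omega> * f (J k \<omega> + H k \<omega>)) \<partial>count_space UNIV \<partial>M)"
  proof (intro nn_integral_cong)
    fix \<omega> assume "\<omega> \<in> space M"
    have "(\<integral>\<^sup>+ z. indicator (at_state k z \<inter> at_state (Suc k) y) \<omega> *
       (indicator B \<omega> * f (J k \<omega> + H k \<omega>)) \<partial>count_space UNIV) =
      (\<integral>\<^sup>+ z. (indicator (at_state (Suc k) y) \<omega> *
       (indicator B \<omega> * f (J k \<omega> + H k \<omega>))) * indicator {Y k \<omega>} z \<partial>count_space UNIV)"
      using \<open>\<omega> \<in> space M\<close> by (intro nn_integral_cong) (auto simp: at_state_def split: split_indicator)
    thus "indicator (at_state (Suc k) y) \<omega> * (indicator B \<omega> * f (J k \<omega> + H k \<omega>)) =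
      (\<integral>\<^sup>+ z. indicator (at_state k z \<inter> at_state (Suc k) y) \<omega> *
       (indicator B \<omega> * f (J k \<omega> + H k \<omega>)) \<partial>count_space UNIV)"
      by simp
  qed
  also have "\<dots> = (\<integral>\<^sup>+ z. \<integral>\<^sup>+ \<omega>. indicator (at_state k z \<inter> at_state (Suc k) y) \<omega> *
       (indicator B \<omega> * f (J k \<omega> + H k \<omega>)) \<partial>M \<partial>count_space UNIV)"
    by (rule nn_integral_count_space_nn_integral) auto
  also have "\<dots> = (\<integral>\<^sup>+ z. (if z \<in> nbrs y then ennreal (L z y) else 0) * (\<integral>\<^sup>+ r. f (ennreal r) * S z r \<partial>lborel) \<partial>count_space UNIV)"
  proof (intro nn_integral_cong)
    fix z
    have "(\<integral>\<^sup>+ \<omega>. indicator (at_state k z \<inter> at_state (Suc k) y) \<omega> * (indicator B \<omega> * f (J k \<omega> + H k \<omega>)) \<partial>M) =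
       ennreal (jump_prob L z y) * (\<integral>\<^sup>+ \<omega>. indicator (at_state k z) \<omega> *
         (\<integral>\<^sup>+ u. indicator B \<omega> * f (J k \<omega> + u) \<partial>exp_law (rate z)) \<partial>M)"
      using nn_integral_holding_next[OF F, of z y] by simp
    also have "\<dots> = ennreal (jump_prob L z y) * (\<integral>\<^sup>+ \<omega>. (\<integral>\<^sup>+ r. ennreal (rate z) * (f (ennreal r) * g z r \<omega>) \<partial>lborel) \<partial>M)"
    proof (intro arg_cong[where f = "(*) _"] nn_integral_cong)
      fix \<omega> assume "\<omega> \<in> space M"
      have "(\<integral>\<^sup>+ u. indicator B \<omega> * f (J k \<omega> + u) \<partial>exp_law (rate z)) =
         indicator B \<omega> * (\<integral>\<^sup>+ r. f (ennreal r) * (ennreal (rate z) * (if J k \<omega> \<le> ennreal r \<and> 0 \<le> r then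
            ennreal (exp (- rate z * (r - enn2real (J k \<omega>)))) else 0)) \<partial>lborel)"
        using nn_integral_exp_law_shift[OF f f_inf, where j = "J k \<omega>" and z = z] by (simp add: nn_integral_cmult)
      thus "indicator (at_state k z) \<omega> * (\<integral>\<^sup>+ u. indicator B \<omega> * f (J k \<omega> + u) \<partial>exp_law (rate z)) =
         (\<integral>\<^sup>+ r. ennreal (rate z) * (f (ennreal r) * g z r \<omega>) \<partial>lborel)"
        by (auto simp: g_def mult_ac split: split_indicator)
    qed
    also have "\<dots> = ennreal (jump_prob L z y) * (\<integral>\<^sup>+ r. (\<integral>\<^sup>+ \<omega>. ennreal (rate z) * (f (ennreal r) * g z r \<omega>) \<partial>M) \<partial>lborel)"
    proof -
      interpret pair_sigma_finite lborel M ..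
      show ?thesis by (subst Fubini') auto
    qed
    also have "\<dots> = ennreal (jump_prob L z y) * (\<integral>\<^sup>+ r. ennreal (rate z) * (f (ennreal r) * S z r) \<partial>lborel)"
    proof (intro arg_cong[where f = "(*) _"] nn_integral_cong)
      fix r :: real
      have gM: "(\<lambda>\<omega>. g z r \<omega>) \<in> borel_measurable M" unfolding g_def by measurable
      show "(\<integral>\<^sup>+ \<omega>. ennreal (rate z) * (f (ennreal r) * g z r \<omega>) \<partial>M) = ennreal (rate z) * (f (ennreal r) * S z r)"
      proof (cases "r \<ge> 0")
        case True
        thus ?thesis using gM by (simp add: S nn_integral_cmult)
      next
        case False
        hence "f (ennreal r) = 0" using s by (simp add: f_ennreal)
        thus ?thesis by simp
      qed
    qed
    \<comment> \<open>The factor \<open>rate z\<close> from the holding-time density joins the jump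
      probability to form \<open>L z y\<close>.\<close>
    also have "\<dots> = ennreal (rate z * jump_prob L z y) * (\<integral>\<^sup>+ r. f (ennreal r) * S z r \<partial>lborel)"
      using fS[of z] by (subst nn_integral_cmult) (simp_all add: ennreal_mult' rate_nonneg mult_ac)
    finally show "(\<integral>\<^sup>+ \<omega>. indicator (at_state k z \<inter> at_state (Suc k) y) \<omega> * (indicator B \<omega> * f (J k \<omega> + H k \<omega>)) \<partial>M) =
      (if z \<in> nbrs y then ennreal (L z y) else 0) * (\<integral>\<^sup>+ r. f (ennreal r) * S z r \<partial>lborel)"
      by (simp add: rate_mult_jump_prob nbrs_sym[of z])
  qed
  also have "\<dots> = (\<Sum>z\<in>nbrs y. ennreal (L z y) * (\<integral>\<^sup>+ r. f (ennreal r) * S z r \<partial>lborel))"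
    by (subst nn_integral_count_space'[OF finite_nbrs[of y]]) auto
  also have "\<dots> = (\<integral>\<^sup>+ r. (\<Sum>z\<in>nbrs y. ennreal (L z y) * (f (ennreal r) * S z r)) \<partial>lborel)"
    by (simp add: nn_integral_sum nn_integral_cmult)
  also have "\<dots> = (\<integral>\<^sup>+ r. (if s < r \<and> r \<le> t then ennreal (exp (- rate y * (t - r))) *
       (\<Sum>z\<in>nbrs y. S z r * ennreal (L z y)) else 0) \<partial>lborel)"
    by (intro nn_integral_cong) (auto simp: f_ennreal sum_distrib_left mult_ac)
  finally show ?thesis unfolding S_def .
qed

text \<open>Memorylessness: \<open>exp (- rate x * (s + t - j))\<close> factors at \<open>s\<close>,
  whatever the time \<open>j\<close> of the last jump.\<close>

lemma emeasure_no_jump: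
  assumes B: "B \<in> sets (hist n)" and s: "0 \<le> s" and t: "0 \<le> t"
  shows "emeasure M (B \<inter> in_state n s x \<inter> in_state n (s + t) x) =
    emeasure M (B \<inter> in_state n s x) * ennreal (exp (- rate x * t))"
proof -
  note [measurable] = measurable_J sets_hist_M[OF B]
  have [measurable]: "J n \<in> borel_measurable (hist n)"
    by (rule measurable_J_hist) simp
  have "{\<omega> \<in> space (hist n). J n \<omega> \<le> ennreal s} \<in> sets (hist n)" by measurable
  hence B': "B \<inter> {\<omega> \<in> space M. J n \<omega> \<le> ennreal s} \<in> sets (hist n)"
    using B by (auto intro: sets.Int)
  have st: "ennreal s \<le> ennreal (s + t)" using s t by (intro ennreal_leI) simp
  have "B \<inter> in_state n s x \<inter> in_state n (s + t) x =
      B \<inter> {\<omega> \<in> space M. J n \<omega> \<le> ennreal s} \<inter> in_state n (s + t) x"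
    using st by (auto simp: in_state_def intro: le_less_trans)
  also have "emeasure M \<dots> = (\<integral>\<^sup>+ \<omega>. indicator (B \<inter> {\<omega> \<in> space M. J n \<omega> \<le> ennreal s} \<inter> at_state n x) \<omega> *
     (if J n \<omega> \<le> ennreal (s + t) then ennreal (exp (- rate x * (s + t - enn2real (J n \<omega>)))) else 0) \<partial>M)"
    by (rule emeasure_holding_at[OF B']) (use s t in auto)
  also have "\<dots> = (\<integral>\<^sup>+ \<omega>. (indicator (B \<inter> at_state n x) \<omega> *
     (if J n \<omega> \<le> ennreal s then ennreal (exp (- rate x * (s - enn2real (J n \<omega>)))) else 0)) *
       ennreal (exp (- rate x * t)) \<partial>M)"
  proof (intro nn_integral_cong)
    fix \<omega> assume \<omega>: "\<omega> \<in> space M"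
    have "exp (- rate x * (s + t - j)) = exp (- rate x * (s - j)) * exp (- rate x * t)" for j
      by (simp add: exp_add[symmetric] algebra_simps)
    thus "indicator (B \<inter> {\<omega> \<in> space M. J n \<omega> \<le> ennreal s} \<inter> at_state n x) \<omega> *
     (if J n \<omega> \<le> ennreal (s + t) then ennreal (exp (- rate x * (s + t - enn2real (J n \<omega>)))) else 0) =
     (indicator (B \<inter> at_state n x) \<omega> *
     (if J n \<omega> \<le> ennreal s then ennreal (exp (- rate x * (s - enn2real (J n \<omega>)))) else 0)) *
       ennreal (exp (- rate x * t))"
      using \<omega> st by (auto simp: ennreal_mult' split: split_indicator intro: order.trans)
  qed
  also have "\<dots> = emeasure M (B \<inter> in_state n s x) * ennreal (exp (- rate x * t))"
    by (subst emeasure_holding_at[OF B s], rule nn_integral_multc) measurable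
  finally show ?thesis .
qed

text \<open>\<open>ntrans m x t y\<close> is the conditional probability of exactly \<open>m\<close>
  further jumps within \<open>t\<close>, ending in \<open>y\<close>. Decomposition at the last of
  them reproduces the recursion of \<open>ntrans\<close>, shifted by \<open>s\<close>.\<close>

lemma emeasure_later_state:
  assumes B: "B \<in> sets (hist n)" and s: "0 \<le> s" and t: "0 \<le> t"
  shows "emeasure M (B \<inter> in_state n s x \<inter> in_state (n + m) (s + t) y) =
    emeasure M (B \<inter> in_state n s x) * ntrans m x t y"
  using t
proof (induction m arbitrary: t y)
  case 0
  show ?case
  proof (cases "x = y")
    case True
    thus ?thesis using emeasure_no_jump[OF B s, of t x] 0 by simp
  next
    case False
    hence "B \<inter> in_state n s x \<inter> in_state n (s + t) y = {}"
      by (auto simp: in_state_def)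
    thus ?thesis using False by simp
  qed
next
  case (Suc m)
  define S where "S = B \<inter> in_state n s x"
  \<comment> \<open>Being in interval \<open>n\<close> at time \<open>s\<close> involves
    \<open>J (Suc n)\<close>, which is unknown at the \<open>n\<close>-th jump. For
    \<open>m = 0\<close> that part is left to the lower bound \<open>s\<close> in the last-jump
    decomposition; for \<open>m > 0\<close> it belongs to the history up to jump
    \<open>n + m\<close>.\<close>
  define B' where "B' = (if m = 0 then B \<inter> {\<omega> \<in> space M. Y n \<omega> = x \<and> J n \<omega> \<le> ennreal s} else S)"
  have B': "B' \<in> sets (hist (n + m))"
  proof (cases "m = 0")
    case True
    have [measurable]: "J n \<in> borel_measurable (hist n)" "Y n \<in> measurable (hist n) (count_space UNIV)"
      by (simp_all add: measurable_J_hist measurable_Y_hist)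
    have "{\<omega> \<in> space (hist n). Y n \<omega> = x \<and> J n \<omega> \<le> ennreal s} \<in> sets (hist n)" by measurable
    thus ?thesis using B True by (auto simp: B'_def intro: sets.Int)
  next
    case False
    have [measurable]: "J n \<in> borel_measurable (hist (n + m))" "Y n \<in> measurable (hist (n + m)) (count_space UNIV)"
      "J (Suc n) \<in> borel_measurable (hist (n + m))"
      using False by (intro measurable_J_hist measurable_Y_hist; simp)+
    have "in_state n s x = {\<omega> \<in> space (hist (n + m)). Y n \<omega> = x \<and> J n \<omega> \<le> ennreal s \<and> ennreal s < J (Suc n) \<omega>}"
      by (simp add: in_state_def)
    also have "\<dots> \<in> sets (hist (n + m))" by measurable
    finally show ?thesis
      using False B sets_hist_mono[of n "n + m"] by (auto simp: B'_def S_def intro: sets.Int)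
  qed
  have Jn: "ennreal s < J (Suc n) \<omega> \<Longrightarrow> ennreal s < J (Suc (n + m)) \<omega>" for \<omega>
    using jump_time_mono[of "Suc n" "Suc (n + m)" H \<omega>] by (auto intro: less_le_trans)
  have 1: "B' \<inter> {\<omega> \<in> space M. ennreal s < J (Suc (n + m)) \<omega>} \<inter> in_state (Suc (n + m)) (s + t) y =
     S \<inter> in_state (n + Suc m) (s + t) y"
    using Jn by (cases "m = 0") (auto simp: B'_def S_def in_state_def)
  have 2: "B' \<inter> in_state (n + m) r z = S \<inter> in_state (n + m) r z" if "s < r" for r z
  proof -
    have "ennreal s < ennreal r" using s that by (simp add: ennreal_less_iff)
    thus ?thesis by (cases "m = 0") (auto simp: B'_def S_def in_state_def intro: less_trans)
  qed
  have 3: "emeasure M (B' \<inter> in_state (n + m) r z) = emeasure M S * ntrans m x (r - s) z" if "s < r" for r z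
    using Suc.IH[of "r - s" z] that unfolding 2[OF that] S_def by simp
  have "emeasure M (S \<inter> in_state (n + Suc m) (s + t) y) =
     (\<integral>\<^sup>+ r. (if s < r \<and> r \<le> s + t then ennreal (exp (- rate y * (s + t - r))) *
       (\<Sum>z\<in>nbrs y. emeasure M (B' \<inter> in_state (n + m) r z) * ennreal (L z y)) else 0) \<partial>lborel)"
    unfolding 1[symmetric] by (rule emeasure_last_jump[OF B' s]) (use Suc.prems in simp)
  also have "\<dots> = (\<integral>\<^sup>+ r. (if s < r \<and> r \<le> s + t then ennreal (exp (- rate y * (s + t - r))) *
       (\<Sum>z\<in>nbrs y. emeasure M S * ntrans m x (r - s) z * ennreal (L z y)) else 0) \<partial>lborel)"
    by (intro nn_integral_cong) (auto simp: 3 cong: if_cong)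
  also have "\<dots> = (\<integral>\<^sup>+ r. (if 0 < r \<and> r \<le> t then ennreal (exp (- rate y * (t - r))) *
       (\<Sum>z\<in>nbrs y. emeasure M S * ntrans m x r z * ennreal (L z y)) else 0) \<partial>lborel)"
  proof -
    have [measurable]: "(\<lambda>r. ntrans m x (r - s) z) \<in> borel_measurable borel" for z
      using measurable_compose[OF _ borel_measurable_ntrans[of m x z], of "\<lambda>r. r - s" borel] by simp
    show ?thesis
      by (subst nn_integral_real_affine[where t = s and c = 1]) (simp_all cong: if_cong)
  qed
  also have "\<dots> = (\<integral>\<^sup>+ r. emeasure M S * (if 0 < r \<and> r \<le> t then ennreal (exp (- rate y * (t - r))) *
       (\<Sum>z\<in>nbrs y. ntrans m x r z * ennreal (L z y)) else 0) \<partial>lborel)"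
    by (intro nn_integral_cong) (auto simp: sum_distrib_left mult_ac cong: if_cong)
  also have "\<dots> = emeasure M S * ntrans (Suc m) x t y"
    unfolding ntrans.simps by (rule nn_integral_cmult) measurable
  finally show ?case by (simp add: S_def)
qed

end

section \<open>The Markov property\<close>

locale jump_process = jump_realization L \<mu> M \<mu>0 Y H
  for L :: "'a::countable \<Rightarrow> 'a \<Rightarrow> real" and \<mu> :: "'a pmf"
    and M :: "'w measure" and \<mu>0 :: "'a pmf"
    and Y :: "nat \<Rightarrow> 'w \<Rightarrow> 'a" and H :: "nat \<Rightarrow> 'w \<Rightarrow> ennreal" +
  fixes X :: "real \<Rightarrow> 'w \<Rightarrow> 'a"
  assumes measurable_X: "t \<ge> 0 \<Longrightarrow> X t \<in> measurable M (count_space UNIV)"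
    and X_eq: "\<lbrakk>\<omega> \<in> space M; t \<ge> 0; jump_time H n \<omega> \<le> ennreal t; ennreal t < jump_time H (Suc n) \<omega>\<rbrakk>
      \<Longrightarrow> X t \<omega> = Y n \<omega>"
    and nonexplosion: "AE \<omega> in M. (\<lambda>n. jump_time H n \<omega>) \<longlonglongrightarrow> \<infinity>"
begin

definition X_event :: "real \<Rightarrow> 'a \<Rightarrow> 'w set" where
  "X_event t x = {\<omega> \<in> space M. X t \<omega> = x}"

lemma sets_X_event: "t \<ge> 0 \<Longrightarrow> X_event t x \<in> sets M"
  unfolding X_event_def using measurable_X[of t] by measurable

lemma in_state_subset_X_event: "t \<ge> 0 \<Longrightarrow> in_state n t x \<subseteq> X_event t x"
  using X_eq by (auto simp: in_state_def X_event_def)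

lemma AE_in_interval: "AE \<omega> in M. \<forall>t\<ge>0. \<exists>n. J n \<omega> \<le> ennreal t \<and> ennreal t < J (Suc n) \<omega>"
  using nonexplosion
proof eventually_elim
  case (elim \<omega>)
  show ?case
  proof (intro allI impI)
    fix t :: real assume "t \<ge> 0"
    have "\<forall>\<^sub>F n in sequentially. ennreal t < J n \<omega>"
      using elim by (rule order_tendstoD) simp
    then obtain m where m: "ennreal t < J m \<omega>"
      by (auto simp: eventually_sequentially)
    show "\<exists>n. J n \<omega> \<le> ennreal t \<and> ennreal t < J (Suc n) \<omega>"
      using jump_interval_exists[OF m] by blast
  qed
qed

lemma emeasure_states:
  assumes [measurable]: "C \<in> sets M" and t: "t \<ge> 0"
  shows "emeasure M C = (\<integral>\<^sup>+ x. emeasure M (C \<inter> X_event t x) \<partial>count_space UNIV)"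
proof -
  note [measurable] = sets_X_event[OF t]
  have "C = (\<Union>x. C \<inter> X_event t x)"
    using sets.sets_into_space[of C M] by (auto simp: X_event_def)
  also have "emeasure M \<dots> = (\<integral>\<^sup>+ x. emeasure M (C \<inter> X_event t x) \<partial>count_space UNIV)"
  proof (rule emeasure_UN_countable)
    show "disjoint_family_on (\<lambda>x. C \<inter> X_event t x) UNIV"
      by (auto simp: disjoint_family_on_def X_event_def)
  qed auto
  finally show ?thesis .
qed

text \<open>Nonexplosion puts \<open>t\<close> almost surely into a jump interval, and the intervals
  are disjoint.\<close>

lemma emeasure_X_event_split:
  assumes [measurable]: "C \<in> sets M" and t: "t \<ge> 0"
  shows "emeasure M (C \<inter> X_event t y) = (\<Sum>n. emeasure M (C \<inter> in_state n t y))"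
proof -
  have "emeasure M (C \<inter> X_event t y) = emeasure M (\<Union>n. C \<inter> in_state n t y)"
  proof (rule emeasure_eq_AE)
    show "AE \<omega> in M. \<omega> \<in> C \<inter> X_event t y \<longleftrightarrow> \<omega> \<in> (\<Union>n. C \<inter> in_state n t y)"
      using AE_in_interval
    proof (eventually_elim, intro iffI)
      fix \<omega> assume *: "\<forall>t\<ge>0. \<exists>n. J n \<omega> \<le> ennreal t \<and> ennreal t < J (Suc n) \<omega>" and \<omega>: "\<omega> \<in> C \<inter> X_event t y"
      obtain n where "J n \<omega> \<le> ennreal t" "ennreal t < J (Suc n) \<omega>" using * t by blast
      thus "\<omega> \<in> (\<Union>n. C \<inter> in_state n t y)"
        using \<omega> X_eq[of \<omega> t n] t by (auto simp: in_state_def X_event_def)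
    qed (use in_state_subset_X_event[OF t] in blast)
  qed (use sets_X_event[OF t] in auto)
  also have "\<dots> = (\<Sum>n. emeasure M (C \<inter> in_state n t y))"
  proof (rule suminf_emeasure[symmetric])
    have "n = m" if "J n \<omega> \<le> ennreal t" "ennreal t < J (Suc n) \<omega>" "J m \<omega> \<le> ennreal t" "ennreal t < J (Suc m) \<omega>"
      for n m \<omega>
      using jump_interval_unique[OF that] jump_interval_unique[OF that(3,4,1,2)] by simp
    thus "disjoint_family (\<lambda>n. C \<inter> in_state n t y)"
      by (auto simp: disjoint_family_on_def in_state_def)
  qed auto
  finally show ?thesis .
qed

text \<open>Summation over the number of further jumps; indices below \<open>n\<close> contribute
  nothing, as the number of jumps does not decrease.\<close>

lemma emeasure_in_state_later:
  assumes B: "B \<in> sets (hist n)" and s: "0 \<le> s" and t: "0 \<le> t"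
  shows "emeasure M (B \<inter> in_state n s x \<inter> X_event (s + t) y) = emeasure M (B \<inter> in_state n s x) * trans_prob x t y"
proof -
  note [measurable] = sets_hist_M[OF B]
  have "emeasure M (B \<inter> in_state n s x \<inter> X_event (s + t) y) =
      (\<Sum>k. emeasure M (B \<inter> in_state n s x \<inter> in_state k (s + t) y))"
    by (rule emeasure_X_event_split) (use s t in auto)
  also have "\<dots> = (\<Sum>m. emeasure M (B \<inter> in_state n s x \<inter> in_state (m + n) (s + t) y)) +
      (\<Sum>k<n. emeasure M (B \<inter> in_state n s x \<inter> in_state k (s + t) y))"
    by (rule suminf_offset) auto
  also have "(\<Sum>k<n. emeasure M (B \<inter> in_state n s x \<inter> in_state k (s + t) y)) = 0"
  proof (intro sum.neutral ballI)
    fix k assume "k \<in> {..<n}"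
    hence "in_state n s x \<inter> in_state k (s + t) y = {}"
      using jump_interval_unique[of H n _ s k "s + t"] t by (auto simp: in_state_def)
    thus "emeasure M (B \<inter> in_state n s x \<inter> in_state k (s + t) y) = 0"
      by (simp add: Int_assoc)
  qed
  also have "(\<Sum>m. emeasure M (B \<inter> in_state n s x \<inter> in_state (m + n) (s + t) y)) =
     (\<Sum>m. emeasure M (B \<inter> in_state n s x) * ntrans m x t y)"
    by (subst add.commute) (simp add: emeasure_later_state[OF B s t])
  also have "\<dots> = emeasure M (B \<inter> in_state n s x) * trans_prob x t y"
    unfolding trans_prob_def by (rule ennreal_suminf_cmult)
  finally show ?thesis by simp
qed

abbreviation past :: "real \<Rightarrow> 'w measure" where
  "past s \<equiv> natural_filtration M X (ennreal s)"

definition past_gens :: "ennreal \<Rightarrow> 'w set set" where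
  "past_gens s = {X r -` A \<inter> space M | r A. 0 \<le> r \<and> ennreal r \<le> s}"

lemma past_gens_M: "past_gens s \<subseteq> sets M"
  using measurable_X by (auto simp: past_gens_def intro!: measurable_sets)

lemma sets_filtration: "sets (natural_filtration M X s) = sigma_sets (space M) (past_gens s)"
  and space_filtration [simp]: "space (natural_filtration M X s) = space M"
proof -
  have "past_gens s \<subseteq> Pow (space M)" by (auto simp: past_gens_def)
  thus "sets (natural_filtration M X s) = sigma_sets (space M) (past_gens s)"
    "space (natural_filtration M X s) = space M"
    by (auto simp: natural_filtration_def past_gens_def)
qed

lemma sets_filtration_M: "sets (natural_filtration M X s) \<subseteq> sets M"
  unfolding sets_filtration by (rule sets.sigma_sets_subset[OF past_gens_M])

lemma sets_filtration_mono: "s \<le> t \<Longrightarrow> sets (natural_filtration M X s) \<subseteq> sets (natural_filtration M X t)"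
  unfolding sets_filtration by (intro sigma_sets_mono') (auto simp: past_gens_def intro: order.trans)

lemma X_event_in_filtration: "0 \<le> r \<Longrightarrow> ennreal r \<le> s \<Longrightarrow> X_event r x \<in> sets (natural_filtration M X s)"
  unfolding sets_filtration
  by (rule sigma_sets.Basic) (auto simp: past_gens_def X_event_def intro!: exI[of _ r] exI[of _ "{x}"])

text \<open>Until the next jump, the past of the process is determined by the jumps made so far.\<close>

lemma past_in_hist:
  assumes s: "s \<ge> 0" and A: "A \<in> sets (past s)"
  shows "\<exists>B\<in>sets (hist n). \<forall>x. A \<inter> in_state n s x = B \<inter> in_state n s x"
  using A unfolding sets_filtration
proof induction
  case (Basic A)
  then obtain r C where A: "A = X r -` C \<inter> space M" and r: "0 \<le> r" "r \<le> s"
    using s by (auto simp: past_gens_def)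
  \<comment> \<open>\<open>X r\<close> is the state of the interval that contains \<open>r\<close>.
    For interval \<open>n\<close> the upper end is omitted: \<open>J (Suc n)\<close> is not in the
    history, and on the event considered it exceeds \<open>s \<ge> r\<close> anyway.\<close>
  define B where "B = {\<omega> \<in> space (hist n). (\<exists>k\<in>{..<n}. J k \<omega> \<le> ennreal r \<and> ennreal r < J (Suc k) \<omega> \<and> Y k \<omega> \<in> C) \<or>
     (J n \<omega> \<le> ennreal r \<and> Y n \<omega> \<in> C)}"
  have "B \<in> sets (hist n)"
  proof -
    have [measurable]: "J n \<in> borel_measurable (hist n)" "Y n \<in> measurable (hist n) (count_space UNIV)"
      by (simp_all add: measurable_J_hist measurable_Y_hist)
    have "Measurable.pred (hist n) (\<lambda>\<omega>. J k \<omega> \<le> ennreal r \<and> ennreal r < J (Suc k) \<omega> \<and> Y k \<omega> \<in> C)" if "k < n" for k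
    proof -
      have [measurable]: "J k \<in> borel_measurable (hist n)" "J (Suc k) \<in> borel_measurable (hist n)"
        "Y k \<in> measurable (hist n) (count_space UNIV)"
        using that by (simp_all add: measurable_J_hist measurable_Y_hist)
      show ?thesis by measurable
    qed
    hence [measurable]: "Measurable.pred (hist n) (\<lambda>\<omega>. \<exists>k\<in>{..<n}. J k \<omega> \<le> ennreal r \<and> ennreal r < J (Suc k) \<omega> \<and> Y k \<omega> \<in> C)"
      by (intro pred_intros_finite) auto
    show ?thesis unfolding B_def by measurable
  qed
  moreover have "A \<inter> in_state n s x = B \<inter> in_state n s x" for x
  proof -
    have "X r \<omega> \<in> C \<longleftrightarrow> \<omega> \<in> B" if \<omega>: "\<omega> \<in> in_state n s x" for \<omega>
    proof -
      have \<omega>': "\<omega> \<in> space M" "J n \<omega> \<le> ennreal s" "ennreal s < J (Suc n) \<omega>"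
        using \<omega> by (auto simp: in_state_def)
      have rs: "ennreal r \<le> ennreal s" using r by (intro ennreal_leI)
      have last: "X r \<omega> = Y n \<omega>" if "J n \<omega> \<le> ennreal r"
        by (rule X_eq[OF \<omega>'(1) r(1) that le_less_trans[OF rs \<omega>'(3)]])
      have B_iff: "\<omega> \<in> B \<longleftrightarrow> (\<exists>k\<in>{..<n}. J k \<omega> \<le> ennreal r \<and> ennreal r < J (Suc k) \<omega> \<and> Y k \<omega> \<in> C) \<or>
          (J n \<omega> \<le> ennreal r \<and> Y n \<omega> \<in> C)"
        using \<omega>'(1) unfolding B_def by simp
      show ?thesis
      proof (cases "J n \<omega> \<le> ennreal r")
        case True
        have "\<not> ennreal r < J (Suc k) \<omega>" if "k < n" for k
          using order.trans[OF jump_time_mono True] that by (simp add: not_less Suc_le_eq)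
        thus ?thesis using True unfolding B_iff last[OF True] by blast
      next
        case False
        then obtain k where Jk: "J k \<omega> \<le> ennreal r" "ennreal r < J (Suc k) \<omega>" "k < n"
          using jump_interval_exists[of r H n \<omega>] by (auto simp: not_le)
        hence "X r \<omega> = Y k \<omega>" using X_eq[of \<omega> r k] \<omega>' r by simp
        moreover have "j = k" if "J j \<omega> \<le> ennreal r" "ennreal r < J (Suc j) \<omega>" for j
          using jump_interval_unique[OF that Jk(1,2)] jump_interval_unique[OF Jk(1,2) that] by simp
        ultimately show ?thesis using Jk False unfolding B_iff by (metis lessThan_iff)
      qed
    qed
    moreover have "in_state n s x \<subseteq> space M" by (auto simp: in_state_def)
    ultimately show ?thesis unfolding A by blast
  qed
  ultimately show ?case by blast
next
  case Empty
  show ?case by (intro bexI[of _ "{}"]) auto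
next
  case (Compl A)
  then obtain B where B: "B \<in> sets (hist n)" "\<And>x. A \<inter> in_state n s x = B \<inter> in_state n s x" by blast
  have "(space M - A) \<inter> in_state n s x = (space (hist n) - B) \<inter> in_state n s x" for x
    using B(2)[of x] by auto
  thus ?case using B(1) by blast
next
  case (Union A)
  then obtain B where B: "\<And>i. B i \<in> sets (hist n)" "\<And>i x. A i \<inter> in_state n s x = B i \<inter> in_state n s x" by metis
  have "(\<Union>i. A i) \<inter> in_state n s x = (\<Union>i. B i) \<inter> in_state n s x" for x
    using B(2)[of _ x] by blast
  thus ?case using B(1) by (intro bexI[of _ "\<Union>i. B i"]) auto
qed

text \<open>On the event of exactly \<open>n\<close> jumps up to \<open>s\<close>, a past event
  agrees with one of \<open>hist n\<close>, for which the claim is known. Summing over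
  \<open>n\<close> removes the restriction.\<close>

lemma markov_past:
  assumes s: "s \<ge> 0" and t: "t \<ge> 0" and A: "A \<in> sets (past s)"
  shows "emeasure M (A \<inter> (X_event s x \<inter> X_event (s + t) y)) = emeasure M (A \<inter> X_event s x) * trans_prob x t y"
proof -
  have AM [measurable]: "A \<in> sets M" using A sets_filtration_M by auto
  note [measurable] = sets_X_event[OF s] sets_X_event[OF add_nonneg_nonneg[OF s t]]
  have "emeasure M (A \<inter> in_state n s x \<inter> X_event (s + t) y) = emeasure M (A \<inter> in_state n s x) * trans_prob x t y" for n
  proof -
    from past_in_hist[OF s A, of n]
    obtain B where B: "B \<in> sets (hist n)" and eq: "\<forall>x. A \<inter> in_state n s x = B \<inter> in_state n s x" ..
    show ?thesis
      unfolding eq[rule_format] by (rule emeasure_in_state_later[OF B s t])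
  qed
  moreover have "emeasure M (A \<inter> (X_event s x \<inter> X_event (s + t) y)) =
      (\<Sum>n. emeasure M (A \<inter> in_state n s x \<inter> X_event (s + t) y))"
  proof -
    have "A \<inter> (X_event s x \<inter> X_event (s + t) y) = A \<inter> X_event (s + t) y \<inter> X_event s x"
      "A \<inter> in_state n s x \<inter> X_event (s + t) y = A \<inter> X_event (s + t) y \<inter> in_state n s x" for n
      by auto
    thus ?thesis
      by (simp only:) (rule emeasure_X_event_split[OF sets.Int[OF AM sets_X_event] s], use s t in simp)
  qed
  moreover have "emeasure M (A \<inter> X_event s x) = (\<Sum>n. emeasure M (A \<inter> in_state n s x))"
    by (rule emeasure_X_event_split[OF AM s])
  ultimately show ?thesis by simp
qed

lemma emeasure_X_0: "emeasure M (X_event 0 x) = ennreal (pmf \<mu>0 x)"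
proof -
  have "emeasure M (X_event 0 x) = emeasure M (pos_event 0 (\<lambda>_. x))"
  proof (rule emeasure_eq_AE)
    show "AE \<omega> in M. \<omega> \<in> X_event 0 x \<longleftrightarrow> \<omega> \<in> pos_event 0 (\<lambda>_. x)"
      using AE_H_pos
      by eventually_elim
        (use X_eq[of _ 0 0] in \<open>auto simp: X_event_def pos_event_def jump_time_def\<close>)
  qed (use sets_X_event in auto)
  thus ?thesis by (simp add: emeasure_pos_event path_weight_def)
qed

lemma emeasure_X:
  assumes t: "t \<ge> 0"
  shows "emeasure M (X_event t y) = (\<integral>\<^sup>+ x. ennreal (pmf \<mu>0 x) * trans_prob x t y \<partial>count_space UNIV)"
proof -
  note [measurable] = sets_X_event[OF order.refl] sets_X_event[OF t]
  have "emeasure M (X_event t y) = (\<integral>\<^sup>+ x. emeasure M (X_event 0 x \<inter> X_event t y) \<partial>count_space UNIV)"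
    by (subst emeasure_states[of _ 0]) (simp_all add: Int_commute)
  also have "\<dots> = (\<integral>\<^sup>+ x. ennreal (pmf \<mu>0 x) * trans_prob x t y \<partial>count_space UNIV)"
  proof (intro nn_integral_cong)
    fix x
    have "space M \<inter> X_event 0 x = X_event 0 x" "space M \<inter> (X_event 0 x \<inter> X_event t y) = X_event 0 x \<inter> X_event t y"
      by (auto simp: X_event_def)
    thus "emeasure M (X_event 0 x \<inter> X_event t y) = ennreal (pmf \<mu>0 x) * trans_prob x t y"
      using markov_past[OF order.refl t, of "space M" x y] sets.top[of "past 0"]
      by (simp add: emeasure_X_0)
  qed
  finally show ?thesis .
qed

text \<open>Intersections of a past event with an event of \<open>\<G>\<close> form an
  intersection-stable generator, and there independence of \<open>\<G>\<close> from the whole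
  process factors the second event out.\<close>

lemma markov_enlarged:
  assumes s: "s \<ge> 0" and t: "t \<ge> 0"
    and G: "sigma_algebra (space M) \<G>" "indep_set \<G> (sets (natural_filtration M X \<infinity>))"
    and A: "A \<in> sets (sigma (space M) (sets (past s) \<union> \<G>))"
  shows "emeasure M (A \<inter> (X_event s x \<inter> X_event (s + t) y)) = emeasure M (A \<inter> X_event s x) * trans_prob x t y"
proof -
  interpret G: sigma_algebra "space M" \<G> by fact
  have GM: "\<G> \<subseteq> sets M" 
  proof -
    have "\<forall>i. case_bool \<G> (sets (natural_filtration M X \<infinity>)) i \<subseteq> sets M"
      using G(2) unfolding indep_set_def indep_sets_def by blast
    from this[rule_format, of True] show ?thesis by simp
  qed
  define E where "E = {a \<inter> b | a b. a \<in> sets (past s) \<and> b \<in> \<G>}"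
  have top: "space M \<in> sets (past s)" using sets.top[of "past s"] by simp
  have sub: "sets (past s) \<union> \<G> \<subseteq> E"
  proof
    fix a assume "a \<in> sets (past s) \<union> \<G>"
    thus "a \<in> E"
    proof
      assume a: "a \<in> sets (past s)"
      hence "a = a \<inter> space M" using sets.sets_into_space[OF a] by auto
      thus ?thesis using a G.top by (auto simp: E_def)
    next
      assume a: "a \<in> \<G>"
      hence "a = space M \<inter> a" using G.sets_into_space by auto
      thus ?thesis using a top unfolding E_def by blast
    qed
  qed
  have "sets (past s) \<union> \<G> \<subseteq> Pow (space M)"
    using sets.sets_into_space[of _ "past s"] G.space_closed by auto
  hence "A \<in> sigma_sets (space M) (sets (past s) \<union> \<G>)" using A by simp
  hence A': "A \<in> sigma_sets (space M) E" using sigma_sets_mono'[OF sub] by blast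
  have prod: "emeasure M (b \<inter> c) = emeasure M b * emeasure M c"
    if "b \<in> \<G>" "c \<in> sets (natural_filtration M X \<infinity>)" for b c
    using indep_setD[OF G(2) that] by (simp add: emeasure_eq_measure ennreal_mult')
  have inf: "a \<in> sets (natural_filtration M X \<infinity>)" if "a \<in> sets (past s)" for a
    using that sets_filtration_mono[of "ennreal s" \<infinity>] by auto
  show ?thesis
  proof (rule emeasure_Int_eqI[where E = E and K = "{space M}"])
    show "Int_stable E"
    proof (rule Int_stableI)
      fix p q assume "p \<in> E" "q \<in> E"
      then obtain a b a' b' where "p = a \<inter> b" "q = a' \<inter> b'" "a \<in> sets (past s)" "a' \<in> sets (past s)" "b \<in> \<G>" "b' \<in> \<G>"
        by (auto simp: E_def)
      moreover have "(a \<inter> b) \<inter> (a' \<inter> b') = (a \<inter> a') \<inter> (b \<inter> b')" by auto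
      ultimately show "p \<inter> q \<in> E" by (auto simp: E_def)
    qed
    show "E \<subseteq> sets M" using sets_filtration_M GM by (auto simp: E_def)
    show "X_event s x \<inter> X_event (s + t) y \<in> sets M" "X_event s x \<in> sets M"
      using s t sets_X_event by auto
    show "{space M} \<subseteq> E" using sub top by auto
    show "A \<in> sigma_sets (space M) E" by (rule A')
  next
    fix p assume "p \<in> E"
    then obtain a b where p: "p = a \<inter> b" and a: "a \<in> sets (past s)" and b: "b \<in> \<G>"
      by (auto simp: E_def)
    have 1: "a \<inter> X_event s x \<in> sets (natural_filtration M X \<infinity>)"
      using inf[OF a] X_event_in_filtration[of s \<infinity> x] s by auto
    have 2: "a \<inter> (X_event s x \<inter> X_event (s + t) y) \<in> sets (natural_filtration M X \<infinity>)"
      using inf[OF a] X_event_in_filtration[of s \<infinity> x] X_event_in_filtration[of "s + t" \<infinity> y] s t by auto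
    have "p \<inter> (X_event s x \<inter> X_event (s + t) y) = b \<inter> (a \<inter> (X_event s x \<inter> X_event (s + t) y))"
      "p \<inter> X_event s x = b \<inter> (a \<inter> X_event s x)" by (auto simp: p)
    thus "emeasure M (p \<inter> (X_event s x \<inter> X_event (s + t) y)) = emeasure M (p \<inter> X_event s x) * trans_prob x t y"
      using prod[OF b 1] prod[OF b 2] markov_past[OF s t a, of x y] by (simp add: mult.assoc)
  qed auto
qed

end

section \<open>Existence of the process\<close>

text \<open>The canonical space of jump data has at most the cardinality of the continuum, so it can
  be transported into the type of sample points.\<close>

lemma exists_inj_function_space:
  fixes emb :: "real \<Rightarrow> 'w"
  assumes "inj emb"
  shows "\<exists>e :: (nat \<times> 'a::countable \<Rightarrow> 'a \<times> ennreal) \<Rightarrow> 'w. inj e"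
proof -
  from nat_sets_eqpoll_reals obtain d :: "nat set \<Rightarrow> real" where "bij d"
    by (auto simp: eqpoll_def)
  \<comment> \<open>The value \<open>-1\<close> codes an infinite holding time, since
    \<open>enn2real\<close> would identify it with 0.\<close>
  define c where "c h = inv d (if h = \<infinity> then -1 else enn2real h)" for h :: ennreal
  have c: "inj c"
  proof (rule injI)
    fix g h :: ennreal assume "c g = c h"
    hence "(if g = \<infinity> then -1 else enn2real g) = (if h = \<infinity> then -1 else enn2real h)"
      unfolding c_def by (rule injD[OF bij_is_inj[OF bij_imp_bij_inv[OF \<open>bij d\<close>]]])
    thus "g = h"
      by (cases g; cases h) (auto split: if_splits)
  qed
  \<comment> \<open>A sample is coded by a subset of a countable type: \<open>Inl\<close> tags
    record the states, \<open>Inr\<close> tags the elements of the sets of naturals that code the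
    holding times.\<close>
  define S where "S \<omega> = {q. case snd q of Inl a \<Rightarrow> fst (\<omega> (fst q)) = a | Inr i \<Rightarrow> i \<in> c (snd (\<omega> (fst q)))}"
    for \<omega> :: "nat \<times> 'a \<Rightarrow> 'a \<times> ennreal"
  have "inj S"
  proof (rule injI)
    fix \<omega> \<eta> assume eq: "S \<omega> = S \<eta>"
    have "\<omega> p = \<eta> p" for p
    proof (rule prod_eqI)
      have "(p, Inl (fst (\<omega> p))) \<in> S \<eta>" unfolding eq[symmetric] by (simp add: S_def)
      thus "fst (\<omega> p) = fst (\<eta> p)" by (simp add: S_def)
      have "(p, Inr i) \<in> S \<omega> \<longleftrightarrow> i \<in> c (snd (\<omega> p))" "(p, Inr i) \<in> S \<eta> \<longleftrightarrow> i \<in> c (snd (\<eta> p))" for i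
        by (simp_all add: S_def)
      hence "c (snd (\<omega> p)) = c (snd (\<eta> p))" using eq by blast
      thus "snd (\<omega> p) = snd (\<eta> p)" using c by (simp add: inj_def)
    qed
    thus "\<omega> = \<eta>" by blast
  qed
  moreover have "inj ((`) (to_nat :: (nat \<times> 'a) \<times> ('a + nat) \<Rightarrow> nat))"
    by (rule injI) (simp add: inj_image_eq_iff)
  ultimately have "inj (emb \<circ> d \<circ> (`) to_nat \<circ> S)"
    using assms bij_is_inj[OF \<open>bij d\<close>] by (intro inj_compose)
  thus ?thesis by blast
qed

section \<open>Sample paths from jump data\<close>

definition path_of ::
  "(nat \<Rightarrow> 'w \<Rightarrow> 'a) \<Rightarrow> (nat \<Rightarrow> 'w \<Rightarrow> ennreal) \<Rightarrow> 'a \<Rightarrow> real \<Rightarrow> 'w \<Rightarrow> 'a" where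
  "path_of Y H a t \<omega> =
     (if \<exists>n. jump_time H n \<omega> \<le> ennreal t \<and> ennreal t < jump_time H (Suc n) \<omega>
      then Y (LEAST n. jump_time H n \<omega> \<le> ennreal t \<and> ennreal t < jump_time H (Suc n) \<omega>) \<omega> else a)"

lemma path_of_eq:
  assumes "jump_time H n \<omega> \<le> ennreal t" "ennreal t < jump_time H (Suc n) \<omega>"
  shows "path_of Y H a t \<omega> = Y n \<omega>"
proof -
  have "(LEAST n. jump_time H n \<omega> \<le> ennreal t \<and> ennreal t < jump_time H (Suc n) \<omega>) = n"
    using assms jump_interval_unique[of H n \<omega> t _ t] by (intro Least_equality) auto
  thus ?thesis using assms by (auto simp: path_of_def)
qed

text \<open>A jump interval is open on the right, so the path is constant just after a covered time.
  If \<open>t\<close> is not covered, all jump times are at most \<open>t\<close>, and the path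
  rests at \<open>a\<close> from then on.\<close>

lemma path_of_right_continuous:
  assumes "t \<ge> 0"
  shows "\<forall>\<^sub>F s in at_right t. path_of Y H a s \<omega> = path_of Y H a t \<omega>"
proof (cases "\<exists>n. jump_time H n \<omega> \<le> ennreal t \<and> ennreal t < jump_time H (Suc n) \<omega>")
  case True
  then obtain n where n: "jump_time H n \<omega> \<le> ennreal t" "ennreal t < jump_time H (Suc n) \<omega>" by blast
  have ev: "\<forall>\<^sub>F s in at_right t. ennreal s < jump_time H (Suc n) \<omega>"
  proof (cases "jump_time H (Suc n) \<omega>")
    case (real j)
    hence "t < j" using n assms by (simp add: ennreal_less_iff)
    moreover have "ennreal s < ennreal j" if "t < s" "s < j" for s
      using that assms by (simp add: ennreal_less_iff)
    ultimately show ?thesis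
      unfolding eventually_at_right_field using real by (intro exI[of _ j] conjI) simp_all
  qed simp
  have "\<forall>\<^sub>F s in at_right t. t < s" by (rule eventually_at_right_less)
  with ev show ?thesis
  proof eventually_elim
    case (elim s)
    have "jump_time H n \<omega> \<le> ennreal s"
      by (rule order.trans[OF n(1)]) (use elim in \<open>auto intro!: ennreal_leI\<close>)
    thus ?case using path_of_eq[of H n \<omega> s Y a] path_of_eq[OF n, of Y a] elim by simp
  qed
next
  case False
  have "path_of Y H a s \<omega> = a" if "t \<le> s" for s
  proof -
    have "\<not> (jump_time H n \<omega> \<le> ennreal s \<and> ennreal s < jump_time H (Suc n) \<omega>)" for n
      using False jump_interval_exists[of t H "Suc n" \<omega>] ennreal_leI[OF that] by (meson le_less_trans)
    hence "\<not> (\<exists>n. jump_time H n \<omega> \<le> ennreal s \<and> ennreal s < jump_time H (Suc n) \<omega>)" by blast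
    thus ?thesis unfolding path_of_def by (rule if_not_P)
  qed
  moreover have "\<forall>\<^sub>F s in at_right t. t < s" by (rule eventually_at_right_less)
  ultimately show ?thesis by (auto elim!: eventually_mono)
qed

lemma measurable_path_of:
  assumes Y: "\<And>n. Y n \<in> measurable M (count_space UNIV)" and H: "\<And>n. H n \<in> borel_measurable M"
  shows "path_of Y H a t \<in> measurable M (count_space (UNIV :: 'a::countable set))"
proof -
  have [measurable]: "jump_time H n \<in> borel_measurable M" for n
    unfolding jump_time_def[abs_def] using H by (intro borel_measurable_sum) auto
  have L: "(\<lambda>\<omega>. LEAST n. jump_time H n \<omega> \<le> ennreal t \<and> ennreal t < jump_time H (Suc n) \<omega>)
    \<in> measurable M (count_space UNIV)"
    by measurable
  have [measurable]: "(\<lambda>\<omega>. Y (LEAST n. jump_time H n \<omega> \<le> ennreal t \<and> ennreal t < jump_time H (Suc n) \<omega>) \<omega>)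
    \<in> measurable M (count_space UNIV)"
    by (rule measurable_compose_countable[OF Y L])
  show ?thesis unfolding path_of_def[abs_def] by measurable
qed

context reversible_generator
begin

definition jump_pmf :: "'a \<Rightarrow> 'a pmf" where
  "jump_pmf x = embed_pmf (jump_prob L x)"

lemma pmf_jump_pmf: "pmf (jump_pmf x) y = jump_prob L x y"
  unfolding jump_pmf_def by (rule pmf_embed_pmf) (simp_all add: jump_prob_nonneg nn_integral_jump_prob)

text \<open>For every step and every possible current state there is an independent pair of next
  state and holding time. The chain reads only the pair at its current position, so a plain product
  measure suffices and no conditional laws need be composed.\<close>

definition step_law :: "nat \<times> 'a \<Rightarrow> ('a \<times> ennreal) measure" where
  "step_law p = measure_pmf (jump_pmf (snd p)) \<Otimes>\<^sub>M exp_law (rate (snd p))"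

definition canonical :: "(nat \<times> 'a \<Rightarrow> 'a \<times> ennreal) measure" where
  "canonical = PiM UNIV step_law"

fun canonical_state :: "'a \<Rightarrow> nat \<Rightarrow> (nat \<times> 'a \<Rightarrow> 'a \<times> ennreal) \<Rightarrow> 'a" where
  "canonical_state x 0 \<omega> = x"
| "canonical_state x (Suc n) \<omega> = fst (\<omega> (n, canonical_state x n \<omega>))"

definition canonical_holding :: "'a \<Rightarrow> nat \<Rightarrow> (nat \<times> 'a \<Rightarrow> 'a \<times> ennreal) \<Rightarrow> ennreal" where
  "canonical_holding x n \<omega> = snd (\<omega> (n, canonical_state x n \<omega>))"

lemma prob_space_step_law: "prob_space (step_law p)"
  unfolding step_law_def
  by (intro prob_space_pair prob_space_exp_law rate_nonneg measure_pmf.prob_space_axioms)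

lemma sets_step_law: "sets (step_law p) = sets (count_space UNIV \<Otimes>\<^sub>M borel)"
  unfolding step_law_def by (intro sets_pair_measure_cong) simp_all

lemma measurable_coord: "(\<lambda>\<omega>. \<omega> p) \<in> measurable canonical (count_space UNIV \<Otimes>\<^sub>M borel)"
proof -
  have "(\<lambda>\<omega>. \<omega> p) \<in> measurable canonical (step_law p)"
    unfolding canonical_def by (rule measurable_component_singleton) simp
  thus ?thesis using measurable_cong_sets[OF refl sets_step_law] by blast
qed

lemma measurable_canonical_state: "canonical_state x n \<in> measurable canonical (count_space UNIV)"
proof (induction n)
  case (Suc n)
  have "(\<lambda>\<omega>. \<omega> (n, canonical_state x n \<omega>)) \<in> measurable canonical (count_space UNIV \<Otimes>\<^sub>M borel)"
    by (rule measurable_compose_countable[OF measurable_coord Suc])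
  hence "(\<lambda>\<omega>. fst (\<omega> (n, canonical_state x n \<omega>))) \<in> measurable canonical (count_space UNIV)"
    by (rule measurable_compose[OF _ measurable_fst])
  thus ?case by simp
qed simp

lemma measurable_canonical_holding: "canonical_holding x n \<in> borel_measurable canonical"
  unfolding canonical_holding_def[abs_def]
  by (rule measurable_compose[OF measurable_compose_countable[OF measurable_coord measurable_canonical_state] measurable_snd])

text \<open>On the cylinder of the path \<open>y\<close> the chain reads the pairs at
  \<open>(k, y k)\<close>. These are distinct coordinates, so the probability is a product.\<close>

lemma canonical_cylinder:
  assumes t: "\<And>k. 0 \<le> t k"
  shows "measure canonical {\<omega> \<in> space canonical. \<forall>k\<le>n. canonical_state x k \<omega> = y k \<and> ennreal (t k) < canonical_holding x k \<omega>} =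
    pmf (return_pmf x) (y 0) * (\<Prod>k<n. jump_prob L (y k) (y (Suc k))) * (\<Prod>k\<le>n. exp (L (y k) (y k) * t k))"
proof (cases "y 0 = x")
  case False
  hence "{\<omega> \<in> space canonical. \<forall>k\<le>n. canonical_state x k \<omega> = y k \<and> ennreal (t k) < canonical_holding x k \<omega>} = {}"
    by (auto intro!: exI[of _ 0])
  thus ?thesis using False by (simp only: measure_empty) (simp add: indicator_def)
next
  case True
  interpret product_prob_space step_law UNIV
    by (intro product_prob_space.intro product_sigma_finite.intro product_prob_space_axioms.intro
        prob_space_imp_sigma_finite prob_space_step_law)
  define K where "K = (\<lambda>k. (k, y k)) ` {..n}"
  \<comment> \<open>The last pair contributes only its holding time: the state after step
    \<open>n\<close> is unrestricted.\<close>
  define A where "A p = (if fst p < n then {y (Suc (fst p))} else UNIV) \<times> {ennreal (t (fst p)) <..}" for p :: "nat \<times> 'a"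
  have "{\<omega> \<in> space canonical. \<forall>k\<le>n. canonical_state x k \<omega> = y k \<and> ennreal (t k) < canonical_holding x k \<omega>} =
    {\<omega> \<in> space canonical. \<forall>p\<in>K. \<omega> p \<in> A p}"
  proof (intro Collect_cong conj_cong refl)
    fix \<omega>
    have st: "(\<forall>k\<le>m. canonical_state x k \<omega> = y k) \<longleftrightarrow> (\<forall>k<m. fst (\<omega> (k, y k)) = y (Suc k))" for m
    proof (induction m)
      case 0
      show ?case using True by simp
    next
      case (Suc m)
      have "(\<forall>k\<le>Suc m. canonical_state x k \<omega> = y k) \<longleftrightarrow>
         (\<forall>k\<le>m. canonical_state x k \<omega> = y k) \<and> fst (\<omega> (m, canonical_state x m \<omega>)) = y (Suc m)"
        by (metis canonical_state.simps(2) le_Suc_eq)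
      also have "\<dots> \<longleftrightarrow> (\<forall>k\<le>m. canonical_state x k \<omega> = y k) \<and> fst (\<omega> (m, y m)) = y (Suc m)"
        by auto
      also have "\<dots> \<longleftrightarrow> (\<forall>k<Suc m. fst (\<omega> (k, y k)) = y (Suc k))"
        unfolding Suc by (metis less_Suc_eq)
      finally show ?case .
    qed
    have "(\<forall>k\<le>n. canonical_state x k \<omega> = y k \<and> ennreal (t k) < canonical_holding x k \<omega>) \<longleftrightarrow>
      (\<forall>k\<le>n. canonical_state x k \<omega> = y k) \<and> (\<forall>k\<le>n. ennreal (t k) < snd (\<omega> (k, y k)))"
      by (auto simp: canonical_holding_def)
    also have "\<dots> \<longleftrightarrow> (\<forall>k\<le>n. (k < n \<longrightarrow> fst (\<omega> (k, y k)) = y (Suc k)) \<and> ennreal (t k) < snd (\<omega> (k, y k)))"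
      unfolding st by (meson less_imp_le)
    also have "\<dots> \<longleftrightarrow> (\<forall>p\<in>K. \<omega> p \<in> A p)"
    proof -
      have "\<omega> (k, y k) \<in> A (k, y k) \<longleftrightarrow>
          (k < n \<longrightarrow> fst (\<omega> (k, y k)) = y (Suc k)) \<and> ennreal (t k) < snd (\<omega> (k, y k))" for k
        by (simp add: A_def mem_Times_iff)
      moreover have "(\<forall>p\<in>K. P p) \<longleftrightarrow> (\<forall>k\<le>n. P (k, y k))" for P
        by (auto simp: K_def)
      ultimately show ?thesis by simp
    qed
    finally show "(\<forall>k\<le>n. canonical_state x k \<omega> = y k \<and> ennreal (t k) < canonical_holding x k \<omega>) \<longleftrightarrow>
      (\<forall>p\<in>K. \<omega> p \<in> A p)" .
  qed
  moreover have "emeasure canonical {\<omega> \<in> space canonical. \<forall>p\<in>K. \<omega> p \<in> A p} = (\<Prod>p\<in>K. emeasure (step_law p) (A p))"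
    unfolding canonical_def
    by (rule emeasure_PiM_Collect) (auto simp: K_def A_def sets_step_law intro!: pair_measureI)
  moreover have "(\<Prod>p\<in>K. emeasure (step_law p) (A p)) = (\<Prod>k\<le>n. emeasure (step_law (k, y k)) (A (k, y k)))"
    unfolding K_def by (subst prod.reindex) (auto simp: inj_on_def)
  moreover have "emeasure (step_law (k, y k)) (A (k, y k)) =
     ennreal ((if k < n then jump_prob L (y k) (y (Suc k)) else 1) * exp (L (y k) (y k) * t k))" for k
  proof -
    interpret E: prob_space "exp_law (rate (y k))" by (rule prob_space_exp_law[OF rate_nonneg])
    have "ray (t k) = {ennreal (t k) <..}" using t[of k] by (simp add: ray_def)
    moreover have "emeasure (exp_law (rate (y k))) (ray (t k)) = ennreal (exp (L (y k) (y k) * t k))"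
      using emeasure_exp_law_ray[OF rate_nonneg, of "y k" "t k"] t[of k] by (simp add: rate_def)
    moreover have "emeasure (measure_pmf (jump_pmf (y k))) (if k < n then {y (Suc k)} else UNIV) =
       ennreal (if k < n then jump_prob L (y k) (y (Suc k)) else 1)"
      using measure_pmf.emeasure_space_1[of "jump_pmf (y k)"] by (simp add: emeasure_pmf_single pmf_jump_pmf)
    ultimately show ?thesis
      unfolding step_law_def A_def
      by (simp add: E.emeasure_pair_measure_Times ennreal_mult'' emeasure_pmf_single pmf_jump_pmf)
  qed
  moreover have "(\<Prod>k\<le>n. ennreal ((if k < n then jump_prob L (y k) (y (Suc k)) else 1) * exp (L (y k) (y k) * t k))) =
    ennreal ((\<Prod>k<n. jump_prob L (y k) (y (Suc k))) * (\<Prod>k\<le>n. exp (L (y k) (y k) * t k)))"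
  proof -
    have "(\<Prod>k\<le>n. (if k < n then jump_prob L (y k) (y (Suc k)) else 1) * exp (L (y k) (y k) * t k)) =
      (\<Prod>k<n. jump_prob L (y k) (y (Suc k))) * (\<Prod>k\<le>n. exp (L (y k) (y k) * t k))"
      unfolding prod.distrib by (simp add: lessThan_Suc_atMost[symmetric])
    thus ?thesis by (subst prod_ennreal) (auto simp: jump_prob_nonneg)
  qed
  ultimately have "emeasure canonical {\<omega> \<in> space canonical. \<forall>k\<le>n. canonical_state x k \<omega> = y k \<and> ennreal (t k) < canonical_holding x k \<omega>} =
    ennreal ((\<Prod>k<n. jump_prob L (y k) (y (Suc k))) * (\<Prod>k\<le>n. exp (L (y k) (y k) * t k)))"
    by simp
  thus ?thesis using True
    by (simp add: measure_def prod_nonneg jump_prob_nonneg)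
qed

lemma exists_realization:
  fixes emb :: "real \<Rightarrow> 'w"
  assumes "inj emb"
  shows "\<exists>(M :: 'w measure) Y H. jump_chain_holding M L (return_pmf x) Y H"
proof -
  from exists_inj_function_space[OF assms] obtain e :: "(nat \<times> 'a \<Rightarrow> 'a \<times> ennreal) \<Rightarrow> 'w" where e: "inj e" ..
  have inv: "inv e (e \<omega>) = \<omega>" for \<omega> using e by simp
  define M where "M = embed_measure canonical e"
  define Y where "Y n w = canonical_state x n (inv e w)" for n w
  define H where "H n w = canonical_holding x n (inv e w)" for n w
  interpret C: prob_space canonical
    unfolding canonical_def by (intro prob_space_PiM prob_space_step_law)
  have em: "emeasure M A = emeasure canonical (e -` A \<inter> space canonical)" if "A \<in> sets M" for A
    using that unfolding M_def by (rule emeasure_embed_measure[OF e])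
  have Y: "Y n \<in> measurable M (count_space UNIV)" for n
    unfolding M_def by (rule measurable_embed_measure1) (simp add: Y_def inv measurable_canonical_state[unfolded eta_contract_eq])
  have H: "H n \<in> borel_measurable M" for n
    unfolding M_def by (rule measurable_embed_measure1) (simp add: H_def inv measurable_canonical_holding)
  have sp: "space M = e ` space canonical" by (simp add: M_def space_embed_measure)
  have "prob_space M"
  proof
    have "e -` space M \<inter> space canonical = space canonical" by (auto simp: sp)
    thus "emeasure M (space M) = 1" using em[OF sets.top] C.emeasure_space_1 by simp
  qed
  moreover have "measure M {\<omega> \<in> space M. \<forall>k\<le>n. Y k \<omega> = y k \<and> ennreal (t k) < H k \<omega>} =
     pmf (return_pmf x) (y 0) * (\<Prod>k<n. jump_prob L (y k) (y (Suc k))) * (\<Prod>k\<le>n. exp (L (y k) (y k) * t k))"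
    if t: "\<forall>k. 0 \<le> t k" for n y t
  proof -
    note [measurable] = Y H
    have "{\<omega> \<in> space M. \<forall>k\<le>n. Y k \<omega> = y k \<and> ennreal (t k) < H k \<omega>} \<in> sets M" by measurable
    moreover have "e -` {\<omega> \<in> space M. \<forall>k\<le>n. Y k \<omega> = y k \<and> ennreal (t k) < H k \<omega>} \<inter> space canonical =
      {\<omega> \<in> space canonical. \<forall>k\<le>n. canonical_state x k \<omega> = y k \<and> ennreal (t k) < canonical_holding x k \<omega>}"
      by (auto simp: sp Y_def H_def inv)
    ultimately show ?thesis
      using canonical_cylinder[of t n x y] t em unfolding measure_def by simp
  qed
  ultimately have "jump_chain_holding M L (return_pmf x) Y H"
    using Y H unfolding jump_chain_holding_def by blast
  thus ?thesis by blast
qed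

lemma exists_process:
  fixes emb :: "real \<Rightarrow> 'w"
  assumes emb: "inj emb" and ne: "nonexplosive TYPE('w) L"
  obtains M :: "'w measure" and Y H X where "jump_process L \<mu> M (return_pmf x) Y H X"
    "markov_jump_process M L (return_pmf x) X"
proof -
  from exists_realization[OF emb, of x] obtain M :: "'w measure" and Y H
    where YH: "jump_chain_holding M L (return_pmf x) Y H" by blast
  define X where "X = path_of Y H x"
  have mY: "Y n \<in> measurable M (count_space UNIV)" and mH: "H n \<in> borel_measurable M" for n
    using YH by (auto simp: jump_chain_holding_def)
  have X: "X t \<in> measurable M (count_space UNIV)" for t
    unfolding X_def by (rule measurable_path_of[OF mY mH])
  have "jump_process L \<mu> M (return_pmf x) Y H X"
  proof
    show "jump_chain_holding M L (return_pmf x) Y H" by fact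
    show "AE \<omega> in M. (\<lambda>n. jump_time H n \<omega>) \<longlonglongrightarrow> \<infinity>"
      using ne YH by (auto simp: nonexplosive_def)
  next
    show "X t \<in> measurable M (count_space UNIV)" for t by (rule X)
    show "X t \<omega> = Y n \<omega>" if "jump_time H n \<omega> \<le> ennreal t" "ennreal t < jump_time H (Suc n) \<omega>" for \<omega> t n
      unfolding X_def using that by (rule path_of_eq)
  qed
  moreover have "markov_jump_process M L (return_pmf x) X"
    unfolding markov_jump_process_def
  proof (intro conjI exI[of _ Y] exI[of _ H] allI ballI impI)
    show "X t \<in> measurable M (count_space UNIV)" for t by (rule X)
    show "jump_chain_holding M L (return_pmf x) Y H" by fact
    show "\<forall>\<^sub>F s in at_right t. X s \<omega> = X t \<omega>" if "0 \<le> t" for t \<omega>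
      unfolding X_def using that by (rule path_of_right_continuous)
    show "X t \<omega> = Y n \<omega>" if "jump_time H n \<omega> \<le> ennreal t \<and> ennreal t < jump_time H (Suc n) \<omega>" for \<omega> t n
      unfolding X_def using that by (intro path_of_eq) auto
  qed
  ultimately show ?thesis using that by blast
qed

end

section \<open>Transition probabilities read off from a realization\<close>

lemma borel_measurable_nn_integral_count_space:
  fixes f :: "'a::countable \<Rightarrow> 'b \<Rightarrow> ennreal"
  assumes [measurable]: "\<And>x. f x \<in> borel_measurable M"
  shows "(\<lambda>\<omega>. \<integral>\<^sup>+ x. f x \<omega> \<partial>count_space UNIV) \<in> borel_measurable M"
proof -
  interpret sigma_finite_measure "count_space (UNIV :: 'a set)"
    by (rule sigma_finite_measure_count_space)
  have "(\<lambda>(x, \<omega>). f x \<omega>) \<in> borel_measurable (count_space UNIV \<Otimes>\<^sub>M M)"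
    by (rule measurable_pair_measure_countable1) auto
  from measurable_pair_swap[OF this]
  have "(\<lambda>(\<omega>, x). f x \<omega>) \<in> borel_measurable (M \<Otimes>\<^sub>M count_space UNIV)"
    by simp
  thus ?thesis by (rule borel_measurable_nn_integral)
qed

locale embedded_generator = reversible_generator L \<mu>
  for L :: "'a::countable \<Rightarrow> 'a \<Rightarrow> real" and \<mu> :: "'a pmf" +
  fixes emb :: "real \<Rightarrow> 'w"
  assumes emb: "inj emb" and nonexplosive: "nonexplosive TYPE('w) L"
begin

text \<open>This represents the analytically defined \<open>trans_prob x t\<close> as the law of a
  process at time \<open>t\<close>, so that its mass and composition properties follow from
  probability.\<close>

lemma obtain_process:
  obtains M :: "'w measure" and Y H X where "jump_process L \<mu> M (return_pmf x) Y H X"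
    "\<And>t y. t \<ge> 0 \<Longrightarrow> emeasure M (jump_process.X_event M X t y) = trans_prob x t y"
proof -
  obtain M :: "'w measure" and Y H X where "jump_process L \<mu> M (return_pmf x) Y H X"
    by (rule exists_process[OF emb nonexplosive])
  then interpret P: jump_process L \<mu> M "return_pmf x" Y H X .
  have "emeasure M (P.X_event t y) = trans_prob x t y" if "t \<ge> 0" for t y
  proof -
    have "emeasure M (P.X_event t y) = (\<integral>\<^sup>+ z. trans_prob x t y * indicator {x} z \<partial>count_space UNIV)"
      unfolding P.emeasure_X[OF that] by (intro nn_integral_cong) (auto split: split_indicator)
    thus ?thesis by simp
  qed
  thus ?thesis using that P.jump_process_axioms by blast
qed

lemma trans_total:
  assumes t: "t \<ge> 0"
  shows "(\<integral>\<^sup>+ y. trans_prob x t y \<partial>count_space UNIV) = 1"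
proof -
  obtain M :: "'w measure" and Y H X where "jump_process L \<mu> M (return_pmf x) Y H X"
    and eq: "\<And>t y. t \<ge> 0 \<Longrightarrow> emeasure M (jump_process.X_event M X t y) = trans_prob x t y"
    by (rule obtain_process[of x]) (rule that)
  then interpret P: jump_process L \<mu> M "return_pmf x" Y H X by simp
  have "P.X_event t y = space M \<inter> P.X_event t y" for y by (auto simp: P.X_event_def)
  hence "(\<integral>\<^sup>+ y. trans_prob x t y \<partial>count_space UNIV) = (\<integral>\<^sup>+ y. emeasure M (space M \<inter> P.X_event t y) \<partial>count_space UNIV)"
    using eq[OF t] by simp
  also have "\<dots> = emeasure M (space M)"
    by (rule P.emeasure_states[symmetric]) (use t in auto)
  finally show ?thesis by (simp add: P.emeasure_space_1)
qed

lemma trans_le_1: "t \<ge> 0 \<Longrightarrow> trans_prob x t y \<le> 1"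
  using nn_integral_ge_point[of y UNIV "trans_prob x t"] trans_total[of t x] by simp

text \<open>One term of the Chapman-Kolmogorov sum, obtained by observing the process in
  \<open>z\<close> at time \<open>s\<close>.\<close>

lemma trans_superadditive:
  assumes s: "s \<ge> 0" and t: "t \<ge> 0"
  shows "trans_prob x s z * trans_prob z t y \<le> trans_prob x (s + t) y"
proof -
  obtain M :: "'w measure" and Y H X where "jump_process L \<mu> M (return_pmf x) Y H X"
    and eq: "\<And>t y. t \<ge> 0 \<Longrightarrow> emeasure M (jump_process.X_event M X t y) = trans_prob x t y"
    by (rule obtain_process[of x]) (rule that)
  then interpret P: jump_process L \<mu> M "return_pmf x" Y H X by simp
  have sub: "P.X_event s z \<subseteq> space M" by (auto simp: P.X_event_def)
  have "trans_prob x s z * trans_prob z t y = emeasure M (space M \<inter> P.X_event s z) * trans_prob z t y"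
    using sub by (simp add: eq[OF s] Int_absorb1)
  also have "\<dots> = emeasure M (space M \<inter> (P.X_event s z \<inter> P.X_event (s + t) y))"
    using P.markov_past[OF s t, of "space M" z y] sets.top[of "P.past s"] by simp
  also have "\<dots> \<le> emeasure M (P.X_event (s + t) y)"
    by (rule emeasure_mono) (use s t P.sets_X_event in auto)
  also have "\<dots> = trans_prob x (s + t) y" using s t by (simp add: eq)
  finally show ?thesis .
qed

lemma laplace_1: "laplace (\<lambda>_. 1) = 1"
  using nn_integral_exp_tail[of 1 0] by (simp add: laplace_def cong: if_cong)

lemma res_total: "(\<integral>\<^sup>+ y. ennreal (res x y) \<partial>count_space UNIV) = 1"
proof -
  have "(\<integral>\<^sup>+ y. ennreal (res x y) \<partial>count_space UNIV) =
    (\<integral>\<^sup>+ y. \<integral>\<^sup>+ t. (if 0 \<le> t then ennreal (exp (- t)) * trans_prob x t y else 0) \<partial>lborel \<partial>count_space UNIV)"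
    by (simp only: laplace_trans[symmetric] laplace_def)
  also have "\<dots> = (\<integral>\<^sup>+ t. \<integral>\<^sup>+ y. (if 0 \<le> t then ennreal (exp (- t)) * trans_prob x t y else 0) \<partial>count_space UNIV \<partial>lborel)"
    by (rule nn_integral_count_space_nn_integral[symmetric]) auto
  also have "\<dots> = laplace (\<lambda>_. 1)"
    unfolding laplace_def by (intro nn_integral_cong) (auto simp: nn_integral_cmult trans_total)
  finally show ?thesis by (simp add: laplace_1)
qed

text \<open>Symmetry of \<open>res\<close> under \<open>\<mu>\<close> turns the sum over starting
  points into a sum over end points, which is 1.\<close>

lemma res_stationary: "(\<integral>\<^sup>+ x. ennreal (pmf \<mu> x) * ennreal (res x y) \<partial>count_space UNIV) = ennreal (pmf \<mu> y)"
proof -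
  have "ennreal (pmf \<mu> x) * ennreal (res x y) = ennreal (pmf \<mu> y) * ennreal (res y x)" for x
    by (simp add: ennreal_mult[symmetric] res_nonneg res_sym)
  thus ?thesis by (simp add: nn_integral_cmult res_total)
qed

end

context jump_process
begin

definition enlarged :: "'w set set \<Rightarrow> ennreal \<Rightarrow> 'w measure" where
  "enlarged \<G> t = sigma (space M) (sets (natural_filtration M X t) \<union> \<G>)"

lemma indep_set_subset:
  assumes "indep_set A B"
  shows "A \<subseteq> sets M"
proof -
  have "\<forall>i. case_bool A B i \<subseteq> sets M"
    using assms unfolding indep_set_def indep_sets_def by blast
  from this[rule_format, of True] show ?thesis by simp
qed

lemma sets_enlarged:
  assumes "\<G> \<subseteq> sets M"
  shows "sets (enlarged \<G> t) = sigma_sets (space M) (sets (natural_filtration M X t) \<union> \<G>)"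
    and "space (enlarged \<G> t) = space M" and "sets (enlarged \<G> t) \<subseteq> sets M"
proof -
  have sub: "sets (natural_filtration M X t) \<union> \<G> \<subseteq> sets M"
    using assms sets_filtration_M by auto
  hence "sets (natural_filtration M X t) \<union> \<G> \<subseteq> Pow (space M)"
    using sets.sets_into_space by blast
  thus *: "sets (enlarged \<G> t) = sigma_sets (space M) (sets (natural_filtration M X t) \<union> \<G>)"
    "space (enlarged \<G> t) = space M"
    by (simp_all add: enlarged_def)
  show "sets (enlarged \<G> t) \<subseteq> sets M"
    unfolding * by (rule sets.sigma_sets_subset[OF sub])
qed

lemma sets_enlarged_mono:
  assumes "\<G> \<subseteq> sets M" "s \<le> t"
  shows "sets (enlarged \<G> s) \<subseteq> sets (enlarged \<G> t)"
  unfolding sets_enlarged(1)[OF assms(1)] using sets_filtration_mono[OF assms(2)]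
  by (intro sigma_sets_mono') auto

end

section \<open>From strong stationary times to a resolvent bound\<close>

locale randomized_stopping = jump_process L \<mu> M \<mu>0 Y H X
  for L :: "'a::countable \<Rightarrow> 'a \<Rightarrow> real" and \<mu> :: "'a pmf"
    and M :: "'w measure" and \<mu>0 :: "'a pmf"
    and Y :: "nat \<Rightarrow> 'w \<Rightarrow> 'a" and H :: "nat \<Rightarrow> 'w \<Rightarrow> ennreal"
    and X :: "real \<Rightarrow> 'w \<Rightarrow> 'a" +
  fixes \<G> :: "'w set set" and T :: "'w \<Rightarrow> ennreal"
  assumes right_continuous: "\<lbrakk>\<omega> \<in> space M; t \<ge> 0\<rbrakk> \<Longrightarrow> \<forall>\<^sub>F s in at_right t. X s \<omega> = X t \<omega>"
    and G_sigma: "sigma_algebra (space M) \<G>"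
    and G_indep: "indep_set \<G> (sets (natural_filtration M X \<infinity>))"
    and stopping: "stopping_time (\<lambda>t. sigma (space M) (sets (natural_filtration M X t) \<union> \<G>)) T"
begin

lemma G_subset: "\<G> \<subseteq> sets M"
  by (rule indep_set_subset[OF G_indep])

lemma T_le_event: "{\<omega> \<in> space M. T \<omega> \<le> t} \<in> sets (enlarged \<G> t)"
proof -
  have "Measurable.pred (enlarged \<G> t) (\<lambda>\<omega>. T \<omega> \<le> t)"
    using stopping by (simp add: stopping_time_def enlarged_def)
  thus ?thesis using sets_enlarged(2)[OF G_subset] by (simp add: pred_def)
qed

lemma measurable_T [measurable]: "T \<in> borel_measurable M"
  using T_le_event sets_enlarged(3)[OF G_subset] by (intro borel_measurableI_le) blast

section \<open>Rounding a stopping time up to a grid\<close>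

definition grid :: "nat \<Rightarrow> nat \<Rightarrow> real" where
  "grid m k = real k / real (Suc m)"

text \<open>On \<open>cell m k\<close> the time \<open>T\<close> is rounded up to \<open>grid m k\<close>.\<close>

definition cell :: "nat \<Rightarrow> nat \<Rightarrow> 'w set" where
  "cell m k = {\<omega> \<in> space M. T \<omega> \<le> ennreal (grid m k)} -
     (if k = 0 then {} else {\<omega> \<in> space M. T \<omega> \<le> ennreal (grid m (k - 1))})"

lemma grid_nonneg: "grid m k \<ge> 0"
  by (simp add: grid_def)

lemma grid_mono: "k \<le> l \<Longrightarrow> grid m k \<le> grid m l"
  by (simp add: grid_def divide_right_mono)

text \<open>Rounding up, not down, keeps the stopping property: by time \<open>grid m k\<close> it
  is known whether \<open>T\<close> lies in the cell.\<close>

lemma cell_enlarged: "cell m k \<in> sets (enlarged \<G> (ennreal (grid m k)))"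
proof -
  have "{\<omega> \<in> space M. T \<omega> \<le> ennreal (grid m (k - 1))} \<in> sets (enlarged \<G> (ennreal (grid m k)))"
    using T_le_event[of "ennreal (grid m (k - 1))"]
      sets_enlarged_mono[OF G_subset ennreal_leI[OF grid_mono[of "k - 1" k m]]] by auto
  thus ?thesis unfolding cell_def using T_le_event by (intro sets.Diff) auto
qed

lemma sets_cell [measurable]: "cell m k \<in> sets M"
  using cell_enlarged sets_enlarged(3)[OF G_subset] by blast

lemma disjoint_cell: "disjoint_family (cell m)"
proof -
  have "cell m k \<inter> cell m l = {}" if "k < l" for k l
  proof -
    have "ennreal (grid m k) \<le> ennreal (grid m (l - 1))"
      using that by (intro ennreal_leI grid_mono) simp
    thus ?thesis using that unfolding cell_def by (auto dest: order.trans)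
  qed
  thus ?thesis
    unfolding disjoint_family_on_def by (metis Int_commute linorder_neqE_nat)
qed

lemma in_cell:
  assumes "\<omega> \<in> space M" "T \<omega> = ennreal r" "r \<ge> 0"
  obtains k where "\<omega> \<in> cell m k" "r \<le> grid m k" "grid m k \<le> r + 1 / real (Suc m)"
proof -
  define k where "k = nat \<lceil>r * real (Suc m)\<rceil>"
  have k: "r * real (Suc m) \<le> real k" "real k < r * real (Suc m) + 1"
    using assms(3) unfolding k_def by (auto simp: of_nat_nat ceiling_correct) linarith+
  have 1: "r \<le> grid m k" using k(1) by (simp add: grid_def field_simps)
  have 2: "grid m k \<le> r + 1 / real (Suc m)"
  proof -
    have "grid m k \<le> (r * real (Suc m) + 1) / real (Suc m)"
      unfolding grid_def using k(2) by (intro divide_right_mono) auto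
    thus ?thesis by (simp add: add_divide_distrib del: of_nat_Suc)
  qed
  have 3: "grid m (k - 1) < r" if "k \<noteq> 0"
    using k(2) that by (simp add: grid_def field_simps of_nat_diff)
  have "\<omega> \<in> cell m k"
    using assms 1 3 grid_nonneg[of m k] grid_nonneg[of m "k - 1"] by (auto simp: cell_def)
  thus ?thesis using that 1 2 by blast
qed

text \<open>The rounded times tend to \<open>T\<close> from above. Right-continuity in the discrete
  topology means that the path is constant just after \<open>T\<close>, so a fine grid sees the
  state at \<open>T\<close> itself.\<close>

lemma eventually_cell_state:
  assumes \<omega>: "\<omega> \<in> space M" and T: "T \<omega> = ennreal r" "r \<ge> 0"
  shows "\<forall>\<^sub>F m in sequentially. \<exists>k. \<omega> \<in> cell m k \<and> X (grid m k) \<omega> = X r \<omega> \<and> r \<le> grid m k \<and> grid m k \<le> r + 1"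
proof -
  from right_continuous[OF \<omega> T(2)] obtain b where b: "b > r" "\<And>s. r < s \<Longrightarrow> s < b \<Longrightarrow> X s \<omega> = X r \<omega>"
    unfolding eventually_at_right_field by blast
  have "\<forall>\<^sub>F m in sequentially. 1 / real (Suc m) < b - r"
    using b(1) by (intro order_tendstoD(2)[OF LIMSEQ_inverse_real_of_nat[unfolded inverse_eq_divide]]) simp
  thus ?thesis
  proof eventually_elim
    case (elim m)
    obtain k where k: "\<omega> \<in> cell m k" "r \<le> grid m k" "grid m k \<le> r + 1 / real (Suc m)"
      using in_cell[OF \<omega> T] by blast
    have "X (grid m k) \<omega> = X r \<omega>"
      using b(2)[of "grid m k"] k elim by (cases "r = grid m k") auto
    moreover have "1 / real (Suc m) \<le> 1" by simp
    hence "grid m k \<le> r + 1" using k(3) by linarith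
    ultimately show ?case using k(1,2) by blast
  qed
qed

definition XT :: "'a \<Rightarrow> 'w set" where
  "XT x = {\<omega> \<in> space M. X (enn2real (T \<omega>)) \<omega> = x}"

text \<open>This form shows measurability: for finite \<open>T\<close> the state at \<open>T\<close>
  is the eventual state at the rounded times. For infinite \<open>T\<close>, \<open>enn2real\<close>
  returns 0 and the state is that at time 0.\<close>

lemma XT_eq:
  "XT x = ({\<omega> \<in> space M. T \<omega> = \<infinity>} \<inter> X_event 0 x) \<union>
     ({\<omega> \<in> space M. T \<omega> < \<infinity>} \<inter> (\<Union>n. \<Inter>m\<in>{n..}. \<Union>k. cell m k \<inter> X_event (grid m k) x))"
proof -
  have "\<omega> \<in> XT x \<longleftrightarrow> \<omega> \<in> (\<Union>n. \<Inter>m\<in>{n..}. \<Union>k. cell m k \<inter> X_event (grid m k) x)"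
    if \<omega>: "\<omega> \<in> space M" and T: "T \<omega> = ennreal r" "r \<ge> 0" for \<omega> r
  proof -
    have XTr: "\<omega> \<in> XT x \<longleftrightarrow> X r \<omega> = x" using \<omega> T by (simp add: XT_def)
    from eventually_cell_state[OF \<omega> T] obtain n0 where
      n0: "\<And>m. m \<ge> n0 \<Longrightarrow> \<exists>k. \<omega> \<in> cell m k \<and> X (grid m k) \<omega> = X r \<omega>"
      unfolding eventually_sequentially by blast
    have uniq: "k = l" if "\<omega> \<in> cell m k" "\<omega> \<in> cell m l" for m k l
      using disjoint_cell[of m] that unfolding disjoint_family_on_def by blast
    show ?thesis
    proof
      assume "\<omega> \<in> XT x"
      hence "\<omega> \<in> (\<Union>k. cell m k \<inter> X_event (grid m k) x)" if "m \<ge> n0" for m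
        using n0[OF that] \<omega> unfolding XTr X_event_def by blast
      thus "\<omega> \<in> (\<Union>n. \<Inter>m\<in>{n..}. \<Union>k. cell m k \<inter> X_event (grid m k) x)" by auto
    next
      assume "\<omega> \<in> (\<Union>n. \<Inter>m\<in>{n..}. \<Union>k. cell m k \<inter> X_event (grid m k) x)"
      then obtain n where n: "\<And>m. m \<ge> n \<Longrightarrow> \<omega> \<in> (\<Union>k. cell m k \<inter> X_event (grid m k) x)" by auto
      obtain k where k: "\<omega> \<in> cell (max n n0) k" "X (grid (max n n0) k) \<omega> = x"
        using n[of "max n n0"] by (auto simp: X_event_def)
      obtain l where "\<omega> \<in> cell (max n n0) l" "X (grid (max n n0) l) \<omega> = X r \<omega>"
        using n0[of "max n n0"] by auto
      thus "\<omega> \<in> XT x" using uniq[OF k(1)] k(2) unfolding XTr by metis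
    qed
  qed
  note fin = this
  show ?thesis (is "_ = ?R")
  proof (intro set_eqI)
    fix \<omega>
    show "\<omega> \<in> XT x \<longleftrightarrow> \<omega> \<in> ?R"
    proof (cases "\<omega> \<in> space M")
      case True
      show ?thesis
      proof (cases "T \<omega>")
        case (real r)
        hence "T \<omega> < \<infinity>" "T \<omega> \<noteq> \<infinity>" by auto
        thus ?thesis using fin[OF True real(2,1)] True by blast
      next
        case top
        hence "\<omega> \<in> XT x \<longleftrightarrow> \<omega> \<in> X_event 0 x" "T \<omega> = \<infinity>" "\<not> T \<omega> < \<infinity>"
          by (auto simp: XT_def X_event_def)
        thus ?thesis using True by blast
      qed
    next
      case False
      thus ?thesis by (simp add: XT_def)
    qed
  qed
qed

lemma sets_XT [measurable]: "XT x \<in> sets M"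
proof -
  have "cell m k \<inter> X_event (grid m k) x \<in> sets M" for m k
    using sets_X_event[OF grid_nonneg] by auto
  hence "(\<Union>n. \<Inter>m\<in>{n..}. \<Union>k. cell m k \<inter> X_event (grid m k) x) \<in> sets M"
    by (intro sets.countable_UN sets.countable_INT' image_subsetI) auto
  moreover have "X_event 0 x \<in> sets M" by (rule sets_X_event) simp
  moreover have "{\<omega> \<in> space M. T \<omega> = \<infinity>} = T -` {\<infinity>} \<inter> space M"
    "{\<omega> \<in> space M. T \<omega> < \<infinity>} = T -` {..<\<infinity>} \<inter> space M" by auto
  ultimately show ?thesis unfolding XT_eq by (intro sets.Un sets.Int) (simp_all add: measurable_sets[OF measurable_T])
qed

lemma markov_cell:
  assumes t: "t \<ge> 0"
  shows "emeasure M (cell m k \<inter> (X_event (grid m k) x \<inter> X_event (grid m k + t) y)) =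
    emeasure M (cell m k \<inter> X_event (grid m k) x) * trans_prob x t y"
  using cell_enlarged[of m k] unfolding enlarged_def
  by (rule markov_enlarged[OF grid_nonneg t G_sigma G_indep])

text \<open>With \<open>T'\<close> the rounded time this is
  \<open>exp (- T') * res (X T') y\<close>, and 0 if \<open>T\<close> is infinite, since the cells
  cover only finite \<open>T\<close>.\<close>

definition discounted :: "'a \<Rightarrow> nat \<Rightarrow> 'w \<Rightarrow> ennreal" where
  "discounted y m \<omega> = (\<Sum>k. \<integral>\<^sup>+ x. indicator (cell m k \<inter> X_event (grid m k) x) \<omega> *
     (ennreal (exp (- grid m k)) * ennreal (res x y)) \<partial>count_space UNIV)"

text \<open>Both sides are expected discounted occupations of \<open>y\<close>, on the left only from the rounded
  time on.\<close>

lemma discounted_le_laplace: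
  "(\<integral>\<^sup>+ \<omega>. discounted y m \<omega> \<partial>M) \<le> laplace (\<lambda>t. \<integral>\<^sup>+ x. ennreal (pmf \<mu>0 x) * trans_prob x t y \<partial>count_space UNIV)"
proof -
  note [measurable] = sets_X_event[OF grid_nonneg]
  \<comment> \<open>The discounted probability that the rounded time is \<open>grid m k\<close> and
    that the process is in \<open>y\<close> at a later time \<open>t\<close>. The Markov property at
    \<open>grid m k\<close> evaluates it.\<close>
  define \<psi> where "\<psi> k t = (if grid m k \<le> t then ennreal (exp (- t)) * emeasure M (cell m k \<inter> X_event t y) else 0)" for k t
  have \<psi>_eq: "\<psi> k t = (\<integral>\<^sup>+ x. emeasure M (cell m k \<inter> X_event (grid m k) x) *
      (if grid m k \<le> t then ennreal (exp (- t)) * trans_prob x (t - grid m k) y else 0) \<partial>count_space UNIV)" for k t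
  proof (cases "grid m k \<le> t")
    case True
    have t0: "t \<ge> 0" using order.trans[OF grid_nonneg True] .
    note [measurable] = sets_X_event[OF t0]
    have "emeasure M (cell m k \<inter> X_event t y) =
        (\<integral>\<^sup>+ x. emeasure M (cell m k \<inter> (X_event (grid m k) x \<inter> X_event t y)) \<partial>count_space UNIV)"
      by (subst emeasure_states[OF _ grid_nonneg[of m k]]) (auto intro!: nn_integral_cong arg_cong[where f = "emeasure M"])
    also have "\<dots> = (\<integral>\<^sup>+ x. emeasure M (cell m k \<inter> X_event (grid m k) x) * trans_prob x (t - grid m k) y \<partial>count_space UNIV)"
      using markov_cell[of "t - grid m k" m k _ y] True by simp
    finally have "ennreal (exp (- t)) * emeasure M (cell m k \<inter> X_event t y) =
      (\<integral>\<^sup>+ x. ennreal (exp (- t)) * (emeasure M (cell m k \<inter> X_event (grid m k) x) * trans_prob x (t - grid m k) y) \<partial>count_space UNIV)"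
      by (simp add: nn_integral_cmult)
    thus ?thesis using True by (simp add: mult_ac \<psi>_def)
  qed (simp add: \<psi>_def)
  have \<psi> [measurable]: "\<psi> k \<in> borel_measurable lborel" for k
    unfolding \<psi>_eq[abs_def] by (rule borel_measurable_nn_integral_count_space) measurable
  have "(\<integral>\<^sup>+ \<omega>. discounted y m \<omega> \<partial>M) =
    (\<Sum>k. \<integral>\<^sup>+ x. emeasure M (cell m k \<inter> X_event (grid m k) x) * (ennreal (exp (- grid m k)) * ennreal (res x y)) \<partial>count_space UNIV)"
    unfolding discounted_def
    by (simp add: nn_integral_suminf borel_measurable_nn_integral_count_space
      nn_integral_count_space_nn_integral nn_integral_multc)
  also have "\<dots> = (\<Sum>k. \<integral>\<^sup>+ t. \<psi> k t \<partial>lborel)"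
  proof (intro suminf_cong)
    fix k
    define g where "g = grid m k"
    have g: "g \<ge> 0" by (simp add: g_def grid_nonneg)
    note [measurable] = sets_X_event[OF g]
    have shift: "ennreal (exp (- g)) * ennreal (res x y) =
      (\<integral>\<^sup>+ t. (if g \<le> t then ennreal (exp (- t)) * trans_prob x (t - g) y else 0) \<partial>lborel)" for x
    proof -
      have "(\<integral>\<^sup>+ t. (if g \<le> t then ennreal (exp (- t)) * trans_prob x (t - g) y else 0) \<partial>lborel) =
        (\<integral>\<^sup>+ t. ennreal (exp (- g)) * (if 0 \<le> t then ennreal (exp (- t)) * trans_prob x t y else 0) \<partial>lborel)"
      proof (subst nn_integral_real_affine[where t = g and c = 1])
        have "ennreal (exp (- (g + t))) = ennreal (exp (- g)) * ennreal (exp (- t))" for t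
          by (simp add: ennreal_mult[symmetric] exp_add[symmetric])
        thus "ennreal \<bar>1\<bar> * (\<integral>\<^sup>+ t. (if g \<le> g + 1 * t then ennreal (exp (- (g + 1 * t))) * trans_prob x (g + 1 * t - g) y else 0) \<partial>lborel) =
          (\<integral>\<^sup>+ t. ennreal (exp (- g)) * (if 0 \<le> t then ennreal (exp (- t)) * trans_prob x t y else 0) \<partial>lborel)"
          by (auto intro!: nn_integral_cong simp: mult.assoc)
      qed auto
      also have "\<dots> = ennreal (exp (- g)) * laplace (\<lambda>t. trans_prob x t y)"
        unfolding laplace_def by (rule nn_integral_cmult) measurable
      finally show ?thesis by (simp add: laplace_trans)
    qed
    have "(\<integral>\<^sup>+ x. emeasure M (cell m k \<inter> X_event g x) * (ennreal (exp (- g)) * ennreal (res x y)) \<partial>count_space UNIV) =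
      (\<integral>\<^sup>+ x. \<integral>\<^sup>+ t. emeasure M (cell m k \<inter> X_event g x) * (if g \<le> t then ennreal (exp (- t)) * trans_prob x (t - g) y else 0) \<partial>lborel \<partial>count_space UNIV)"
      unfolding shift by (simp add: nn_integral_cmult)
    also have "\<dots> = (\<integral>\<^sup>+ t. \<integral>\<^sup>+ x. emeasure M (cell m k \<inter> X_event g x) * (if g \<le> t then ennreal (exp (- t)) * trans_prob x (t - g) y else 0) \<partial>count_space UNIV \<partial>lborel)"
      by (rule nn_integral_count_space_nn_integral[symmetric]) auto
    also have "\<dots> = (\<integral>\<^sup>+ t. \<psi> k t \<partial>lborel)"
      unfolding \<psi>_eq g_def ..
    finally show "(\<integral>\<^sup>+ x. emeasure M (cell m k \<inter> X_event (grid m k) x) * (ennreal (exp (- grid m k)) * ennreal (res x y)) \<partial>count_space UNIV) =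
      (\<integral>\<^sup>+ t. \<psi> k t \<partial>lborel)"
      by (simp only: g_def)
  qed
  also have "\<dots> = (\<integral>\<^sup>+ t. (\<Sum>k. \<psi> k t) \<partial>lborel)"
    by (rule nn_integral_suminf[symmetric]) measurable
  also have "\<dots> \<le> laplace (\<lambda>t. \<integral>\<^sup>+ x. ennreal (pmf \<mu>0 x) * trans_prob x t y \<partial>count_space UNIV)"
    unfolding laplace_def
  proof (rule nn_integral_mono)
    fix t :: real
    show "(\<Sum>k. \<psi> k t) \<le> (if 0 \<le> t then ennreal (exp (- t)) * (\<integral>\<^sup>+ x. ennreal (pmf \<mu>0 x) * trans_prob x t y \<partial>count_space UNIV) else 0)"
    proof (cases "0 \<le> t")
      case True
      note [measurable] = sets_X_event[OF True]
      \<comment> \<open>Once the restriction to times after the rounded one is dropped, the disjoint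
        cells together have at most the probability of being in \<open>y\<close> at
        \<open>t\<close>.\<close>
      have "(\<Sum>k. \<psi> k t) \<le> (\<Sum>k. ennreal (exp (- t)) * emeasure M (cell m k \<inter> X_event t y))"
        by (intro suminf_le) (auto simp: \<psi>_def)
      also have "\<dots> = ennreal (exp (- t)) * (\<Sum>k. emeasure M (cell m k \<inter> X_event t y))"
        by (rule ennreal_suminf_cmult)
      also have "(\<Sum>k. emeasure M (cell m k \<inter> X_event t y)) = emeasure M (\<Union>k. cell m k \<inter> X_event t y)"
        by (rule suminf_emeasure)
          (use disjoint_cell[of m] in \<open>auto simp: disjoint_family_on_def\<close>)
      also have "\<dots> \<le> emeasure M (X_event t y)"
        by (rule emeasure_mono) auto
      finally show ?thesis
        using True by (simp add: emeasure_X mult_left_mono)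
    next
      case False
      hence "\<psi> k t = 0" for k using grid_nonneg[of m k] by (auto simp: \<psi>_def)
      thus ?thesis by simp
    qed
  qed
  finally show ?thesis .
qed

text \<open>The rounded time is at most \<open>T + 1\<close>, so a fixed discount factor bounds
  those of all grids, while the state is eventually the one at \<open>T\<close>.\<close>

lemma le_liminf_discounted:
  assumes \<omega>: "\<omega> \<in> space M" and T: "T \<omega> < \<infinity>"
  shows "(\<integral>\<^sup>+ x. indicator (XT x) \<omega> * (ennreal (exp (- (enn2real (T \<omega>) + 1))) * ennreal (res x y)) \<partial>count_space UNIV)
     \<le> liminf (\<lambda>m. discounted y m \<omega>)"
proof -
  obtain r where r: "T \<omega> = ennreal r" "r \<ge> 0" using T by (cases "T \<omega>") auto
  have "(\<integral>\<^sup>+ x. indicator (XT x) \<omega> * (ennreal (exp (- (enn2real (T \<omega>) + 1))) * ennreal (res x y)) \<partial>count_space UNIV) =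
    (\<integral>\<^sup>+ x. ennreal (exp (- (r + 1))) * ennreal (res (X r \<omega>) y) * indicator {X r \<omega>} x \<partial>count_space UNIV)"
    using \<omega> r by (intro nn_integral_cong) (auto simp: XT_def split: split_indicator)
  also have "\<dots> = ennreal (exp (- (r + 1))) * ennreal (res (X r \<omega>) y)" by simp
  also have "\<dots> \<le> liminf (\<lambda>m. discounted y m \<omega>)"
  proof (rule Liminf_bounded)
    show "\<forall>\<^sub>F m in sequentially. ennreal (exp (- (r + 1))) * ennreal (res (X r \<omega>) y) \<le> discounted y m \<omega>"
      using eventually_cell_state[OF \<omega> r]
    proof eventually_elim
      case (elim m)
      then obtain k where k: "\<omega> \<in> cell m k" "X (grid m k) \<omega> = X r \<omega>" "grid m k \<le> r + 1" by blast
      have "ennreal (exp (- (r + 1))) * ennreal (res (X r \<omega>) y) \<le> ennreal (exp (- grid m k)) * ennreal (res (X r \<omega>) y)"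
        using k(3) by (intro mult_right_mono ennreal_leI) auto
      also have "\<dots> = (\<integral>\<^sup>+ x. ennreal (exp (- grid m k)) * ennreal (res (X r \<omega>) y) * indicator {X r \<omega>} x \<partial>count_space UNIV)"
        by simp
      also have "\<dots> = (\<integral>\<^sup>+ x. indicator (cell m k \<inter> X_event (grid m k) x) \<omega> *
          (ennreal (exp (- grid m k)) * ennreal (res x y)) \<partial>count_space UNIV)"
        using k \<omega> by (intro nn_integral_cong) (auto simp: X_event_def split: split_indicator)
      also have "\<dots> \<le> discounted y m \<omega>"
        unfolding discounted_def
        using sum_le_suminf[of "\<lambda>k. \<integral>\<^sup>+ x. indicator (cell m k \<inter> X_event (grid m k) x) \<omega> *
          (ennreal (exp (- grid m k)) * ennreal (res x y)) \<partial>count_space UNIV" "{k}"] by simp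
      finally show ?case .
    qed
  qed
  finally show ?thesis .
qed

text \<open>The conditional probability given \<open>T\<close> is a constant, so the state at
  \<open>T\<close> has law \<open>\<mu>\<close> and is independent of \<open>T\<close>; this is
  tested here against bounded functions of \<open>T\<close>.\<close>

lemma strong_stationary_integral:
  assumes sst: "\<And>x. AE \<omega> in M. T \<omega> < \<infinity> \<longrightarrow>
        real_cond_exp M (vimage_algebra (space M) T borel)
          (indicator {\<omega> \<in> space M. X (enn2real (T \<omega>)) \<omega> = x}) \<omega> = pmf \<mu> x"
    and fin: "AE \<omega> in M. T \<omega> < \<infinity>"
    and f [measurable]: "f \<in> borel_measurable borel" and f_bounds: "\<And>t. 0 \<le> f t" "\<And>t. f t \<le> 1"
  shows "(\<integral>\<^sup>+ \<omega>. indicator (XT x) \<omega> * ennreal (f (enn2real (T \<omega>))) \<partial>M) =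
     ennreal (pmf \<mu> x) * (\<integral>\<^sup>+ \<omega>. ennreal (f (enn2real (T \<omega>))) \<partial>M)"
proof -
  define F where "F = vimage_algebra (space M) T borel"
  have F: "subalgebra M F"
    unfolding subalgebra_def F_def
  proof
    show "sets (vimage_algebra (space M) T borel) \<subseteq> sets M"
      by (auto simp: sets_vimage_algebra2)
  qed simp
  interpret finite_measure_subalgebra M F by unfold_locales (rule F)
  have [measurable]: "T \<in> borel_measurable F"
    unfolding F_def by (rule measurable_vimage_algebra1) auto
  have fF: "(\<lambda>\<omega>. f (enn2real (T \<omega>))) \<in> borel_measurable F" by measurable
  have int: "integrable M (\<lambda>\<omega>. f (enn2real (T \<omega>)))"
    by (rule integrable_const_bound[where B = 1]) (use f_bounds in auto)
  have int': "integrable M (\<lambda>\<omega>. f (enn2real (T \<omega>)) * indicator (XT x) \<omega>)"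
    by (rule integrable_const_bound[where B = 1]) (use f_bounds in \<open>auto split: split_indicator\<close>)
  have "(\<integral>\<omega>. f (enn2real (T \<omega>)) * indicator (XT x) \<omega> \<partial>M) =
     (\<integral>\<omega>. f (enn2real (T \<omega>)) * real_cond_exp M F (indicator (XT x)) \<omega> \<partial>M)"
    by (rule real_cond_exp_intg(2)[symmetric, OF int' fF]) measurable
  also have "\<dots> = (\<integral>\<omega>. f (enn2real (T \<omega>)) * pmf \<mu> x \<partial>M)"
  proof (rule integral_cong_AE)
    show "AE \<omega> in M. f (enn2real (T \<omega>)) * real_cond_exp M F (indicator (XT x)) \<omega> = f (enn2real (T \<omega>)) * pmf \<mu> x"
      using sst[of x] fin unfolding F_def[symmetric] XT_def[symmetric] by eventually_elim simp
  qed measurable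
  also have "\<dots> = pmf \<mu> x * (\<integral>\<omega>. f (enn2real (T \<omega>)) \<partial>M)"
    by simp
  finally have eq: "(\<integral>\<omega>. f (enn2real (T \<omega>)) * indicator (XT x) \<omega> \<partial>M) = pmf \<mu> x * (\<integral>\<omega>. f (enn2real (T \<omega>)) \<partial>M)" .
  have "(\<integral>\<^sup>+ \<omega>. indicator (XT x) \<omega> * ennreal (f (enn2real (T \<omega>))) \<partial>M) =
      (\<integral>\<^sup>+ \<omega>. ennreal (f (enn2real (T \<omega>)) * indicator (XT x) \<omega>) \<partial>M)"
    by (intro nn_integral_cong) (auto split: split_indicator)
  also have "\<dots> = ennreal (\<integral>\<omega>. f (enn2real (T \<omega>)) * indicator (XT x) \<omega> \<partial>M)"
    by (rule nn_integral_eq_integral[OF int']) (use f_bounds in auto)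
  also have "\<dots> = ennreal (pmf \<mu> x) * ennreal (\<integral>\<omega>. f (enn2real (T \<omega>)) \<partial>M)"
    unfolding eq by (rule ennreal_mult') simp
  also have "ennreal (\<integral>\<omega>. f (enn2real (T \<omega>)) \<partial>M) = (\<integral>\<^sup>+ \<omega>. ennreal (f (enn2real (T \<omega>))) \<partial>M)"
    by (rule nn_integral_eq_integral[symmetric, OF int]) (use f_bounds in auto)
  finally show ?thesis .
qed

text \<open>The constant is the mean of \<open>exp (- (T + 1))\<close>. As the state at
  \<open>T\<close> is independent of \<open>T\<close>, stationarity of \<open>\<mu>\<close> under
  \<open>res\<close> evaluates the discounted resolvent from time \<open>T\<close> on; Fatou over
  the grids bounds it by the resolvent from \<open>z\<close>.\<close>

lemma resolvent_lower_bound: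
  assumes sst: "\<And>x. AE \<omega> in M. T \<omega> < \<infinity> \<longrightarrow>
        real_cond_exp M (vimage_algebra (space M) T borel)
          (indicator {\<omega> \<in> space M. X (enn2real (T \<omega>)) \<omega> = x}) \<omega> = pmf \<mu> x"
    and fin: "AE \<omega> in M. T \<omega> < \<infinity>"
    and stat: "\<And>y. (\<integral>\<^sup>+ x. ennreal (pmf \<mu> x) * ennreal (res x y) \<partial>count_space UNIV) = ennreal (pmf \<mu> y)"
    and start: "\<mu>0 = return_pmf z"
  shows "\<exists>c>0. \<forall>y. c * pmf \<mu> y \<le> res z y"
proof -
  \<comment> \<open>The \<open>max 0\<close> keeps \<open>f\<close> at most 1 on all reals; at
    values of \<open>T\<close> it has no effect.\<close>
  define f where "f t = exp (- (max 0 t + 1))" for t :: real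
  have f [measurable]: "f \<in> borel_measurable borel" unfolding f_def by measurable
  have f_bounds: "0 \<le> f t" "f t \<le> 1" for t by (simp_all add: f_def)
  define c where "c = (\<integral>\<^sup>+ \<omega>. ennreal (f (enn2real (T \<omega>))) \<partial>M)"
  have "c \<noteq> 0"
  proof
    assume "c = 0"
    hence "AE \<omega> in M. ennreal (f (enn2real (T \<omega>))) = 0"
      unfolding c_def by (subst (asm) nn_integral_0_iff_AE) auto
    hence "AE \<omega> in M. False" by eventually_elim (simp add: f_def)
    thus False by (simp add: AE_False)
  qed
  moreover have "c \<le> 1"
  proof -
    have "c \<le> (\<integral>\<^sup>+ \<omega>. 1 \<partial>M)" unfolding c_def
      by (intro nn_integral_mono) (simp add: f_bounds)
    thus ?thesis by (simp add: emeasure_space_1)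
  qed
  ultimately obtain d where d: "c = ennreal d" "d > 0"
    by (cases c) (auto simp: top_unique)
  have "d * pmf \<mu> y \<le> res z y" for y
  proof -
    define u where "u \<omega> = (\<integral>\<^sup>+ x. indicator (XT x) \<omega> * (ennreal (f (enn2real (T \<omega>))) * ennreal (res x y)) \<partial>count_space UNIV)" for \<omega>
    have "(\<integral>\<^sup>+ \<omega>. u \<omega> \<partial>M) = (\<integral>\<^sup>+ x. \<integral>\<^sup>+ \<omega>. indicator (XT x) \<omega> * (ennreal (f (enn2real (T \<omega>))) * ennreal (res x y)) \<partial>M \<partial>count_space UNIV)"
      unfolding u_def by (rule nn_integral_count_space_nn_integral) auto
    also have "\<dots> = (\<integral>\<^sup>+ x. c * (ennreal (pmf \<mu> x) * ennreal (res x y)) \<partial>count_space UNIV)"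
    proof (intro nn_integral_cong)
      fix x
      have "(\<integral>\<^sup>+ \<omega>. indicator (XT x) \<omega> * (ennreal (f (enn2real (T \<omega>))) * ennreal (res x y)) \<partial>M) =
        (\<integral>\<^sup>+ \<omega>. indicator (XT x) \<omega> * ennreal (f (enn2real (T \<omega>))) \<partial>M) * ennreal (res x y)"
        by (subst nn_integral_multc[symmetric]) (auto simp: mult.assoc)
      thus "(\<integral>\<^sup>+ \<omega>. indicator (XT x) \<omega> * (ennreal (f (enn2real (T \<omega>))) * ennreal (res x y)) \<partial>M) =
        c * (ennreal (pmf \<mu> x) * ennreal (res x y))"
        using strong_stationary_integral[OF sst fin f f_bounds, of x] by (simp add: c_def mult_ac)
    qed
    also have "\<dots> = c * ennreal (pmf \<mu> y)"
      by (subst nn_integral_cmult) (auto simp: stat)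
    finally have "c * ennreal (pmf \<mu> y) = (\<integral>\<^sup>+ \<omega>. u \<omega> \<partial>M)" ..
    also have "\<dots> \<le> (\<integral>\<^sup>+ \<omega>. liminf (\<lambda>m. discounted y m \<omega>) \<partial>M)"
    proof (rule nn_integral_mono_AE)
      show "AE \<omega> in M. u \<omega> \<le> liminf (\<lambda>m. discounted y m \<omega>)"
        using fin AE_space
        by eventually_elim (use le_liminf_discounted[of _ y] in \<open>simp add: u_def f_def\<close>)
    qed
    also have "\<dots> \<le> liminf (\<lambda>m. \<integral>\<^sup>+ \<omega>. discounted y m \<omega> \<partial>M)"
    proof (rule nn_integral_liminf)
      note [measurable] = sets_X_event[OF grid_nonneg]
      have [measurable]: "(\<lambda>\<omega>. \<integral>\<^sup>+ x. indicator (cell m k \<inter> X_event (grid m k) x) \<omega> *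
        (ennreal (exp (- grid m k)) * ennreal (res x y)) \<partial>count_space UNIV) \<in> borel_measurable M" for m k
        by (rule borel_measurable_nn_integral_count_space) measurable
      show "discounted y m \<in> borel_measurable M" for m
        unfolding discounted_def by measurable
    qed
    also have "\<dots> \<le> liminf (\<lambda>m::nat. laplace (\<lambda>t. \<integral>\<^sup>+ x. ennreal (pmf \<mu>0 x) * trans_prob x t y \<partial>count_space UNIV))"
      by (intro Liminf_mono always_eventually allI discounted_le_laplace)
    also have "\<dots> = laplace (\<lambda>t. \<integral>\<^sup>+ x. ennreal (pmf \<mu>0 x) * trans_prob x t y \<partial>count_space UNIV)"
      by (simp add: Liminf_const)
    also have "(\<lambda>t. \<integral>\<^sup>+ x. ennreal (pmf \<mu>0 x) * trans_prob x t y \<partial>count_space UNIV) = (\<lambda>t. trans_prob z t y)"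
    proof
      fix t
      have "(\<integral>\<^sup>+ x. ennreal (pmf \<mu>0 x) * trans_prob x t y \<partial>count_space UNIV) = (\<integral>\<^sup>+ x. trans_prob z t y * indicator {z} x \<partial>count_space UNIV)"
        unfolding start by (intro nn_integral_cong) (auto split: split_indicator)
      thus "(\<integral>\<^sup>+ x. ennreal (pmf \<mu>0 x) * trans_prob x t y \<partial>count_space UNIV) = trans_prob z t y" by simp
    qed
    finally have "ennreal (d * pmf \<mu> y) \<le> ennreal (res z y)"
      using d by (simp add: laplace_trans ennreal_mult)
    thus ?thesis by (simp add: res_nonneg)
  qed
  thus ?thesis using d(2) by blast
qed

end

section \<open>From a resolvent bound to strong stationary times\<close>

context embedded_generator
begin

text \<open>The part of the transform up to \<open>\<tau>\<close> is at most \<open>V\<close>, and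
  the part beyond is at most \<open>b * exp (- \<tau>)\<close>, which is at most half of the lower
  bound \<open>a\<close>.\<close>

lemma laplace_le_bound:
  assumes [measurable]: "f \<in> borel_measurable borel"
    and b: "\<And>t. t \<ge> 0 \<Longrightarrow> f t \<le> ennreal b" "b \<ge> 0"
    and V: "\<And>t. 0 \<le> t \<Longrightarrow> t \<le> \<tau> \<Longrightarrow> f t \<le> V" and \<tau>: "\<tau> \<ge> 0"
    and a: "ennreal a \<le> laplace f" and tail: "b * exp (- \<tau>) \<le> a / 2"
  shows "ennreal (a / 2) \<le> V"
proof -
  have "ennreal a \<le> laplace f" by (rule a)
  also have "\<dots> \<le> (\<integral>\<^sup>+ t. (if 0 \<le> t then ennreal (exp (- 1 * t)) else 0) * V +
      (if \<tau> \<le> t then ennreal (exp (- 1 * t)) else 0) * ennreal b \<partial>lborel)"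
    unfolding laplace_def
  proof (rule nn_integral_mono)
    fix t :: real
    show "(if 0 \<le> t then ennreal (exp (- t)) * f t else 0) \<le>
       (if 0 \<le> t then ennreal (exp (- 1 * t)) else 0) * V + (if \<tau> \<le> t then ennreal (exp (- 1 * t)) else 0) * ennreal b"
      using V[of t] b(1)[of t] \<tau>
      by (cases "t \<le> \<tau>") (auto intro!: mult_left_mono add_increasing2 add_increasing)
  qed
  also have "\<dots> = (\<integral>\<^sup>+ t. (if 0 \<le> t then ennreal (exp (- 1 * t)) else 0) \<partial>lborel) * V +
      (\<integral>\<^sup>+ t. (if \<tau> \<le> t then ennreal (exp (- 1 * t)) else 0) \<partial>lborel) * ennreal b"
    by (simp add: nn_integral_add nn_integral_multc)
  also have "\<dots> = V + ennreal (b * exp (- \<tau>))"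
    using nn_integral_exp_tail[of 1 0] nn_integral_exp_tail[of 1 \<tau>] b(2)
    by (simp add: ennreal_mult mult.commute)
  also have "\<dots> \<le> V + ennreal (a / 2)"
    using tail by (intro add_left_mono ennreal_leI)
  finally have *: "ennreal a \<le> V + ennreal (a / 2)" .
  have a0: "a / 2 \<ge> 0" using tail b(2) by (smt (verit) exp_ge_zero mult_nonneg_nonneg)
  show ?thesis
  proof (cases V)
    case (real v)
    hence "ennreal a \<le> ennreal (v + a / 2)" using * a0 by (simp add: ennreal_plus)
    hence "a \<le> v + a / 2" using real a0 by (subst (asm) ennreal_le_iff) auto
    thus ?thesis using real by (auto intro: ennreal_leI)
  qed auto
qed

text \<open>A passage from \<open>x\<close> to \<open>z\<close> in time \<open>\<tau>\<close> is
  followed by one from \<open>z\<close> to \<open>y\<close> in time \<open>\<tau>\<close>. Each is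
  bounded below through the resolvent, at the price of a factor for waiting at
  \<open>z\<close>.\<close>

lemma doeblin_minorization:
  assumes c: "c > 0" "\<And>y. c * pmf \<mu> y \<le> res z y"
  obtains h \<epsilon> where "h > 0" "0 < \<epsilon>" "\<epsilon> < 1" "\<And>x y. ennreal (\<epsilon> * pmf \<mu> y) \<le> trans_prob x h y"
proof -
  define m where "m = pmf \<mu> z"
  have m: "m > 0" by (simp add: m_def mu_pos)
  \<comment> \<open>Large enough that times beyond \<open>\<tau>\<close> account for at most half of
    either resolvent bound.\<close>
  define \<tau> where "\<tau> = max 1 (- ln (c * m / 2))"
  have \<tau>: "\<tau> > 0" by (simp add: \<tau>_def)
  have e: "exp (- \<tau>) \<le> c * m / 2"
  proof -
    have "exp (- \<tau>) \<le> exp (ln (c * m / 2))" by (simp add: \<tau>_def)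
    also have "\<dots> = c * m / 2" using c m by (intro exp_ln) simp
    finally show ?thesis .
  qed
  \<comment> \<open>\<open>1 / \<kappa>\<close> is the probability of no jump from \<open>z\<close>
    during \<open>\<tau>\<close>, hence a lower bound for being at \<open>z\<close> at any time up
    to \<open>\<tau>\<close>.\<close>
  define \<kappa> where "\<kappa> = exp (rate z * \<tau>)"
  have \<kappa>: "\<kappa> > 0" by (simp add: \<kappa>_def)
  have stay: "ennreal (1 / \<kappa>) \<le> trans_prob z t z" if "0 \<le> t" "t \<le> \<tau>" for t
  proof -
    have "1 / \<kappa> = exp (- rate z * \<tau>)" by (simp add: \<kappa>_def exp_minus inverse_eq_divide)
    also have "\<dots> \<le> exp (- rate z * t)" using that rate_nonneg[of z] by (simp add: mult_left_mono)
    finally show ?thesis using trans_self_ge[of z t] by (meson ennreal_leI order.trans)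
  qed
  have scale: "ennreal (a / \<kappa>) \<le> W" if "ennreal a \<le> ennreal \<kappa> * W" "a \<ge> 0" for a W
  proof -
    have "ennreal (1 / \<kappa>) * ennreal a \<le> ennreal (1 / \<kappa>) * (ennreal \<kappa> * W)"
      using that(1) by (rule mult_left_mono) simp
    also have "\<dots> = W" using \<kappa> by (simp add: mult.assoc[symmetric] ennreal_mult[symmetric])
    finally show ?thesis using that(2) \<kappa> by (simp add: ennreal_mult[symmetric])
  qed
  have up: "W \<le> ennreal \<kappa> * V" if "ennreal (1 / \<kappa>) * W \<le> V" for W V
  proof -
    have "ennreal \<kappa> * (ennreal (1 / \<kappa>) * W) \<le> ennreal \<kappa> * V"
      using that by (rule mult_left_mono) simp
    thus ?thesis using \<kappa> by (simp add: mult.assoc[symmetric] ennreal_mult[symmetric])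
  qed
  have from_z: "ennreal (c * pmf \<mu> y / 2 / \<kappa>) \<le> trans_prob z \<tau> y" for y
  proof (rule scale)
    show "ennreal (c * pmf \<mu> y / 2) \<le> ennreal \<kappa> * trans_prob z \<tau> y"
    proof (rule laplace_le_bound)
      show "(\<lambda>t. trans_prob z t y) \<in> borel_measurable borel" by simp
      \<comment> \<open>The trivial bound 1 would not do: the tail has to be small relative to
        \<open>pmf \<mu> y\<close>, uniformly in \<open>y\<close>.\<close>
      show "trans_prob z t y \<le> ennreal (pmf \<mu> y / m)" if "t \<ge> 0" for t
        unfolding m_def by (rule trans_le[OF that])
      show "pmf \<mu> y / m \<ge> 0" using m by simp
      show "trans_prob z t y \<le> ennreal \<kappa> * trans_prob z \<tau> y" if t: "0 \<le> t" "t \<le> \<tau>" for t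
      proof (rule up)
        \<comment> \<open>Here the waiting at \<open>z\<close> comes before the passage to
          \<open>y\<close>; in the bound towards \<open>z\<close> it comes after the
          arrival.\<close>
        have "ennreal (1 / \<kappa>) * trans_prob z t y \<le> trans_prob z (\<tau> - t) z * trans_prob z t y"
          using stay[of "\<tau> - t"] t by (intro mult_right_mono) auto
        also have "\<dots> \<le> trans_prob z \<tau> y"
          using trans_superadditive[of "\<tau> - t" t z z y] t by simp
        finally show "ennreal (1 / \<kappa>) * trans_prob z t y \<le> trans_prob z \<tau> y" .
      qed
      show "\<tau> \<ge> 0" using \<tau> by simp
      show "ennreal (c * pmf \<mu> y) \<le> laplace (\<lambda>t. trans_prob z t y)"
        using c(2)[of y] by (simp add: laplace_trans ennreal_leI)
      have "pmf \<mu> y / m * exp (- \<tau>) \<le> pmf \<mu> y / m * (c * m / 2)"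
        using e m by (intro mult_left_mono) auto
      thus "pmf \<mu> y / m * exp (- \<tau>) \<le> c * pmf \<mu> y / 2" using m by (simp add: mult.commute[of c])
    qed
  qed (use c in simp)
  have to_z: "ennreal (c * m / 2 / \<kappa>) \<le> trans_prob x \<tau> z" for x
  proof (rule scale)
    show "ennreal (c * m / 2) \<le> ennreal \<kappa> * trans_prob x \<tau> z"
    proof (rule laplace_le_bound)
      show "(\<lambda>t. trans_prob x t z) \<in> borel_measurable borel" by simp
      show "trans_prob x t z \<le> ennreal 1" if "t \<ge> 0" for t
        using trans_le_1[OF that] by simp
      show "trans_prob x t z \<le> ennreal \<kappa> * trans_prob x \<tau> z" if t: "0 \<le> t" "t \<le> \<tau>" for t
      proof (rule up)
        have "ennreal (1 / \<kappa>) * trans_prob x t z \<le> trans_prob z (\<tau> - t) z * trans_prob x t z"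
          using stay[of "\<tau> - t"] t by (intro mult_right_mono) auto
        also have "\<dots> \<le> trans_prob x \<tau> z"
          using trans_superadditive[of t "\<tau> - t" x z z] t by (simp add: mult.commute)
        finally show "ennreal (1 / \<kappa>) * trans_prob x t z \<le> trans_prob x \<tau> z" .
      qed
      show "\<tau> \<ge> 0" using \<tau> by simp
      \<comment> \<open>The bound \<open>c * pmf \<mu> x \<le> res z x\<close>, read backwards by
        symmetry, no longer depends on \<open>x\<close>.\<close>
      have "c * m * pmf \<mu> x \<le> res x z * pmf \<mu> x"
        using mult_right_mono[OF c(2)[of x], of m] m res_sym[of z x] by (simp add: m_def mult_ac)
      hence "c * m \<le> res x z" using mu_pos[of x] by simp
      thus "ennreal (c * m) \<le> laplace (\<lambda>t. trans_prob x t z)" by (simp add: laplace_trans ennreal_leI)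
      show "1 * exp (- \<tau>) \<le> c * m / 2" using e by simp
    qed simp
  qed (use c m in simp)
  \<comment> \<open>The product of the two passage bounds with \<open>pmf \<mu> y\<close> split off;
    the minimum with \<open>1/2\<close> ensures \<open>\<epsilon> < 1\<close>.\<close>
  define \<epsilon> where "\<epsilon> = min (1/2) (c * m / 2 / \<kappa> * (c / 2 / \<kappa>))"
  show ?thesis
  proof (rule that[of "2 * \<tau>" \<epsilon>])
    show "2 * \<tau> > 0" using \<tau> by simp
    show "\<epsilon> > 0" using c m \<kappa> by (simp add: \<epsilon>_def)
    show "\<epsilon> < 1" by (simp add: \<epsilon>_def)
    show "ennreal (\<epsilon> * pmf \<mu> y) \<le> trans_prob x (2 * \<tau>) y" for x y
    proof -
      have "ennreal (\<epsilon> * pmf \<mu> y) \<le> ennreal (c * m / 2 / \<kappa> * (c / 2 / \<kappa>) * pmf \<mu> y)"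
        by (intro ennreal_leI mult_right_mono) (auto simp: \<epsilon>_def)
      also have "\<dots> = ennreal (c * m / 2 / \<kappa>) * ennreal (c * pmf \<mu> y / 2 / \<kappa>)"
        using c m \<kappa> by (subst ennreal_mult[symmetric]) (auto simp: mult_ac)
      also have "\<dots> \<le> trans_prob x \<tau> z * trans_prob z \<tau> y"
        by (intro mult_mono to_z from_z) auto
      also have "\<dots> \<le> trans_prob x (2 * \<tau>) y"
        using trans_superadditive[of \<tau> \<tau> x z y] \<tau> by simp
      finally show ?thesis .
    qed
  qed
qed

end

context jump_process
begin

section \<open>The Markov property for functions of the past\<close>

lemma nn_integral_markov:
  assumes s: "s \<ge> 0" and t: "t \<ge> 0" and f: "f \<in> borel_measurable (past s)"
  shows "(\<integral>\<^sup>+ \<omega>. indicator (X_event s x \<inter> X_event (s + t) y) \<omega> * f \<omega> \<partial>M) =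
    trans_prob x t y * (\<integral>\<^sup>+ \<omega>. indicator (X_event s x) \<omega> * f \<omega> \<partial>M)"
proof -
  have [measurable]: "X_event s x \<in> sets M" "X_event (s + t) y \<in> sets M"
    using s t sets_X_event by auto
  have id: "(\<lambda>\<omega>. \<omega>) \<in> measurable M (past s)"
    using sets_filtration_M by (auto simp: measurable_def)
  define N1 where "N1 = weighted_image 1 (X_event s x \<inter> X_event (s + t) y) M (past s) (\<lambda>\<omega>. \<omega>)"
  define N2 where "N2 = weighted_image (trans_prob x t y) (X_event s x) M (past s) (\<lambda>\<omega>. \<omega>)"
  have "N1 = N2"
  proof (rule measure_eqI)
    fix A assume "A \<in> sets N1"
    hence A: "A \<in> sets (past s)" by (simp add: N1_def)
    hence "A \<inter> space M = A" using sets_filtration_M sets.sets_into_space by blast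
    thus "emeasure N1 A = emeasure N2 A"
      using markov_past[OF s t A, of x y] A
      by (simp add: N1_def N2_def emeasure_weighted_image[OF id] Int_commute mult.commute)
  qed (simp add: N1_def N2_def)
  hence "(\<integral>\<^sup>+ \<omega>. f \<omega> \<partial>N1) = (\<integral>\<^sup>+ \<omega>. f \<omega> \<partial>N2)" by simp
  thus ?thesis
    using f by (simp add: N1_def N2_def nn_integral_weighted_image[OF id])
qed

lemma nn_integral_X_event_split:
  assumes t: "t \<ge> 0" and [measurable]: "f \<in> borel_measurable M"
  shows "(\<integral>\<^sup>+ x. \<integral>\<^sup>+ \<omega>. indicator (X_event t x) \<omega> * f \<omega> \<partial>M \<partial>count_space UNIV) = (\<integral>\<^sup>+ \<omega>. f \<omega> \<partial>M)"
proof -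
  note [measurable] = sets_X_event[OF t]
  have "(\<integral>\<^sup>+ x. \<integral>\<^sup>+ \<omega>. indicator (X_event t x) \<omega> * f \<omega> \<partial>M \<partial>count_space UNIV) =
     (\<integral>\<^sup>+ \<omega>. \<integral>\<^sup>+ x. indicator (X_event t x) \<omega> * f \<omega> \<partial>count_space UNIV \<partial>M)"
    by (rule nn_integral_count_space_nn_integral[symmetric]) auto
  also have "\<dots> = (\<integral>\<^sup>+ \<omega>. f \<omega> \<partial>M)"
  proof (rule nn_integral_cong)
    fix \<omega> assume \<omega>: "\<omega> \<in> space M"
    have "(\<integral>\<^sup>+ x. indicator (X_event t x) \<omega> * f \<omega> \<partial>count_space UNIV) =
      (\<integral>\<^sup>+ x. f \<omega> * indicator {X t \<omega>} x \<partial>count_space UNIV)"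
      using \<omega> by (intro nn_integral_cong) (auto simp: X_event_def split: split_indicator)
    thus "(\<integral>\<^sup>+ x. indicator (X_event t x) \<omega> * f \<omega> \<partial>count_space UNIV) = f \<omega>" by simp
  qed
  finally show ?thesis .
qed

lemma measurable_X_past:
  assumes "0 \<le> r" "ennreal r \<le> s"
  shows "X r \<in> measurable (natural_filtration M X s) (count_space UNIV)"
proof (rule measurable_count_space_eq2_countable[THEN iffD2], intro conjI ballI)
  fix a
  have "X r -` {a} \<inter> space (natural_filtration M X s) = X_event r a"
    by (auto simp: X_event_def)
  thus "X r -` {a} \<inter> space (natural_filtration M X s) \<in> sets (natural_filtration M X s)"
    using X_event_in_filtration[OF assms] by simp
qed auto

end

text \<open>The chain observed at the multiples of \<open>h\<close> is stopped with conditional probability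
  \<open>\<epsilon> * \<mu> y / P\<^sub>h(x, y)\<close> at each step from \<open>x\<close> to \<open>y\<close>, so that on stopping the state has law \<open>\<mu>\<close>.
  \<open>survival k\<close> is the conditional probability, given the path, of not having stopped up to step \<open>k\<close>.\<close>

locale minorized_process = jump_process L \<mu> M \<mu>0 Y H X
  for L :: "'a::countable \<Rightarrow> 'a \<Rightarrow> real" and \<mu> :: "'a pmf"
    and M :: "'w measure" and \<mu>0 :: "'a pmf"
    and Y :: "nat \<Rightarrow> 'w \<Rightarrow> 'a" and H :: "nat \<Rightarrow> 'w \<Rightarrow> ennreal"
    and X :: "real \<Rightarrow> 'w \<Rightarrow> 'a" +
  fixes h \<epsilon> :: real
  assumes h: "h > 0" and eps: "0 < \<epsilon>" "\<epsilon> < 1"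
    and minorization: "ennreal (\<epsilon> * pmf \<mu> y) \<le> trans_prob x h y"
    and trans_le_1: "trans_prob x h y \<le> 1"
begin

definition time :: "nat \<Rightarrow> real" where
  "time k = real k * h"

definition accept :: "'a \<Rightarrow> 'a \<Rightarrow> real" where
  "accept x y = \<epsilon> * pmf \<mu> y / enn2real (trans_prob x h y)"

definition survival :: "nat \<Rightarrow> 'w \<Rightarrow> real" where
  "survival k \<omega> = (\<Prod>j<k. 1 - accept (X (time j) \<omega>) (X (time (Suc j)) \<omega>))"

lemma time_nonneg: "time k \<ge> 0" and time_mono: "j \<le> k \<Longrightarrow> time j \<le> time k"
  and time_Suc: "time (Suc k) = time k + h" and time_inj: "time j = time k \<longleftrightarrow> j = k"
  using h by (auto simp: time_def mult_right_mono algebra_simps)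

lemma trans_h_real: "trans_prob x h y = ennreal (enn2real (trans_prob x h y))"
  using le_less_trans[OF trans_le_1[of x y] ennreal_one_less_top] by simp

lemma accept_mult_trans: "ennreal (accept x y) * trans_prob x h y = ennreal (\<epsilon> * pmf \<mu> y)"
  and accept_bounds: "0 \<le> accept x y" "accept x y \<le> 1"
proof -
  define p where "p = enn2real (trans_prob x h y)"
  have p: "trans_prob x h y = ennreal p" unfolding p_def by (rule trans_h_real)
  \<comment> \<open>The minorization is exactly what makes the acceptance ratio a
    probability.\<close>
  have le: "\<epsilon> * pmf \<mu> y \<le> p"
    using minorization[of y x] unfolding p by (subst (asm) ennreal_le_iff) (auto simp: p_def)
  have "\<epsilon> * pmf \<mu> y > 0" using eps mu_pos[of y] by simp
  hence p0: "p > 0" using le by linarith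
  show "0 \<le> accept x y" "accept x y \<le> 1"
    using le p0 eps by (auto simp: accept_def p_def[symmetric])
  have "accept x y * p = \<epsilon> * pmf \<mu> y" using p0 by (simp add: accept_def p_def[symmetric])
  thus "ennreal (accept x y) * trans_prob x h y = ennreal (\<epsilon> * pmf \<mu> y)"
    unfolding p using p0 \<open>0 \<le> accept x y\<close> by (simp add: ennreal_mult[symmetric])
qed

lemma survival_bounds: "0 \<le> survival k \<omega>" "survival k \<omega> \<le> 1"
  unfolding survival_def using accept_bounds by (auto intro!: prod_nonneg prod_le_1)

lemma survival_0: "survival 0 \<omega> = 1"
  by (simp add: survival_def)

lemma survival_Suc: "survival (Suc k) \<omega> = survival k \<omega> * (1 - accept (X (time k) \<omega>) (X (time (Suc k)) \<omega>))"
  by (simp add: survival_def)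

lemma survival_decreasing: "j \<le> k \<Longrightarrow> survival k \<omega> \<le> survival j \<omega>"
proof (induction k rule: dec_induct)
  case (step k)
  have "survival (Suc k) \<omega> \<le> survival k \<omega> * 1"
    unfolding survival_Suc using accept_bounds survival_bounds by (intro mult_left_mono) auto
  thus ?case using step by simp
qed simp

lemma measurable_survival_if:
  assumes "\<And>j. j \<le> k \<Longrightarrow> (\<lambda>\<omega>. X (time j) (g \<omega>)) \<in> measurable N (count_space UNIV)"
  shows "(\<lambda>\<omega>. survival k (g \<omega>)) \<in> borel_measurable N"
proof -
  have "(\<lambda>\<omega>. accept (X (time j) (g \<omega>)) (X (time (Suc j)) (g \<omega>))) \<in> borel_measurable N" if "j < k" for j
  proof -
    have 1: "(\<lambda>\<omega>. X (time j) (g \<omega>)) \<in> measurable N (count_space UNIV)"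
      and 2: "(\<lambda>\<omega>. X (time (Suc j)) (g \<omega>)) \<in> measurable N (count_space UNIV)"
      using that by (intro assms; simp)+
    have "(\<lambda>\<omega>. accept x (X (time (Suc j)) (g \<omega>))) \<in> borel_measurable N" for x
      by (rule measurable_compose[OF 2]) simp
    from measurable_compose_countable[OF this 1] show ?thesis .
  qed
  thus ?thesis unfolding survival_def by (intro borel_measurable_prod borel_measurable_diff) auto
qed

lemma measurable_survival_past: "survival k \<in> borel_measurable (past (time k))"
  using measurable_survival_if[of k "\<lambda>\<omega>. \<omega>" "past (time k)"] measurable_X_past
  by (simp add: time_nonneg time_mono ennreal_leI)

lemma measurable_survival [measurable]: "survival k \<in> borel_measurable M"
  using measurable_survival_if[of k "\<lambda>\<omega>. \<omega>" M] measurable_X by (simp add: time_nonneg)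

definition mean_survival :: "nat \<Rightarrow> ennreal" where
  "mean_survival k = (\<integral>\<^sup>+ \<omega>. ennreal (survival k \<omega>) \<partial>M)"

text \<open>The survival so far depends only on the past of \<open>time k\<close>, so the Markov
  property produces a factor \<open>trans_prob x h y\<close>. The acceptance ratio cancels it, and
  the result depends on \<open>y\<close> only through \<open>pmf \<mu> y\<close>.\<close>

lemma stop_at_state:
  "(\<integral>\<^sup>+ \<omega>. indicator (X_event (time (Suc k)) y) \<omega> * ennreal (survival k \<omega> - survival (Suc k) \<omega>) \<partial>M) =
   ennreal (pmf \<mu> y) * (ennreal \<epsilon> * mean_survival k)"
proof -
  note [measurable] = sets_X_event[OF time_nonneg]
  have "(\<integral>\<^sup>+ \<omega>. indicator (X_event (time (Suc k)) y) \<omega> * ennreal (survival k \<omega> - survival (Suc k) \<omega>) \<partial>M) =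
    (\<integral>\<^sup>+ \<omega>. \<integral>\<^sup>+ x. ennreal (accept x y) * (indicator (X_event (time k) x \<inter> X_event (time k + h) y) \<omega> * ennreal (survival k \<omega>)) \<partial>count_space UNIV \<partial>M)"
  proof (rule nn_integral_cong)
    fix \<omega> assume \<omega>: "\<omega> \<in> space M"
    define z where "z = X (time k) \<omega>"
    have "(\<integral>\<^sup>+ x. ennreal (accept x y) * (indicator (X_event (time k) x \<inter> X_event (time k + h) y) \<omega> * ennreal (survival k \<omega>)) \<partial>count_space UNIV) =
      (\<integral>\<^sup>+ x. ennreal (accept z y) * (indicator (X_event (time k + h) y) \<omega> * ennreal (survival k \<omega>)) * indicator {z} x \<partial>count_space UNIV)"
      using \<omega> by (intro nn_integral_cong) (auto simp: z_def X_event_def split: split_indicator)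
    also have "\<dots> = ennreal (accept z y) * (indicator (X_event (time k + h) y) \<omega> * ennreal (survival k \<omega>))" by simp
    also have "\<dots> = indicator (X_event (time (Suc k)) y) \<omega> * ennreal (survival k \<omega> - survival (Suc k) \<omega>)"
    proof (cases "X (time (Suc k)) \<omega> = y")
      case True
      have "survival k \<omega> - survival (Suc k) \<omega> = accept z y * survival k \<omega>"
        using True by (simp add: survival_Suc z_def algebra_simps)
      thus ?thesis using True \<omega> accept_bounds survival_bounds
        by (simp add: X_event_def time_Suc[symmetric] ennreal_mult)
    qed (simp add: X_event_def time_Suc)
    finally show "indicator (X_event (time (Suc k)) y) \<omega> * ennreal (survival k \<omega> - survival (Suc k) \<omega>) =
      (\<integral>\<^sup>+ x. ennreal (accept x y) * (indicator (X_event (time k) x \<inter> X_event (time k + h) y) \<omega> * ennreal (survival k \<omega>)) \<partial>count_space UNIV)" ..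
  qed
  also have "\<dots> = (\<integral>\<^sup>+ x. \<integral>\<^sup>+ \<omega>. ennreal (accept x y) * (indicator (X_event (time k) x \<inter> X_event (time k + h) y) \<omega> * ennreal (survival k \<omega>)) \<partial>M \<partial>count_space UNIV)"
    by (rule nn_integral_count_space_nn_integral) (auto simp flip: time_Suc)
  also have "\<dots> = (\<integral>\<^sup>+ x. ennreal (\<epsilon> * pmf \<mu> y) * (\<integral>\<^sup>+ \<omega>. indicator (X_event (time k) x) \<omega> * ennreal (survival k \<omega>) \<partial>M) \<partial>count_space UNIV)"
  proof (rule nn_integral_cong)
    fix x
    have "(\<integral>\<^sup>+ \<omega>. ennreal (accept x y) * (indicator (X_event (time k) x \<inter> X_event (time k + h) y) \<omega> * ennreal (survival k \<omega>)) \<partial>M) =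
      ennreal (accept x y) * (\<integral>\<^sup>+ \<omega>. indicator (X_event (time k) x \<inter> X_event (time k + h) y) \<omega> * ennreal (survival k \<omega>) \<partial>M)"
      by (rule nn_integral_cmult) (auto simp flip: time_Suc)
    also have "\<dots> = ennreal (accept x y) * (trans_prob x h y * (\<integral>\<^sup>+ \<omega>. indicator (X_event (time k) x) \<omega> * ennreal (survival k \<omega>) \<partial>M))"
      using measurable_survival_past[of k] h
      by (subst nn_integral_markov[OF time_nonneg]) auto
    finally show "(\<integral>\<^sup>+ \<omega>. ennreal (accept x y) * (indicator (X_event (time k) x \<inter> X_event (time k + h) y) \<omega> * ennreal (survival k \<omega>)) \<partial>M) =
      ennreal (\<epsilon> * pmf \<mu> y) * (\<integral>\<^sup>+ \<omega>. indicator (X_event (time k) x) \<omega> * ennreal (survival k \<omega>) \<partial>M)"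
      by (simp add: mult.assoc[symmetric] accept_mult_trans)
  qed
  also have "\<dots> = ennreal (\<epsilon> * pmf \<mu> y) * (\<integral>\<^sup>+ x. \<integral>\<^sup>+ \<omega>. indicator (X_event (time k) x) \<omega> * ennreal (survival k \<omega>) \<partial>M \<partial>count_space UNIV)"
    by (rule nn_integral_cmult) simp
  also have "(\<integral>\<^sup>+ x. \<integral>\<^sup>+ \<omega>. indicator (X_event (time k) x) \<omega> * ennreal (survival k \<omega>) \<partial>M \<partial>count_space UNIV) = mean_survival k"
    unfolding mean_survival_def by (rule nn_integral_X_event_split[OF time_nonneg]) measurable
  finally show ?thesis
    using eps by (simp add: ennreal_mult mult_ac)
qed

lemma stop_at_time:
  "(\<integral>\<^sup>+ \<omega>. ennreal (survival k \<omega> - survival (Suc k) \<omega>) \<partial>M) = ennreal \<epsilon> * mean_survival k"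
proof -
  have "(\<integral>\<^sup>+ \<omega>. ennreal (survival k \<omega> - survival (Suc k) \<omega>) \<partial>M) =
     (\<integral>\<^sup>+ y. ennreal (pmf \<mu> y) * (ennreal \<epsilon> * mean_survival k) \<partial>count_space UNIV)"
    by (subst nn_integral_X_event_split[OF time_nonneg[of "Suc k"], symmetric]) (auto simp: stop_at_state)
  also have "\<dots> = ennreal \<epsilon> * mean_survival k"
    by (simp add: nn_integral_multc nn_integral_pmf_eq_1)
  finally show ?thesis .
qed

text \<open>Summed over all states, each step stops the fraction \<open>\<epsilon>\<close> of the
  mean survival, so the number of steps is geometric.\<close>

lemma mean_survival: "mean_survival k = ennreal ((1 - \<epsilon>) ^ k)"
proof (induction k)
  case 0
  show ?case by (simp add: mean_survival_def survival_0 emeasure_space_1)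
next
  case (Suc k)
  have "mean_survival k = (\<integral>\<^sup>+ \<omega>. ennreal (survival (Suc k) \<omega>) + ennreal (survival k \<omega> - survival (Suc k) \<omega>) \<partial>M)"
    unfolding mean_survival_def using survival_bounds survival_decreasing[of k "Suc k"]
    by (intro nn_integral_cong) (simp flip: ennreal_plus)
  also have "\<dots> = mean_survival (Suc k) + ennreal \<epsilon> * mean_survival k"
    by (subst nn_integral_add) (auto simp: stop_at_time mean_survival_def)
  finally have eq: "mean_survival (Suc k) + ennreal (\<epsilon> * (1 - \<epsilon>) ^ k) = ennreal ((1 - \<epsilon>) ^ k)"
    using Suc eps by (simp add: ennreal_mult)
  have "mean_survival (Suc k) = ennreal ((1 - \<epsilon>) ^ k) - ennreal (\<epsilon> * (1 - \<epsilon>) ^ k)"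
    unfolding eq[symmetric] by simp
  also have "\<dots> = ennreal ((1 - \<epsilon>) ^ k - \<epsilon> * (1 - \<epsilon>) ^ k)"
    using eps by (intro ennreal_minus) auto
  also have "(1 - \<epsilon>) ^ k - \<epsilon> * (1 - \<epsilon>) ^ k = (1 - \<epsilon>) ^ Suc k"
    by (simp add: algebra_simps)
  finally show ?case .
qed

text \<open>The additional randomness is one uniform variable \<open>u\<close>; stopping happens at the first step
  \<open>k\<close> with \<open>survival k \<le> u\<close>.\<close>

definition uniform :: "real measure" where
  "uniform = uniform_measure lborel {0..<1}"

lemma sets_uniform [simp, measurable_cong]: "sets uniform = sets borel"
  and space_uniform [simp]: "space uniform = UNIV"
  by (simp_all add: uniform_def)

lemma prob_space_uniform: "prob_space uniform"
  unfolding uniform_def by (rule prob_space_uniform_measure) auto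

lemma emeasure_uniform:
  assumes "0 \<le> a" "b \<le> 1"
  shows "emeasure uniform {a..<b} = ennreal (b - a)"
proof -
  have "{0..<1} \<inter> {a..<b} = {a..<b}" using assms by auto
  thus ?thesis unfolding uniform_def
    by (cases "a \<le> b") (simp_all add: emeasure_uniform_measure divide_ennreal_def ennreal_neg)
qed

definition space2 :: "('w \<times> real) measure" where
  "space2 = M \<Otimes>\<^sub>M uniform"

definition X2 :: "real \<Rightarrow> 'w \<times> real \<Rightarrow> 'a" where
  "X2 t \<omega> = X t (fst \<omega>)"

definition stop :: "'w \<times> real \<Rightarrow> ennreal" where
  "stop \<omega> = (if \<exists>k. survival k (fst \<omega>) \<le> snd \<omega>
     then ennreal (time (LEAST k. survival k (fst \<omega>) \<le> snd \<omega>)) else \<infinity>)"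

text \<open>Survival decreases from 1, so these half-open intervals for \<open>u\<close> are
  disjoint. Since \<open>survival 0 = 1\<close> and \<open>u < 1\<close> almost surely, the earliest
  stop is at step 1, hence the shift to \<open>Suc k\<close>.\<close>

definition stop_step :: "nat \<Rightarrow> ('w \<times> real) set" where
  "stop_step k = {\<omega> \<in> space space2. survival (Suc k) (fst \<omega>) \<le> snd \<omega> \<and> snd \<omega> < survival k (fst \<omega>)}"

lemma prob_space_space2: "prob_space space2"
  unfolding space2_def by (intro prob_space_pair prob_space_axioms prob_space_uniform)

lemma space_space2: "space space2 = space M \<times> UNIV"
  by (simp add: space2_def space_pair_measure)

lemma measurable_fst2 [measurable]: "fst \<in> measurable space2 M"
  and measurable_snd2 [measurable]: "snd \<in> borel_measurable space2"
  unfolding space2_def by measurable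

lemma stop_on_step:
  assumes "\<omega> \<in> stop_step k"
  shows "stop \<omega> = ennreal (time (Suc k))"
proof -
  have "(LEAST k. survival k (fst \<omega>) \<le> snd \<omega>) = Suc k"
  proof (rule Least_equality)
    show "survival (Suc k) (fst \<omega>) \<le> snd \<omega>" using assms by (simp add: stop_step_def)
    fix j assume "survival j (fst \<omega>) \<le> snd \<omega>"
    thus "Suc k \<le> j"
      using assms survival_decreasing[of j k "fst \<omega>"] by (fastforce simp: stop_step_def not_less_eq_eq)
  qed
  moreover have "\<exists>k. survival k (fst \<omega>) \<le> snd \<omega>" using assms by (auto simp: stop_step_def)
  ultimately show ?thesis by (simp add: stop_def)
qed

text \<open>Monotonicity of survival makes any step with \<open>survival k \<le> u\<close> a
  witness, so the event involves only \<open>u\<close> and the path up to \<open>t\<close>; the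
  stopping property follows.\<close>

lemma stop_le_iff: "stop \<omega> \<le> t \<longleftrightarrow> (t = \<infinity> \<or> (\<exists>k. ennreal (time k) \<le> t \<and> survival k (fst \<omega>) \<le> snd \<omega>))"
proof (cases "\<exists>k. survival k (fst \<omega>) \<le> snd \<omega>")
  case True
  define l where "l = (LEAST k. survival k (fst \<omega>) \<le> snd \<omega>)"
  have l: "survival l (fst \<omega>) \<le> snd \<omega>" unfolding l_def by (rule LeastI_ex[OF True])
  have least: "l \<le> k" if "survival k (fst \<omega>) \<le> snd \<omega>" for k unfolding l_def using that by (rule Least_le)
  have "stop \<omega> = ennreal (time l)" using True by (simp add: stop_def l_def)
  moreover have "ennreal (time l) \<le> t" if "ennreal (time k) \<le> t" "survival k (fst \<omega>) \<le> snd \<omega>" for k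
    using order.trans[OF ennreal_leI[OF time_mono[OF least[OF that(2)]]] that(1)] .
  ultimately show ?thesis using l by auto
next
  case False
  thus ?thesis by (auto simp: stop_def top_unique)
qed

lemma sets_stop_step [measurable]: "stop_step k \<in> sets space2"
  unfolding stop_step_def by measurable

text \<open>Given the path, \<open>u\<close> has to fall into an interval of length
  \<open>survival k - survival (Suc k)\<close>.\<close>

lemma emeasure_stop_step:
  assumes [measurable]: "C \<in> sets M"
  shows "emeasure space2 (stop_step k \<inter> (fst -` C \<inter> space space2)) =
    (\<integral>\<^sup>+ \<omega>. indicator C \<omega> * ennreal (survival k \<omega> - survival (Suc k) \<omega>) \<partial>M)"
proof -
  interpret U: prob_space uniform by (rule prob_space_uniform)
  have alt: "emeasure space2 N = (\<integral>\<^sup>+ \<omega>. emeasure uniform (Pair \<omega> -` N) \<partial>M)" if "N \<in> sets space2" for N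
    using that unfolding space2_def by (rule U.emeasure_pair_measure_alt)
  have "emeasure space2 (stop_step k \<inter> (fst -` C \<inter> space space2)) =
    (\<integral>\<^sup>+ \<omega>. emeasure uniform (Pair \<omega> -` (stop_step k \<inter> (fst -` C \<inter> space space2))) \<partial>M)"
    by (rule alt) measurable
  also have "\<dots> = (\<integral>\<^sup>+ \<omega>. indicator C \<omega> * ennreal (survival k \<omega> - survival (Suc k) \<omega>) \<partial>M)"
  proof (rule nn_integral_cong)
    fix \<omega> assume \<omega>: "\<omega> \<in> space M"
    have "Pair \<omega> -` (stop_step k \<inter> (fst -` C \<inter> space space2)) =
      (if \<omega> \<in> C then {survival (Suc k) \<omega>..<survival k \<omega>} else {})"
      using \<omega> by (auto simp: stop_step_def space_space2)
    thus "emeasure uniform (Pair \<omega> -` (stop_step k \<inter> (fst -` C \<inter> space space2))) =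
      indicator C \<omega> * ennreal (survival k \<omega> - survival (Suc k) \<omega>)"
      by (simp add: emeasure_uniform survival_bounds)
  qed
  finally show ?thesis .
qed

lemma disjoint_stop_step: "disjoint_family stop_step"
proof -
  have "stop_step k \<inter> stop_step l = {}" if "k < l" for k l
  proof -
    have False if "\<omega> \<in> stop_step k" "\<omega> \<in> stop_step l" for \<omega>
    proof -
      have "survival (Suc k) (fst \<omega>) \<le> snd \<omega>" "snd \<omega> < survival l (fst \<omega>)"
        using that by (simp_all add: stop_step_def)
      thus False using survival_decreasing[of "Suc k" l "fst \<omega>"] \<open>k < l\<close> by simp
    qed
    thus ?thesis by blast
  qed
  thus ?thesis
    unfolding disjoint_family_on_def by (metis Int_commute linorder_neqE_nat)
qed

lemma emeasure_stop_step_state: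
  "emeasure space2 (stop_step k \<inter> (fst -` X_event (time (Suc k)) x \<inter> space space2)) =
    ennreal (pmf \<mu> x * (\<epsilon> * (1 - \<epsilon>) ^ k))"
  and emeasure_stop_step_eq: "emeasure space2 (stop_step k) = ennreal (\<epsilon> * (1 - \<epsilon>) ^ k)"
proof -
  show "emeasure space2 (stop_step k \<inter> (fst -` X_event (time (Suc k)) x \<inter> space space2)) =
    ennreal (pmf \<mu> x * (\<epsilon> * (1 - \<epsilon>) ^ k))"
    using eps by (subst emeasure_stop_step[OF sets_X_event[OF time_nonneg]])
      (simp add: stop_at_state mean_survival ennreal_mult)
  have "stop_step k \<inter> (fst -` space M \<inter> space space2) = stop_step k"
    by (auto simp: stop_step_def space_space2)
  moreover have "(\<integral>\<^sup>+ \<omega>. indicator (space M) \<omega> * ennreal (survival k \<omega> - survival (Suc k) \<omega>) \<partial>M) = ennreal \<epsilon> * mean_survival k"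
    unfolding stop_at_time[symmetric] by (intro nn_integral_cong) auto
  ultimately show "emeasure space2 (stop_step k) = ennreal (\<epsilon> * (1 - \<epsilon>) ^ k)"
    using emeasure_stop_step[OF sets.top, of k] eps by (simp add: mean_survival ennreal_mult)
qed

lemma AE_stop_step: "AE \<omega> in space2. \<exists>k. \<omega> \<in> stop_step k"
proof -
  interpret P: prob_space space2 by (rule prob_space_space2)
  have "emeasure space2 (\<Union>k. stop_step k) = (\<Sum>k. ennreal (\<epsilon> * (1 - \<epsilon>) ^ k))"
    by (subst suminf_emeasure[symmetric]) (auto simp: disjoint_stop_step emeasure_stop_step_eq)
  also have "(\<lambda>k. \<epsilon> * (1 - \<epsilon>) ^ k) sums (\<epsilon> * (1 / (1 - (1 - \<epsilon>))))"
    using eps by (intro sums_mult geometric_sums) auto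
  hence "(\<Sum>k. ennreal (\<epsilon> * (1 - \<epsilon>) ^ k)) = 1"
    using eps by (subst suminf_ennreal2) (auto simp: sums_iff)
  finally have "P.prob (\<Union>k. stop_step k) = 1"
    by (simp add: measure_def)
  hence "AE \<omega> in space2. \<omega> \<in> (\<Union>k. stop_step k)"
    by (subst (asm) P.prob_eq_1) auto
  thus ?thesis by simp
qed

definition aux_sets :: "('w \<times> real) set set" where
  "aux_sets = sets (vimage_algebra (space space2) snd uniform)"

lemma aux_sets_subset: "aux_sets \<subseteq> sets space2"
proof
  fix b assume "b \<in> aux_sets"
  then obtain B where "B \<in> sets borel" "b = snd -` B \<inter> space space2"
    by (auto simp: aux_sets_def sets_vimage_algebra2)
  thus "b \<in> sets space2" using measurable_sets[OF measurable_snd2] by auto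
qed

lemma filtration2_subset:
  "sets (natural_filtration space2 X2 t) \<subseteq> {fst -` A \<inter> space space2 | A. A \<in> sets M}"
proof -
  have V: "sets (vimage_algebra (space space2) fst M) = {fst -` A \<inter> space space2 | A. A \<in> sets M}"
    by (rule sets_vimage_algebra2) (auto simp: space_space2)
  have gens: "{X2 s -` A \<inter> space space2 | s A. 0 \<le> s \<and> ennreal s \<le> t} \<subseteq> sets (vimage_algebra (space space2) fst M)"
  proof
    fix B assume "B \<in> {X2 s -` A \<inter> space space2 | s A. 0 \<le> s \<and> ennreal s \<le> t}"
    then obtain s A where "0 \<le> s" and B: "B = X2 s -` A \<inter> space space2" by auto
    hence "X s -` A \<inter> space M \<in> sets M" using measurable_sets[OF measurable_X[OF \<open>0 \<le> s\<close>], of A] by simp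
    moreover have "B = fst -` (X s -` A \<inter> space M) \<inter> space space2"
      unfolding B by (auto simp: X2_def space_space2)
    ultimately show "B \<in> sets (vimage_algebra (space space2) fst M)" unfolding V by blast
  qed
  have "{X2 s -` A \<inter> space space2 | s A. 0 \<le> s \<and> ennreal s \<le> t} \<subseteq> Pow (space space2)" by auto
  hence "sets (natural_filtration space2 X2 t) = sigma_sets (space space2) {X2 s -` A \<inter> space space2 | s A. 0 \<le> s \<and> ennreal s \<le> t}"
    by (simp add: natural_filtration_def)
  also have "\<dots> \<subseteq> sets (vimage_algebra (space space2) fst M)"
    using sets.sigma_sets_subset[OF gens] by simp
  finally show ?thesis unfolding V .
qed

text \<open>The auxiliary algebra is generated by the second coordinate, while every event of the
  process is a cylinder over the first; the product measure makes them independent.\<close>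

lemma randomized_stopping_time_stop: "randomized_stopping_time space2 X2 stop"
  unfolding randomized_stopping_time_def
proof (intro exI conjI)
  interpret P: prob_space space2 by (rule prob_space_space2)
  interpret U: prob_space uniform by (rule prob_space_uniform)
  show "sigma_algebra (space space2) aux_sets"
    using sets.sigma_algebra_axioms[of "vimage_algebra (space space2) snd uniform"]
    by (simp add: aux_sets_def)
  show "P.indep_set aux_sets (sets (natural_filtration space2 X2 \<infinity>))"
  proof (rule P.indep_setI)
    show "aux_sets \<subseteq> sets space2" by (rule aux_sets_subset)
    show "sets (natural_filtration space2 X2 \<infinity>) \<subseteq> sets space2"
      using filtration2_subset[of \<infinity>] measurable_sets[OF measurable_fst2] by auto
    fix a b assume "a \<in> aux_sets" "b \<in> sets (natural_filtration space2 X2 \<infinity>)"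
    then obtain B A where B: "B \<in> sets uniform" "a = snd -` B \<inter> space space2"
      and A: "A \<in> sets M" "b = fst -` A \<inter> space space2"
      using filtration2_subset[of \<infinity>] by (auto simp: aux_sets_def sets_vimage_algebra2)
    have "A \<subseteq> space M" using A(1) sets.sets_into_space by blast
    hence "a \<inter> b = A \<times> B" "a = space M \<times> B" "b = A \<times> space uniform"
      using A B by (auto simp: space_space2)
    hence "emeasure space2 (a \<inter> b) = emeasure space2 a * emeasure space2 b"
      using A(1) B(1) by (simp add: space2_def U.emeasure_pair_measure_Times emeasure_space_1 mult.commute
        U.emeasure_space_1[simplified])
    thus "P.prob (a \<inter> b) = P.prob a * P.prob b"
      by (simp add: P.emeasure_eq_measure ennreal_mult[symmetric])
  qed
  show "stopping_time (\<lambda>t. sigma (space space2) (sets (natural_filtration space2 X2 t) \<union> aux_sets)) stop"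
    unfolding stopping_time_def
  proof
    fix t :: ennreal
    define F where "F = sigma (space space2) (sets (natural_filtration space2 X2 t) \<union> aux_sets)"
    have sub: "sets (natural_filtration space2 X2 t) \<union> aux_sets \<subseteq> Pow (space space2)"
      using filtration2_subset[of t] aux_sets_subset sets.sets_into_space[of _ space2] by blast
    have spF: "space F = space space2" and setsF: "sets F = sigma_sets (space space2) (sets (natural_filtration space2 X2 t) \<union> aux_sets)"
      using sub by (simp_all add: F_def)
    have sndF: "snd \<in> borel_measurable F"
    proof (rule measurableI)
      fix B :: "real set" assume "B \<in> sets borel"
      hence "snd -` B \<inter> space F \<in> aux_sets"
        by (auto simp: aux_sets_def sets_vimage_algebra2 spF)
      thus "snd -` B \<inter> space F \<in> sets F" unfolding setsF by (intro sigma_sets.Basic) simp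
    qed simp
    have XF: "(\<lambda>\<omega>. X r (fst \<omega>)) \<in> measurable F (count_space UNIV)" if "0 \<le> r" "ennreal r \<le> t" for r
    proof (rule measurableI)
      fix A :: "'a set"
      have "{X2 s -` A \<inter> space space2 | s A. 0 \<le> s \<and> ennreal s \<le> t} \<subseteq> Pow (space space2)" by auto
      hence "X2 r -` A \<inter> space space2 \<in> sets (natural_filtration space2 X2 t)"
        using that by (auto simp: natural_filtration_def intro!: sigma_sets.Basic)
      hence "X2 r -` A \<inter> space space2 \<in> sets F" unfolding setsF by (intro sigma_sets.Basic) simp
      thus "(\<lambda>\<omega>. X r (fst \<omega>)) -` A \<inter> space F \<in> sets F" by (simp add: X2_def[abs_def] spF)
    qed simp
    have surv: "(\<lambda>\<omega>. survival k (fst \<omega>)) \<in> borel_measurable F" if "ennreal (time k) \<le> t" for k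
      by (rule measurable_survival_if)
        (use that in \<open>auto intro!: XF time_nonneg intro: order.trans[OF ennreal_leI[OF time_mono]]\<close>)
    have "Measurable.pred F (\<lambda>\<omega>. ennreal (time k) \<le> t \<and> survival k (fst \<omega>) \<le> snd \<omega>)" for k
    proof (cases "ennreal (time k) \<le> t")
      case True
      note [measurable] = surv[OF True] sndF
      show ?thesis using True by simp
    qed simp
    hence ex: "Measurable.pred F (\<lambda>\<omega>. \<exists>k. ennreal (time k) \<le> t \<and> survival k (fst \<omega>) \<le> snd \<omega>)"
      by (rule pred_intros_countable)
    show "Measurable.pred F (\<lambda>\<omega>. stop \<omega> \<le> t)"
    proof (cases "t = \<infinity>")
      case True
      hence "(\<lambda>\<omega>. stop \<omega> \<le> t) = (\<lambda>\<omega>. True)" unfolding stop_le_iff by blast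
      thus ?thesis by (simp only: measurable_const UNIV_I space_count_space)
    next
      case False
      hence "(\<lambda>\<omega>. stop \<omega> \<le> t) = (\<lambda>\<omega>. \<exists>k. ennreal (time k) \<le> t \<and> survival k (fst \<omega>) \<le> snd \<omega>)"
        unfolding stop_le_iff by blast
      thus ?thesis using ex by (simp only:)
    qed
  qed
qed

lemma measurable_stop [measurable]: "stop \<in> borel_measurable space2"
proof (rule borel_measurableI_le)
  fix t
  show "{\<omega> \<in> space space2. stop \<omega> \<le> t} \<in> sets space2"
    unfolding stop_le_iff by measurable
qed

definition stop_event :: "'a \<Rightarrow> ('w \<times> real) set" where
  "stop_event x = {\<omega> \<in> space space2. X2 (enn2real (stop \<omega>)) \<omega> = x}"

lemma sets_stop_event: "stop_event x \<in> sets space2"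
proof -
  have [measurable]: "X (time k) \<in> measurable M (count_space UNIV)" for k
    by (rule measurable_X[OF time_nonneg])
  define l where "l \<omega> = (LEAST k. survival k (fst \<omega>) \<le> snd \<omega>)" for \<omega>
  have l: "l \<in> measurable space2 (count_space UNIV)" unfolding l_def[abs_def] by measurable
  have "(\<lambda>\<omega>. X (time k) (fst \<omega>)) \<in> measurable space2 (count_space UNIV)" for k by measurable
  from measurable_compose_countable[OF this l]
  have [measurable]: "(\<lambda>\<omega>. X (time (l \<omega>)) (fst \<omega>)) \<in> measurable space2 (count_space UNIV)" .
  \<comment> \<open>On the event of never stopping, \<open>enn2real \<infinity> = 0\<close> selects
    the state at time 0.\<close>
  have X2: "X2 (enn2real (stop \<omega>)) \<omega> =
    (if \<exists>k. survival k (fst \<omega>) \<le> snd \<omega> then X (time (l \<omega>)) (fst \<omega>) else X (time 0) (fst \<omega>))" for \<omega>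
    by (simp add: X2_def stop_def l_def time_nonneg) (simp add: time_def)
  show ?thesis unfolding stop_event_def X2 by measurable
qed

text \<open>\<open>stop\<close> is constant on each step event, and within each of these the state
  on stopping has law \<open>\<mu>\<close>; the factor \<open>pmf \<mu> x\<close> is common to all
  steps.\<close>

lemma emeasure_stop_event:
  assumes B: "B \<in> sets borel"
  shows "emeasure space2 (stop -` B \<inter> space space2 \<inter> stop_event x) =
    ennreal (pmf \<mu> x) * emeasure space2 (stop -` B \<inter> space space2)"
proof -
  have A: "stop -` B \<inter> space space2 \<in> sets space2" by (rule measurable_sets[OF measurable_stop B])
  have split: "emeasure space2 C = (\<Sum>k. emeasure space2 (C \<inter> stop_step k))" if C: "C \<in> sets space2" for C
  proof -
    have "emeasure space2 C = emeasure space2 (\<Union>k. C \<inter> stop_step k)"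
    proof (rule emeasure_eq_AE)
      show "AE \<omega> in space2. \<omega> \<in> C \<longleftrightarrow> \<omega> \<in> (\<Union>k. C \<inter> stop_step k)"
        using AE_stop_step by eventually_elim auto
    qed (use C in auto)
    also have "\<dots> = (\<Sum>k. emeasure space2 (C \<inter> stop_step k))"
      by (rule suminf_emeasure[symmetric])
        (use C disjoint_stop_step in \<open>auto simp: disjoint_family_on_def\<close>)
    finally show ?thesis .
  qed
  have 1: "emeasure space2 (stop -` B \<inter> space space2 \<inter> stop_step k) =
      (if ennreal (time (Suc k)) \<in> B then ennreal (\<epsilon> * (1 - \<epsilon>) ^ k) else 0)" for k
  proof -
    have "stop -` B \<inter> space space2 \<inter> stop_step k = (if ennreal (time (Suc k)) \<in> B then stop_step k else {})"
      using stop_on_step[of _ k] by (auto simp: stop_step_def)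
    thus ?thesis by (simp add: emeasure_stop_step_eq)
  qed
  have 2: "emeasure space2 (stop -` B \<inter> space space2 \<inter> stop_event x \<inter> stop_step k) =
      (if ennreal (time (Suc k)) \<in> B then ennreal (pmf \<mu> x * (\<epsilon> * (1 - \<epsilon>) ^ k)) else 0)" for k
  proof -
    have "stop -` B \<inter> space space2 \<inter> stop_event x \<inter> stop_step k =
      (if ennreal (time (Suc k)) \<in> B then stop_step k \<inter> (fst -` X_event (time (Suc k)) x \<inter> space space2) else {})"
      using stop_on_step[of _ k] time_nonneg[of "Suc k"]
      by (auto simp: stop_event_def stop_step_def X_event_def X2_def space_space2)
    thus ?thesis by (simp add: emeasure_stop_step_state)
  qed
  have "emeasure space2 (stop -` B \<inter> space space2 \<inter> stop_event x) =
      (\<Sum>k. ennreal (pmf \<mu> x) * (if ennreal (time (Suc k)) \<in> B then ennreal (\<epsilon> * (1 - \<epsilon>) ^ k) else 0))"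
  proof -
    have "(if ennreal (time (Suc k)) \<in> B then ennreal (pmf \<mu> x * (\<epsilon> * (1 - \<epsilon>) ^ k)) else 0) =
      ennreal (pmf \<mu> x) * (if ennreal (time (Suc k)) \<in> B then ennreal (\<epsilon> * (1 - \<epsilon>) ^ k) else 0)" for k
      by (simp add: ennreal_mult')
    thus ?thesis unfolding split[OF sets.Int[OF A sets_stop_event]] 2 by simp
  qed
  also have "\<dots> = ennreal (pmf \<mu> x) * emeasure space2 (stop -` B \<inter> space space2)"
    unfolding split[OF A] 1 by (rule ennreal_suminf_cmult)
  finally show ?thesis .
qed

lemma strong_stationary_time_stop: "strong_stationary_time space2 X2 \<mu> stop"
  unfolding strong_stationary_time_def
proof (intro conjI allI)
  interpret P: prob_space space2 by (rule prob_space_space2)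
  show "randomized_stopping_time space2 X2 stop" by (rule randomized_stopping_time_stop)
  fix x
  define F where "F = vimage_algebra (space space2) stop borel"
  have F: "sets F = {stop -` B \<inter> space space2 | B. B \<in> sets borel}"
    unfolding F_def by (rule sets_vimage_algebra2) auto
  have "subalgebra space2 F"
    unfolding subalgebra_def F using measurable_sets[OF measurable_stop] by (auto simp: F_def)
  then interpret finite_measure_subalgebra space2 F by unfold_locales
  note [measurable] = sets_stop_event
  have "AE \<omega> in space2. real_cond_exp space2 F (indicator (stop_event x)) \<omega> = pmf \<mu> x"
  proof (rule real_cond_exp_charact)
    fix A assume "A \<in> sets F"
    then obtain B where B: "B \<in> sets borel" "A = stop -` B \<inter> space space2" unfolding F by auto
    have A [measurable]: "A \<in> sets space2" unfolding B by (rule measurable_sets[OF measurable_stop B(1)])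
    have "P.prob (A \<inter> stop_event x) = pmf \<mu> x * P.prob A"
      using emeasure_stop_event[OF B(1), of x] unfolding B(2)[symmetric]
      by (simp add: P.emeasure_eq_measure ennreal_mult[symmetric])
    thus "(\<integral>\<omega>\<in>A. indicator (stop_event x) \<omega> \<partial>space2) = (\<integral>\<omega>\<in>A. pmf \<mu> x \<partial>space2)"
      by (simp add: set_lebesgue_integral_def indicator_inter_arith[symmetric] mult.commute)
  next
    show "integrable space2 (indicator (stop_event x) :: _ \<Rightarrow> real)"
      by (rule P.integrable_const_bound[where B = 1]) auto
  qed auto
  thus "AE \<omega> in space2. stop \<omega> < \<infinity> \<longrightarrow>
      real_cond_exp space2 (vimage_algebra (space space2) stop borel)
        (indicator {\<omega> \<in> space space2. X2 (enn2real (stop \<omega>)) \<omega> = x}) \<omega> = pmf \<mu> x"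
    unfolding F_def[symmetric] stop_event_def[symmetric] by eventually_elim simp
qed

lemma has_finite_sst: "has_finite_strong_stationary_time M X \<mu>"
  unfolding has_finite_strong_stationary_time_def
proof (intro exI conjI)
  show "prob_space uniform" by (rule prob_space_uniform)
  show "strong_stationary_time (M \<Otimes>\<^sub>M uniform) (\<lambda>t \<omega>. X t (fst \<omega>)) \<mu> stop"
    using strong_stationary_time_stop by (simp add: space2_def X2_def[abs_def])
  show "AE \<omega> in M \<Otimes>\<^sub>M uniform. stop \<omega> < \<infinity>"
    using AE_stop_step unfolding space2_def by eventually_elim (auto simp: stop_on_step)
qed

end

context reversible_generator
begin

lemma summable_mu:
  assumes "inj (f :: nat \<Rightarrow> 'a)"
  shows "summable (\<lambda>n. pmf \<mu> (f n))"
proof -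
  have "(\<lambda>x. pmf \<mu> x) summable_on UNIV"
  proof (rule nonneg_bdd_above_summable_on)
    show "bdd_above (sum (pmf \<mu>) ` {F. F \<subseteq> UNIV \<and> finite F})"
      by (rule bdd_aboveI2[where M = 1]) (auto simp: measure_measure_pmf_finite[symmetric])
  qed simp
  hence "(\<lambda>x. pmf \<mu> x) summable_on range f" by (rule summable_on_subset_banach) simp
  hence "(\<lambda>n. pmf \<mu> (f n)) summable_on UNIV"
    using summable_on_reindex[OF assms, of "pmf \<mu>"] by (simp add: o_def)
  thus ?thesis by (subst (asm) summable_on_UNIV_nonneg_real_iff) auto
qed

end

section \<open>The branches of the graph\<close>

text \<open>The neighbours are prescribed for \<open>n > 0\<close> only, because
  \<open>\<phi> 0\<close> is the end at which the branch meets the rest of the graph.\<close>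

locale generator_branch = reversible_generator L \<mu>
  for L :: "'a::countable \<Rightarrow> 'a \<Rightarrow> real" and \<mu> :: "'a pmf" +
  fixes \<phi> :: "nat \<Rightarrow> 'a"
  assumes inj_branch: "inj \<phi>"
    and nbrs_branch: "n > 0 \<Longrightarrow> nbrs (\<phi> n) = {\<phi> (n - 1), \<phi> (n + 1)}"
    and summable_rate: "(\<lambda>p. pmf \<mu> p * \<bar>L p p\<bar>) summable_on UNIV"
begin

definition weight :: "nat \<Rightarrow> real" where
  "weight n = pmf \<mu> (\<phi> n)"

definition conductance :: "nat \<Rightarrow> real" where
  "conductance n = weight n * L (\<phi> n) (\<phi> (n + 1))"

abbreviation branch_term :: "nat \<Rightarrow> real" where
  "branch_term j \<equiv> branch_measure L \<phi> (j + 1) *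
     (\<Sum>k=1..j. 1 / (branch_measure L \<phi> k * L (\<phi> k) (\<phi> (k + 1))))"

lemma branch_eq_iff: "\<phi> n = \<phi> k \<longleftrightarrow> n = k"
  using inj_branch by (auto simp: inj_def)

lemma next_nbr: "\<phi> (n + 1) \<in> nbrs (\<phi> n)"
  using nbrs_branch[of "n + 1"] nbrs_sym by simp

lemma L_branch_pos: "L (\<phi> n) (\<phi> (n + 1)) > 0" "L (\<phi> (n + 1)) (\<phi> n) > 0"
  using next_nbr[of n] L_nonneg[of "\<phi> n" "\<phi> (n + 1)"] L_nonneg[of "\<phi> (n + 1)" "\<phi> n"]
    nbrs_sym[of "\<phi> (n + 1)" "\<phi> n"]
  by (auto simp: nbrs_def less_le)

lemma weight_pos: "weight n > 0"
  by (simp add: weight_def mu_pos)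

lemma conductance_pos: "conductance n > 0"
  using weight_pos L_branch_pos by (simp add: conductance_def)

text \<open>Detailed balance along successive edges: \<open>branch_measure\<close> is the stationary
  weight normalized at the end of the branch.\<close>

lemma weight_eq_branch_measure: "weight n = weight 0 * branch_measure L \<phi> n"
proof (induction n)
  case (Suc n)
  have "weight (Suc n) * L (\<phi> (Suc n)) (\<phi> n) = weight n * L (\<phi> n) (\<phi> (Suc n))"
    by (simp add: weight_def balance)
  hence "weight (Suc n) = weight n * (L (\<phi> n) (\<phi> (n + 1)) / L (\<phi> (n + 1)) (\<phi> n))"
    using L_branch_pos(2)[of n] by (simp add: field_simps)
  thus ?case using Suc by (simp add: branch_measure_def)
qed (simp add: branch_measure_def)

text \<open>The normalization \<open>weight 0\<close> cancels between the outer weight and the inner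
  inverse conductances.\<close>

lemma branch_term_eq: "branch_term j = weight (j + 1) * (\<Sum>k=1..j. 1 / conductance k)"
proof -
  have "branch_measure L \<phi> k = weight k / weight 0" for k
    using weight_eq_branch_measure[of k] weight_pos[of 0] by simp
  hence "branch_measure L \<phi> (j + 1) * (1 / (branch_measure L \<phi> k * L (\<phi> k) (\<phi> (k + 1)))) =
    weight (j + 1) * (1 / conductance k)" for k
    using weight_pos[of 0] by (simp add: conductance_def)
  thus ?thesis unfolding sum_distrib_left by simp
qed

text \<open>A conductance is at most \<open>\<mu>\<close> times the total jump rate at its vertex,
  and these products are summable.\<close>

lemma conductance_tendsto: "conductance \<longlonglongrightarrow> 0"
proof -
  have "(\<lambda>p. pmf \<mu> p * \<bar>L p p\<bar>) summable_on range \<phi>"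
    using summable_rate by (rule summable_on_subset_banach) simp
  hence "(\<lambda>n. weight n * \<bar>L (\<phi> n) (\<phi> n)\<bar>) summable_on UNIV"
    using summable_on_reindex[OF inj_branch, of "\<lambda>p. pmf \<mu> p * \<bar>L p p\<bar>"] by (simp add: o_def weight_def)
  hence "summable (\<lambda>n. weight n * \<bar>L (\<phi> n) (\<phi> n)\<bar>)"
    using weight_pos by (subst (asm) summable_on_UNIV_nonneg_real_iff) (auto simp: less_imp_le)
  hence lim: "(\<lambda>n. weight n * \<bar>L (\<phi> n) (\<phi> n)\<bar>) \<longlonglongrightarrow> 0" by (rule summable_LIMSEQ_zero)
  have "conductance n \<le> weight n * \<bar>L (\<phi> n) (\<phi> n)\<bar>" for n
  proof -
    have "L (\<phi> n) (\<phi> (n + 1)) \<le> rate (\<phi> n)"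
      unfolding rate_eq_sum
    proof (rule member_le_sum[OF next_nbr])
      show "0 \<le> L (\<phi> n) y" if "y \<in> nbrs (\<phi> n) - {\<phi> (n + 1)}" for y
        using that by (intro L_nonneg) (auto simp: nbrs_def)
    qed simp
    thus ?thesis using weight_pos[of n] by (auto simp: conductance_def rate_def intro!: mult_left_mono)
  qed
  thus ?thesis
    by (intro tendsto_sandwich[OF _ _ tendsto_const lim]) (auto simp: conductance_pos less_imp_le)
qed

text \<open>Beyond \<open>n0\<close> the branch avoids \<open>z\<close> and every vertex has just
  its two branch neighbours, so the backward equation for the density takes the one-dimensional
  form.\<close>

lemma branch_function:
  assumes "n0 > 0" "\<And>n. n \<ge> n0 \<Longrightarrow> \<phi> n \<noteq> z"
  shows "branch_function weight conductance (\<lambda>n. res z (\<phi> n) / weight n) n0 (1 / pmf \<mu> z)"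
proof
  show "weight n > 0" for n by (rule weight_pos)
  show "summable weight" unfolding weight_def[abs_def] by (rule summable_mu[OF inj_branch])
  show "conductance n > 0" for n by (rule conductance_pos)
  show "conductance \<longlonglongrightarrow> 0" by (rule conductance_tendsto)
  show "res z (\<phi> n) / weight n > 0" for n using res_pos weight_pos by simp
  show "res z (\<phi> n) / weight n \<le> 1 / pmf \<mu> z" for n
    using res_le[of z "\<phi> n"] weight_pos[of n] mu_pos[of z] by (simp add: weight_def field_simps)
next
  fix n assume n: "n \<ge> n0"
  hence "n > 0" using assms(1) by simp
  define g where "g n = res z (\<phi> n) / weight n" for n
  have "g n = (\<Sum>w\<in>{\<phi> (n - 1), \<phi> (n + 1)}. L (\<phi> n) w * (res z w / pmf \<mu> w - g n))"
    using res_density_harmonic[of z "\<phi> n"] assms(2)[OF n] nbrs_branch[OF \<open>n > 0\<close>]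
    by (auto simp: g_def weight_def)
  also have "\<dots> = L (\<phi> n) (\<phi> (n - 1)) * (g (n - 1) - g n) + L (\<phi> n) (\<phi> (n + 1)) * (g (n + 1) - g n)"
    using \<open>n > 0\<close> by (simp add: branch_eq_iff g_def weight_def)
  finally have "weight n * g n = weight n * (L (\<phi> n) (\<phi> (n - 1)) * (g (n - 1) - g n) +
      L (\<phi> n) (\<phi> (n + 1)) * (g (n + 1) - g n))"
    by (rule arg_cong)
  also have "\<dots> = weight n * L (\<phi> n) (\<phi> (n - 1)) * (g (n - 1) - g n) +
      weight n * L (\<phi> n) (\<phi> (n + 1)) * (g (n + 1) - g n)"
    by (simp add: distrib_left mult.assoc)
  also have "weight n * L (\<phi> n) (\<phi> (n - 1)) = conductance (n - 1)"
    using \<open>n > 0\<close> by (simp add: conductance_def weight_def balance)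
  finally show "weight n * (res z (\<phi> n) / weight n) =
    conductance n * (res z (\<phi> (n + 1)) / weight (n + 1) - res z (\<phi> n) / weight n) +
    conductance (n - 1) * (res z (\<phi> (n - 1)) / weight (n - 1) - res z (\<phi> n) / weight n)"
    by (simp add: g_def conductance_def)
qed

lemma summable_iff_tail:
  "branch_term summable_on {1..} \<longleftrightarrow> summable (\<lambda>n. (\<Sum>j. weight (j + Suc n)) / conductance n)"
proof -
  have "summable weight" unfolding weight_def[abs_def] by (rule summable_mu[OF inj_branch])
  hence "(\<lambda>j. weight (j + 1) * (\<Sum>k=1..j. 1 / conductance k)) summable_on {1..} \<longleftrightarrow>
    summable (\<lambda>k. 1 / conductance (Suc k) * (\<Sum>j. weight (j + Suc (Suc k))))"
    by (intro summable_tail_iff[symmetric]) (simp_all add: weight_pos conductance_pos less_imp_le)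
  also have "\<dots> \<longleftrightarrow> summable (\<lambda>n. 1 / conductance n * (\<Sum>j. weight (j + Suc n)))"
    by (rule summable_Suc_iff)
  finally show ?thesis unfolding branch_term_eq by simp
qed

text \<open>Starting the resolvent at the end \<open>\<phi> 0\<close> makes the equation valid at
  every later vertex, so \<open>n0 = 1\<close>.\<close>

lemma summable_if_res_bounded_below:
  assumes "c > 0" "\<And>y. c * pmf \<mu> y \<le> res (\<phi> 0) y"
  shows "branch_term summable_on {1..}"
proof -
  interpret B: branch_function weight conductance "\<lambda>n. res (\<phi> 0) (\<phi> n) / weight n" 1 "1 / pmf \<mu> (\<phi> 0)"
    by (rule branch_function) (auto simp: branch_eq_iff)
  have "summable (\<lambda>n. B.tail n / conductance n)"
  proof (rule B.summable_tail_if_bounded_below[OF assms(1)])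
    show "c \<le> res (\<phi> 0) (\<phi> n) / weight n" for n
      using assms(2)[of "\<phi> n"] weight_pos[of n] by (simp add: weight_def pos_le_divide_eq)
  qed
  thus ?thesis unfolding summable_iff_tail B.tail_def .
qed

lemma res_bounded_below_if_summable:
  assumes "branch_term summable_on {1..}"
  shows "\<exists>d>0. \<forall>n. d * pmf \<mu> (\<phi> n) \<le> res z (\<phi> n)"
proof -
  \<comment> \<open>If \<open>z\<close> lies on the branch, the equation is used only beyond
    it.\<close>
  obtain n0 where n0: "n0 > 0" "\<And>n. n \<ge> n0 \<Longrightarrow> \<phi> n \<noteq> z"
  proof (cases "z \<in> range \<phi>")
    case True
    then obtain k where "z = \<phi> k" by auto
    thus ?thesis using that[of "Suc k"] by (auto simp: branch_eq_iff)
  next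
    case False
    thus ?thesis using that[of 1] by auto
  qed
  interpret B: branch_function weight conductance "\<lambda>n. res z (\<phi> n) / weight n" n0 "1 / pmf \<mu> z"
    by (rule branch_function[OF n0])
  have "summable (\<lambda>n. B.tail n / conductance n)"
    using assms unfolding summable_iff_tail B.tail_def .
  from B.bounded_below_if_summable_tail[OF this] obtain d where
    "d > 0" "\<And>n. d \<le> res z (\<phi> n) / weight n" by blast
  thus ?thesis using weight_pos by (auto simp: weight_def pos_le_divide_eq)
qed

end

section \<open>Independent enlargement and the two implications\<close>

lemma (in jump_process) jump_process_pair:
  assumes "prob_space K"
  shows "jump_process L \<mu> (M \<Otimes>\<^sub>M K) \<mu>0 (\<lambda>n \<omega>. Y n (fst \<omega>)) (\<lambda>n \<omega>. H n (fst \<omega>)) (\<lambda>t \<omega>. X t (fst \<omega>))"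
proof
  interpret K: prob_space K by fact
  interpret P: pair_prob_space M K ..
  have J: "jump_time (\<lambda>n \<omega>. H n (fst \<omega>)) n \<omega> = J n (fst \<omega>)" for n \<omega>
    by (simp add: jump_time_def)
  note [measurable] = measurable_H
  show "jump_chain_holding (M \<Otimes>\<^sub>M K) L \<mu>0 (\<lambda>n \<omega>. Y n (fst \<omega>)) (\<lambda>n \<omega>. H n (fst \<omega>))"
    unfolding jump_chain_holding_def
  proof (intro conjI allI impI)
    show "prob_space (M \<Otimes>\<^sub>M K)" by (rule P.prob_space_axioms)
  next
    fix n :: nat and y :: "nat \<Rightarrow> 'a" and t :: "nat \<Rightarrow> real" assume t: "\<forall>k. 0 \<le> t k"
    define A where "A = {\<omega> \<in> space M. \<forall>k\<le>n. Y k \<omega> = y k \<and> ennreal (t k) < H k \<omega>}"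
    have [measurable]: "A \<in> sets M" unfolding A_def by measurable
    have "{\<omega> \<in> space (M \<Otimes>\<^sub>M K). \<forall>k\<le>n. Y k (fst \<omega>) = y k \<and> ennreal (t k) < H k (fst \<omega>)} = A \<times> space K"
      by (auto simp: A_def space_pair_measure)
    moreover have "measure (M \<Otimes>\<^sub>M K) (A \<times> space K) = measure M A"
      by (simp add: measure_def K.emeasure_pair_measure_Times K.emeasure_space_1)
    ultimately show "measure (M \<Otimes>\<^sub>M K) {\<omega> \<in> space (M \<Otimes>\<^sub>M K). \<forall>k\<le>n. Y k (fst \<omega>) = y k \<and> ennreal (t k) < H k (fst \<omega>)} =
      pmf \<mu>0 (y 0) * (\<Prod>k<n. jump_prob L (y k) (y (Suc k))) * (\<Prod>k\<le>n. exp (L (y k) (y k) * t k))"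
      using realization t by (simp add: jump_chain_holding_def A_def)
  qed measurable
  show "(\<lambda>\<omega>. X t (fst \<omega>)) \<in> measurable (M \<Otimes>\<^sub>M K) (count_space UNIV)" if "t \<ge> 0" for t
    by (rule measurable_compose[OF measurable_fst measurable_X[OF that]])
  show "X t (fst \<omega>) = Y n (fst \<omega>)"
    if "\<omega> \<in> space (M \<Otimes>\<^sub>M K)" "t \<ge> 0" "jump_time (\<lambda>n \<omega>. H n (fst \<omega>)) n \<omega> \<le> ennreal t"
      "ennreal t < jump_time (\<lambda>n \<omega>. H n (fst \<omega>)) (Suc n) \<omega>" for \<omega> t n
    using that by (intro X_eq) (auto simp: J space_pair_measure)
  show "AE \<omega> in M \<Otimes>\<^sub>M K. (\<lambda>n. jump_time (\<lambda>n \<omega>. H n (fst \<omega>)) n \<omega>) \<longlonglongrightarrow> \<infinity>"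
  proof -
    obtain N where N: "\<And>\<omega>. \<omega> \<in> space M - N \<Longrightarrow> (\<lambda>n. J n \<omega>) \<longlonglongrightarrow> \<infinity>" "N \<in> null_sets M"
      by (rule AE_E3[OF nonexplosion]) (rule that)
    have N': "\<omega> \<in> N" if "\<omega> \<in> space M" "\<not> (\<lambda>n. J n \<omega>) \<longlonglongrightarrow> \<infinity>" for \<omega>
      using N(1)[of \<omega>] that by blast
    have "N \<times> space K \<in> null_sets (M \<Otimes>\<^sub>M K)"
      using N(2) by (intro null_setsI) (auto simp: null_sets_def K.emeasure_pair_measure_Times)
    thus ?thesis
      by (rule AE_I') (use N' in \<open>auto simp: J space_pair_measure\<close>)
  qed
qed

text \<open>The stationary time lives on the enlarged space; the process lifted to that space is
  again a realization of the same jump data, so its Markov property is available there.\<close>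

lemma (in embedded_generator) resolvent_bound_if_stationary_times:
  assumes sst: "\<And>(M :: 'w measure) X. markov_jump_process M L (return_pmf z) X \<Longrightarrow>
      has_finite_strong_stationary_time M X \<mu>"
  shows "\<exists>c>0. \<forall>y. c * pmf \<mu> y \<le> res z y"
proof -
  obtain M :: "'w measure" and Y H X where P: "jump_process L \<mu> M (return_pmf z) Y H X"
    and X: "markov_jump_process M L (return_pmf z) X"
    by (rule exists_process[OF emb nonexplosive])
  from sst[OF X] obtain K :: "real measure" and T where K: "prob_space K"
    and T: "strong_stationary_time (M \<Otimes>\<^sub>M K) (\<lambda>t \<omega>. X t (fst \<omega>)) \<mu> T"
    and fin: "AE \<omega> in M \<Otimes>\<^sub>M K. T \<omega> < \<infinity>"
    unfolding has_finite_strong_stationary_time_def by blast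
  obtain \<G> where \<G>: "sigma_algebra (space (M \<Otimes>\<^sub>M K)) \<G>"
    "prob_space.indep_set (M \<Otimes>\<^sub>M K) \<G> (sets (natural_filtration (M \<Otimes>\<^sub>M K) (\<lambda>t \<omega>. X t (fst \<omega>)) \<infinity>))"
    "stopping_time (\<lambda>t. sigma (space (M \<Otimes>\<^sub>M K)) (sets (natural_filtration (M \<Otimes>\<^sub>M K) (\<lambda>t \<omega>. X t (fst \<omega>)) t) \<union> \<G>)) T"
    using T unfolding strong_stationary_time_def randomized_stopping_time_def by blast
  interpret P2: jump_process L \<mu> "M \<Otimes>\<^sub>M K" "return_pmf z" "\<lambda>n \<omega>. Y n (fst \<omega>)" "\<lambda>n \<omega>. H n (fst \<omega>)" "\<lambda>t \<omega>. X t (fst \<omega>)"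
    by (rule jump_process.jump_process_pair[OF P K])
  interpret S: randomized_stopping L \<mu> "M \<Otimes>\<^sub>M K" "return_pmf z" "\<lambda>n \<omega>. Y n (fst \<omega>)" "\<lambda>n \<omega>. H n (fst \<omega>)" "\<lambda>t \<omega>. X t (fst \<omega>)" \<G> T
  proof (intro randomized_stopping.intro randomized_stopping_axioms.intro P2.jump_process_axioms)
    show "\<forall>\<^sub>F s in at_right t. X s (fst \<omega>) = X t (fst \<omega>)" if "\<omega> \<in> space (M \<Otimes>\<^sub>M K)" "t \<ge> 0" for \<omega> t
      using X that by (auto simp: markov_jump_process_def space_pair_measure)
  qed (fact \<G>)+
  show ?thesis
    using T unfolding strong_stationary_time_def
    by (intro S.resolvent_lower_bound[OF _ fin res_stationary refl]) auto
qed

text \<open>The bound at one \<open>z\<close> gives a minorization from all states at once, so the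
  stopping rule works for every initial law.\<close>

lemma (in embedded_generator) stationary_times_if_resolvent_bound:
  fixes M :: "'w measure"
  assumes c: "c > 0" "\<And>y. c * pmf \<mu> y \<le> res z y"
    and X: "markov_jump_process M L \<mu>0 X"
  shows "has_finite_strong_stationary_time M X \<mu>"
proof -
  from X obtain Y H where YH: "jump_chain_holding M L \<mu>0 Y H"
    and XY: "\<And>\<omega> t n. \<omega> \<in> space M \<Longrightarrow> t \<ge> 0 \<Longrightarrow> jump_time H n \<omega> \<le> ennreal t \<Longrightarrow>
      ennreal t < jump_time H (Suc n) \<omega> \<Longrightarrow> X t \<omega> = Y n \<omega>"
    unfolding markov_jump_process_def by blast
  obtain h \<epsilon> where h: "h > 0" "0 < \<epsilon>" "\<epsilon> < 1" "\<And>x y. ennreal (\<epsilon> * pmf \<mu> y) \<le> trans_prob x h y"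
    by (rule doeblin_minorization[OF c]) (rule that)
  interpret P: minorized_process L \<mu> M \<mu>0 Y H X h \<epsilon>
  proof
    show "jump_chain_holding M L \<mu>0 Y H" by fact
    show "AE \<omega> in M. (\<lambda>n. jump_time H n \<omega>) \<longlonglongrightarrow> \<infinity>"
      using nonexplosive YH by (auto simp: nonexplosive_def)
    show "X t \<in> measurable M (count_space UNIV)" if "t \<ge> 0" for t
      using X that by (simp add: markov_jump_process_def)
    show "trans_prob x h y \<le> 1" for x y using h(1) by (intro trans_le_1) simp
  qed (use h XY in auto)
  show ?thesis by (rule P.has_finite_sst)
qed

theorem theorem1p1:
  fixes E :: "'a::countable \<Rightarrow> 'a \<Rightarrow> bool"
    and L :: "'a \<Rightarrow> 'a \<Rightarrow> real"
    and \<mu> :: "'a pmf"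
    and N :: nat
    and Q :: "nat \<Rightarrow> 'a set"
    and \<phi> :: "nat \<Rightarrow> nat \<Rightarrow> 'a"
    and emb :: "real \<Rightarrow> 'w"
  assumes "inj emb" \<comment> \<open>the type of sample points is large enough\<close>
    and "symp E" and "irreflp E"
    and "connected_vertices E UNIV"
    and "\<nexists>f. graph_iso UNIV int_adj UNIV E f"
    and "\<And>x. finite {y. E x y}"
    and "bij_betw Q {1..N} {B. infinite_branch E B}"
    and "finite (- (\<Union>i\<in>{1..N}. Q i))"
    and "\<And>i. i \<in> {1..N} \<Longrightarrow> graph_iso UNIV nat_adj (Q i) E (\<phi> i)"
    and "generator L"
    and "\<And>x y. x \<noteq> y \<Longrightarrow> L x y \<noteq> 0 \<longleftrightarrow> E x y"
    and "positive_recurrent TYPE('w) L"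
    and "nonexplosive TYPE('w) L"
    and "stationary L \<mu>"
    and "reversible L \<mu>"
    and "(\<lambda>p. pmf \<mu> p * \<bar>L p p\<bar>) summable_on UNIV"
  shows
    "(\<forall>\<mu>0. \<forall>(M :: 'w measure) X. markov_jump_process M L \<mu>0 X \<longrightarrow>
         has_finite_strong_stationary_time M X \<mu>)
     \<longleftrightarrow>
     (\<forall>i\<in>{1..N}.
         (\<lambda>j. branch_measure L (\<phi> i) (j + 1) *
            (\<Sum>k=1..j. 1 / (branch_measure L (\<phi> i) k * L (\<phi> i k) (\<phi> i (k + 1)))))
         summable_on {1..})"
proof -
  have E_sym: "E x y \<longleftrightarrow> E y x" for x y using \<open>symp E\<close> by (auto dest: sympD)
  have E_neq: "E x y \<Longrightarrow> x \<noteq> y" for x y using \<open>irreflp E\<close> by (auto dest: irreflpD)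
  have adj: "(z \<noteq> y \<and> L z y \<noteq> 0) \<longleftrightarrow> E y z" for y z
    using assms(11)[of z y] E_neq E_sym by blast
  have adj': "(u \<noteq> v \<and> L u v \<noteq> 0) \<longleftrightarrow> E u v" for u v
    using adj[of u v] E_sym[of u v] by simp
  interpret embedded_generator L \<mu> emb
  proof
    show "finite {z. z \<noteq> y \<and> L z y \<noteq> 0}" for y
      unfolding adj using assms(6) .
    show "(\<lambda>u v. u \<noteq> v \<and> L u v \<noteq> 0)\<^sup>*\<^sup>* x y" for x y
      using \<open>connected_vertices E UNIV\<close> unfolding connected_vertices_def adj' by simp
  qed (use assms in auto)
  have nbrs: "nbrs y = {z. E y z}" for y
    unfolding nbrs_def adj ..
  have range: "range (\<phi> i) = Q i" and inj: "inj (\<phi> i)" and branch: "generator_branch L \<mu> (\<phi> i)"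
    if i: "i \<in> {1..N}" for i
  proof -
    have iso: "bij_betw (\<phi> i) UNIV (Q i)" "\<And>n m. nat_adj n m \<longleftrightarrow> E (\<phi> i n) (\<phi> i m)"
      using assms(9)[OF i] by (auto simp: graph_iso_def)
    show "range (\<phi> i) = Q i" and inj: "inj (\<phi> i)"
      using iso(1) by (auto simp: bij_betw_def)
    have "infinite_branch E (Q i)"
      using assms(7) i by (auto simp: bij_betw_def)
    hence card: "card {y. E (\<phi> i n) y} = 2" for n
      using iso(1) by (auto simp: infinite_branch_def branch_candidate_def bij_betw_def)
    show "generator_branch L \<mu> (\<phi> i)"
    proof
      show "inj (\<phi> i)" by (rule inj)
      show "(\<lambda>p. pmf \<mu> p * \<bar>L p p\<bar>) summable_on UNIV" by fact
      fix n :: nat assume "n > 0"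
      \<comment> \<open>The isomorphism provides two neighbours on the branch, and degree 2 excludes
        any other.\<close>
      have "{\<phi> i (n - 1), \<phi> i (n + 1)} \<subseteq> {y. E (\<phi> i n) y}"
        using \<open>n > 0\<close> iso(2)[of n "n - 1"] iso(2)[of n "n + 1"] by (auto simp: nat_adj_def)
      moreover have "card {\<phi> i (n - 1), \<phi> i (n + 1)} = 2"
        using \<open>n > 0\<close> by (simp add: inj_eq[OF inj])
      ultimately show "nbrs (\<phi> i n) = {\<phi> i (n - 1), \<phi> i (n + 1)}"
        unfolding nbrs using card_subset_eq[OF assms(6)] card[of n] by metis
    qed
  qed
  show ?thesis
  proof (intro iffI ballI allI impI)
    fix i assume *: "\<forall>\<mu>0. \<forall>(M :: 'w measure) X. markov_jump_process M L \<mu>0 X \<longrightarrow>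
      has_finite_strong_stationary_time M X \<mu>" and i: "i \<in> {1..N}"
    interpret B: generator_branch L \<mu> "\<phi> i" by (rule branch[OF i])
    have "\<exists>c>0. \<forall>y. c * pmf \<mu> y \<le> res (\<phi> i 0) y"
      by (rule resolvent_bound_if_stationary_times) (rule *[rule_format])
    then obtain c where "c > 0" "\<And>y. c * pmf \<mu> y \<le> res (\<phi> i 0) y" by blast
    thus "(\<lambda>j. branch_measure L (\<phi> i) (j + 1) *
            (\<Sum>k=1..j. 1 / (branch_measure L (\<phi> i) k * L (\<phi> i k) (\<phi> i (k + 1)))))
         summable_on {1..}"
      by (rule B.summable_if_res_bounded_below)
  next
    fix \<mu>0 and M :: "'w measure" and X
    assume b: "\<forall>i\<in>{1..N}. (\<lambda>j. branch_measure L (\<phi> i) (j + 1) *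
            (\<Sum>k=1..j. 1 / (branch_measure L (\<phi> i) k * L (\<phi> i k) (\<phi> i (k + 1)))))
         summable_on {1..}"
      and X: "markov_jump_process M L \<mu>0 X"
    \<comment> \<open>An arbitrary vertex serves as the centre of the minorization.\<close>
    define z :: 'a where "z = undefined"
    have "\<exists>d>0. \<forall>y\<in>Q i. d * pmf \<mu> y \<le> res z y" if i: "i \<in> {1..N}" for i
    proof -
      interpret B: generator_branch L \<mu> "\<phi> i" by (rule branch[OF i])
      show ?thesis
        using B.res_bounded_below_if_summable[OF b[rule_format, OF i], of z] unfolding range[OF i, symmetric] by blast
    qed
    then obtain d where d: "\<And>i. i \<in> {1..N} \<Longrightarrow> d i > 0" "\<And>i y. i \<in> {1..N} \<Longrightarrow> y \<in> Q i \<Longrightarrow> d i * pmf \<mu> y \<le> res z y"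
      by metis
    define R where "R = - (\<Union>i\<in>{1..N}. Q i)"
    \<comment> \<open>Outside the branches there are finitely many vertices, each with a positive
      ratio, so a finite minimum gives the global constant. The element 1 makes the set visibly
      nonempty.\<close>
    define S where "S = insert 1 (d ` {1..N} \<union> (\<lambda>y. res z y / pmf \<mu> y) ` R)"
    have S: "finite S" "S \<noteq> {}" using assms(8) by (auto simp: S_def R_def)
    have "Min S > 0"
      using S d(1) res_pos mu_pos by (subst Min_gr_iff) (auto simp: S_def)
    moreover have "Min S * pmf \<mu> y \<le> res z y" for y
    proof (cases "y \<in> R")
      case True
      hence "Min S \<le> res z y / pmf \<mu> y" using S by (intro Min_le) (auto simp: S_def)
      thus ?thesis using mu_pos[of y] by (simp add: pos_le_divide_eq)
    next
      case False
      then obtain i where i: "i \<in> {1..N}" "y \<in> Q i" by (auto simp: R_def)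
      hence "Min S \<le> d i" using S by (intro Min_le) (auto simp: S_def)
      hence "Min S * pmf \<mu> y \<le> d i * pmf \<mu> y" by (rule mult_right_mono) simp
      also have "\<dots> \<le> res z y" by (rule d(2)[OF i])
      finally show ?thesis .
    qed
    ultimately show "has_finite_strong_stationary_time M X \<mu>"
      using X by (rule stationary_times_if_resolvent_bound)
  qed
qed

end
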